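(* For $T>0$ let $R_T$ be the set of all conjugacy classes in $\mathcal{P}=\mathrm{PSL}(2,\mathbb{Z}[i])$ of reversible loxodromic elements whose trace $\mu$ (well defined up to sign) has norm $N(\mu)=|\mu|^2\le T$. Then, as $T\to\infty$, $$|R_T|=\frac{3\pi}{32\,G}\,T(\log T)^{2}+O\bigl(T\log T(\log\log T)^{2}\bigr),$$ where $G=L(2,\chi_{-4})=\sum_{n\ge0}\frac{(-1)^n}{(2n+1)^2}$ is Catalan's constant.
   Context: $\mathbb{Z}[i]$ is the ring of Gaussian integers and $N(z)=|z|^2$. An element of $\mathrm{PSL}(2,\mathbb{C})$ is elliptic if it fixes a point of hyperbolic space $\mathbb{H}^3$, and loxodromic if it is not elliptic and has exactly two fixed points on $\partial\mathbb{H}^3=\mathbb{C}\cup\{\infty\}$. An element $g$ of a group is reversible if it is conjugate in that group to $g^{-1}$. The trace of an element of $\mathrm{PSL}(2,\mathbb{Z}[i])$ is the trace of a lift to $\mathrm{SL}(2,\mathbb{Z}[i])$, defined up to sign; its norm is constant on conjugacy classes. *)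

theory Defs
  imports "HOL-Analysis.Analysis" "HOL-Algebra.Coset" "HOL-Library.Landau_Symbols"
begin

section \<open>The groups \<open>SL(2,S)\<close> and \<open>PSL(2,S)\<close>\<close>

definition gaussian_ints :: "complex set" where
  "gaussian_ints = {z. Re z \<in> \<int> \<and> Im z \<in> \<int>}"

definition SL2 :: "complex set \<Rightarrow> (complex^2^2) monoid" where
  "SL2 S = \<lparr>carrier = {A. (\<forall>i j. A $ i $ j \<in> S) \<and> det A = 1}, mult = (**), one = mat 1\<rparr>"

definition PSL2 :: "complex set \<Rightarrow> (complex^2^2) set monoid" where
  "PSL2 S = SL2 S Mod {mat 1, - mat 1}"

text \<open>
  An element of \<^term>\<open>PSL2 S\<close> is the set \<open>{A, - A}\<close> of its lifts to \<^term>\<open>SL2 S\<close>. In particular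
  \<^term>\<open>PSL2 S\<close> is literally contained in \<^term>\<open>PSL2 UNIV\<close>, that is, in \<open>PSL(2,\<complex>)\<close>.
\<close>

locale complex_subring =
  fixes S :: "complex set"
  assumes zero_mem: "0 \<in> S" and one_mem: "1 \<in> S"
    and add_mem: "x \<in> S \<Longrightarrow> y \<in> S \<Longrightarrow> x + y \<in> S"
    and mult_mem: "x \<in> S \<Longrightarrow> y \<in> S \<Longrightarrow> x * y \<in> S"
    and uminus_mem: "x \<in> S \<Longrightarrow> - x \<in> S"

lemma complex_subring_UNIV: "complex_subring UNIV"
  by unfold_locales auto

lemma complex_subring_gaussian_ints: "complex_subring gaussian_ints"
  by unfold_locales (auto simp: gaussian_ints_def)

lemma mat_eq_2_iff:
  "(A :: complex^2^2) = B \<longleftrightarrow>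
     A$1$1 = B$1$1 \<and> A$1$2 = B$1$2 \<and> A$2$1 = B$2$1 \<and> A$2$2 = B$2$2"
  by (auto simp: vec_eq_iff forall_2)

lemma matrix_mult_2: "((A :: complex^2^2) ** B) $ i $ j = A$i$1 * B$1$j + A$i$2 * B$2$j"
  by (simp add: matrix_matrix_mult_def sum_2)

lemma mat_uminus_mult:
  "(- A) ** B = - (A ** B)" "A ** (- B) = - (A ** B)" for A B :: "complex^2^2"
  by (simp_all add: mat_eq_2_iff matrix_mult_2)

lemma det_uminus_2: "det (- A) = det A" for A :: "complex^2^2"
  by (simp add: det_2)

context complex_subring
begin

lemma group_SL2: "group (SL2 S)"
proof (rule groupI, goal_cases)
  case (1 A B)
  then show ?case
    by (auto simp: SL2_def det_mul matrix_mult_2 intro!: add_mem mult_mem)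
next
  case 2
  then show ?case
    by (auto simp: SL2_def mat_def zero_mem one_mem det_2)
next
  case (3 A B C)
  then show ?case by (simp add: SL2_def matrix_mul_assoc)
next
  case (4 A)
  then show ?case by (simp add: SL2_def)
next
  case (5 A)
  let ?B = "(\<chi> i j. if i = 1 then (if j = 1 then A$2$2 else - A$1$2)
                     else (if j = 1 then - A$2$1 else A$1$1)) :: complex^2^2"
  from 5 have A: "A$i$j \<in> S" "A$1$1 * A$2$2 - A$1$2 * A$2$1 = 1" for i j
    by (auto simp: SL2_def det_2)
  have "?B ** A = mat 1"
    using A(2) by (auto simp: mat_eq_2_iff matrix_mult_2 mat_def algebra_simps)
  moreover have "?B \<in> carrier (SL2 S)"
    using A by (auto simp: SL2_def det_2 algebra_simps intro: uminus_mem)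
  ultimately show ?case
    by (intro bexI[of _ ?B]) (simp_all add: SL2_def)
qed

lemma normal_center: "{mat 1, - mat 1} \<lhd> SL2 S"
proof -
  interpret group "SL2 S" by (rule group_SL2)
  have sub: "{mat 1, - mat 1} \<subseteq> carrier (SL2 S)"
    using one_closed by (auto simp: SL2_def det_uminus_2 intro: uminus_mem)
  have mm: "(- mat 1) \<otimes>\<^bsub>SL2 S\<^esub> (- mat 1) = \<one>\<^bsub>SL2 S\<^esub>"
    by (simp add: SL2_def mat_uminus_mult)
  have inv: "inv\<^bsub>SL2 S\<^esub> (- mat 1) = - mat 1"
    by (rule inv_equality) (use mm sub in auto)
  have "subgroup {mat 1, - mat 1} (SL2 S)"
  proof (unfold_locales, goal_cases)
    case 1 show ?case by (rule sub)
  next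
    case (2 x y) then show ?case by (auto simp: SL2_def mat_uminus_mult)
  next
    case 3 show ?case by (simp add: SL2_def)
  next
    case (4 x)
    have "inv\<^bsub>SL2 S\<^esub> (mat 1) = mat 1"
      using inv_one by (simp add: SL2_def)
    then show ?case using 4 inv by auto
  qed
  then show ?thesis
    by (rule normalI)
       (auto simp: r_coset_def l_coset_def SL2_def mat_uminus_mult)
qed

lemma group_PSL2: "group (PSL2 S)"
  unfolding PSL2_def by (rule normal.factorgroup_is_group[OF normal_center])

end

lemma carrier_PSL2: "carrier (PSL2 S) = {{A, - A} | A. A \<in> carrier (SL2 S)}"
  by (auto simp: PSL2_def FactGroup_def RCOSETS_def r_coset_def SL2_def mat_uminus_mult)

lemma PSL2_gaussian_ints_subset: "carrier (PSL2 gaussian_ints) \<subseteq> carrier (PSL2 UNIV)"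
  unfolding carrier_PSL2 by (auto simp: SL2_def)


section \<open>Elliptic and loxodromic elements\<close>

text \<open>Hyperbolic 3-space in the upper half-space model.\<close>

definition hyp3 :: "(complex \<times> real) set" where
  "hyp3 = {(z, t). t > 0}"

text \<open>
  The Poincare extension of the Moebius transformation of a matrix of determinant 1, i.e.
  \<open>P \<mapsto> (a P + b) (c P + d)\<inverse>\<close> for the quaternion \<open>P = z + t j\<close>.
\<close>

definition hyp3_act :: "complex^2^2 \<Rightarrow> complex \<times> real \<Rightarrow> complex \<times> real" where
  "hyp3_act A = (\<lambda>(z, t).
     let a = A$1$1; b = A$1$2; c = A$2$1; d = A$2$2;
         q = (cmod (c * z + d))\<^sup>2 + (cmod c)\<^sup>2 * t\<^sup>2
     in (((a * z + b) * cnj (c * z + d) + a * cnj c * (of_real t)\<^sup>2) / of_real q, t / q))"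

text \<open>The boundary \<open>\<complex> \<union> {\<infinity>}\<close> is \<^typ>\<open>complex option\<close>, with \<^term>\<open>None\<close> for \<open>\<infinity>\<close>.\<close>

definition boundary_act :: "complex^2^2 \<Rightarrow> complex option \<Rightarrow> complex option" where
  "boundary_act A w =
     (let a = A$1$1; b = A$1$2; c = A$2$1; d = A$2$2
      in case w of
           None \<Rightarrow> if c = 0 then None else Some (a / c)
         | Some z \<Rightarrow> if c * z + d = 0 then None else Some ((a * z + b) / (c * z + d)))"

text \<open>
  Both lifts of an element of \<open>PSL(2,\<complex>)\<close> act in the same way, so quantifying over all
  lifts in the following definitions is the same as choosing one of them.
\<close>

lemma hyp3_act_uminus: "hyp3_act (- A) = hyp3_act A"
proof -
  have 1: "- x - y = - (x + y)" for x y :: complex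
    by simp
  show ?thesis
    by (rule ext)
       (simp only: hyp3_act_def Let_def vector_uminus_component mult_minus_left mult_minus_right
          add_uminus_conv_diff 1 norm_minus_cancel complex_cnj_minus minus_minus)
qed

lemma boundary_act_uminus: "boundary_act (- A) = boundary_act A"
proof -
  have 1: "- x - y = - (x + y)" for x y :: complex
    by simp
  have 2: "(- x) / (- y) = x / y" for x y :: complex
    by simp
  show ?thesis
    by (rule ext)
       (simp only: boundary_act_def Let_def vector_uminus_component mult_minus_left
          add_uminus_conv_diff 1 2 neg_equal_0_iff_equal)
qed

definition elliptic :: "(complex^2^2) set \<Rightarrow> bool" where
  "elliptic g \<longleftrightarrow> (\<exists>p\<in>hyp3. \<forall>A\<in>g. hyp3_act A p = p)"

definition loxodromic :: "(complex^2^2) set \<Rightarrow> bool" where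
  "loxodromic g \<longleftrightarrow> \<not> elliptic g \<and> card {w. \<forall>A\<in>g. boundary_act A w = w} = 2"

definition trace_norm :: "(complex^2^2) set \<Rightarrow> real" where
  "trace_norm g = (THE r. \<exists>A\<in>g. r = (cmod (trace A))\<^sup>2)"

lemma trace_norm_lifts: "trace_norm {A, - A} = (cmod (trace A))\<^sup>2"
proof -
  have "trace (- A) = - trace A"
    by (simp add: trace_def sum_negf)
  then show ?thesis
    by (auto simp: trace_norm_def)
qed


section \<open>Conjugacy and reversibility\<close>

definition conj_class :: "('a, 'b) monoid_scheme \<Rightarrow> 'a \<Rightarrow> 'a set" where
  "conj_class G g = {x \<otimes>\<^bsub>G\<^esub> g \<otimes>\<^bsub>G\<^esub> inv\<^bsub>G\<^esub> x | x. x \<in> carrier G}"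

definition reversible :: "('a, 'b) monoid_scheme \<Rightarrow> 'a \<Rightarrow> bool" where
  "reversible G g \<longleftrightarrow> inv\<^bsub>G\<^esub> g \<in> conj_class G g"

definition rev_lox_classes :: "real \<Rightarrow> (complex^2^2) set set set" where
  "rev_lox_classes T = {conj_class (PSL2 gaussian_ints) g | g.
     g \<in> carrier (PSL2 gaussian_ints) \<and> reversible (PSL2 gaussian_ints) g \<and>
     loxodromic g \<and> trace_norm g \<le> T}"

definition catalan :: real where
  "catalan = (\<Sum>n. (-1) ^ n / (2 * real n + 1)\<^sup>2)"

end

theory Submission
  imports Defs "HOL-Number_Theory.Number_Theory" "HOL-Real_Asymp.Real_Asymp"
begin

text \<open>
  A reversible loxodromic element is inverted by an element of trace 0 and is therefore a product
  \<open>x y\<close> of two such involutions. Its centralizer modulo \<open>\<plusminus>1\<close> is infinite cyclic up to odd torsion, so a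
  class has exactly two such factorisations up to conjugation and signs. Over the Gaussian integers
  the involutions have primitive eigenvectors \<open>v\<close>, \<open>w\<close> for the eigenvalue \<open>\<i>\<close>. Moving \<open>v\<close> to \<open>(1, 0)\<close> and \<open>w\<close>
  to \<open>(u, s)\<close>, with \<open>u\<close> a unit modulo \<open>s\<close>, leaves two free parameters \<open>W\<close>, \<open>Q\<close> in fixed residue classes
  modulo \<open>s\<close>, and the trace is \<open>Q W + 2\<close>. Choosing signs that minimise \<open>|s|\<close> amounts, up to constants, to
  \<open>|s| \<le> |W|\<close> and \<open>|s| \<le> |Q|\<close>; each such tuple set is an elementary divisor problem for lattice points, with
  main term \<open>\<pi>\<^sup>2 (T / |s|^4) log (T / |s|^4)\<close> for each of the \<open>\<phi>(s)\<close> values of \<open>u\<close> and total error \<open>O(T log T)\<close>.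
  The sum over \<open>s\<close> follows from the convolution identity \<open>\<Sum> \<phi>(d) = 4 |n|\<^sup>2\<close> over divisors \<open>d\<close> of \<open>n\<close> (units
  included), and the constant from \<open>\<Sum> |z|^-4 = 4 \<zeta>(2) G\<close>, which is Jacobi's two-square theorem.
\<close>

section \<open>Gaussian integers\<close>

text \<open>The obstacle is that the sign choice with smallest |s| cannot be read off exactly: the
  other determinants equal W, Q and (Q W + 4) / s only up to contents dividing 2. So no exact
  fundamental domain is described. Instead 16 |R_T| is squeezed between two counts of tuples with
  |W|^2 and |Q|^2 at least C |s|^2: for C = 1 every minimal tuple is included, for C = 9 every tuple
  is the unique minimum among its signs. The squeeze is affordable because C enters the count of
  lattice pairs only through log (Z / C^2), hence only through the O(T log T) error; passing from
  the trace Q W + 2 to Q W replaces T by (sqrt T + 2)^2 or (sqrt T - 2)^2, with an even smaller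
  effect. Since u runs through all units modulo s, every lattice estimate has to be uniform in the
  residue class; this is why the circle problem is stated for arbitrarily shifted lattices from the
  start.\<close>

abbreviation "ZI \<equiv> gaussian_ints"

text \<open>
  Ideal membership certificates: an equation is checked by writing the difference of its sides as
  a combination of known equations.
\<close>

lemma eq_of_diff_multiple: "x = y \<Longrightarrow> u - v = k * (x - y) \<Longrightarrow> u = v" for u v x y k :: "'a :: comm_ring"
  by simp

lemma eq_of_diff_combination: "x = y \<Longrightarrow> x' = y' \<Longrightarrow> u - v = k * (x - y) + k' * (x' - y') \<Longrightarrow> u = v"
  for u v x y x' y' k k' :: "'a :: comm_ring"
  by simp

lemma ZI_simps [simp, intro]: "0 \<in> ZI" "1 \<in> ZI" "\<i> \<in> ZI" "2 \<in> ZI"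
  by (auto simp: gaussian_ints_def)

lemma ZI_closed [intro]:
  assumes "x \<in> ZI" "y \<in> ZI"
  shows "x + y \<in> ZI" "x - y \<in> ZI" "x * y \<in> ZI"
  using assms by (auto simp: gaussian_ints_def)

lemma ZI_uminus_iff [simp]: "- x \<in> ZI \<longleftrightarrow> x \<in> ZI"
  by (auto simp: gaussian_ints_def)

lemma ZI_cnj [intro]: "x \<in> ZI \<Longrightarrow> cnj x \<in> ZI"
  by (auto simp: gaussian_ints_def)

lemma ZI_Complex: "Complex (of_int a) (of_int b) \<in> ZI"
  by (auto simp: gaussian_ints_def)

lemma ZI_cases:
  assumes "z \<in> ZI"
  obtains a b :: int where "z = Complex (of_int a) (of_int b)"
proof -
  from assms obtain a b where "Re z = of_int a" "Im z = of_int b"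
    unfolding gaussian_ints_def by (auto elim!: Ints_cases)
  then have "z = Complex (of_int a) (of_int b)" by (simp add: complex_eq_iff)
  then show thesis by (rule that)
qed

lemma ZI_norm_nat:
  assumes "z \<in> ZI"
  obtains n :: nat where "(cmod z)\<^sup>2 = real n"
proof -
  from assms obtain a b where z: "z = Complex (of_int a) (of_int b)" by (rule ZI_cases)
  have "(cmod z)\<^sup>2 = of_int (a\<^sup>2 + b\<^sup>2)"
    by (simp add: z cmod_power2)
  also have "\<dots> = real (nat (a\<^sup>2 + b\<^sup>2))"
    by simp
  finally show thesis by (rule that)
qed

lemma ZI_norm_ge_1:
  assumes "z \<in> ZI" "z \<noteq> 0"
  shows "(cmod z)\<^sup>2 \<ge> 1" "cmod z \<ge> 1"
proof -
  obtain n :: nat where n: "(cmod z)\<^sup>2 = real n" using assms(1) by (rule ZI_norm_nat)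
  with assms(2) have "n \<noteq> 0" by (metis of_nat_0 norm_eq_zero power_eq_0_iff)
  then show "(cmod z)\<^sup>2 \<ge> 1" using n by simp
  then show "cmod z \<ge> 1"
    using power2_le_imp_le[of 1 "cmod z"] by simp
qed

definition gfloor :: "complex \<Rightarrow> complex" where
  "gfloor z = Complex (of_int \<lfloor>Re z\<rfloor>) (of_int \<lfloor>Im z\<rfloor>)"

lemma gfloor_ZI [simp, intro]: "gfloor z \<in> ZI"
  by (simp add: gfloor_def ZI_Complex)

lemma gfloor_add: "k \<in> ZI \<Longrightarrow> gfloor (z + k) = gfloor z + k"
  by (erule ZI_cases) (simp add: gfloor_def complex_eq_iff)

lemma gfloor_eq_0_iff: "gfloor z = 0 \<longleftrightarrow> 0 \<le> Re z \<and> Re z < 1 \<and> 0 \<le> Im z \<and> Im z < 1"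
  by (auto simp: gfloor_def complex_eq_iff floor_eq_iff)

lemma gfloor_diff_eq_0: "gfloor (z - gfloor z) = 0"
  using gfloor_add[of "- gfloor z" z] by simp

text \<open>The half-open unit square meets each class modulo Z[i] exactly once; this is uniqueness,
  \<open>gfloor_diff_eq_0\<close> is existence.\<close>

lemma gfloor_eq_0_diff_ZI:
  assumes "gfloor z = 0" "gfloor w = 0" "z - w \<in> ZI"
  shows "z = w"
proof -
  have "gfloor (w + (z - w)) = gfloor w + (z - w)" using assms(3) by (rule gfloor_add)
  then show ?thesis using assms by simp
qed

text \<open>Rounding loses at most 1/2 in each coordinate. A bound below 1 is what makes Z[i]
  norm-Euclidean.\<close>

lemma ZI_round:
  obtains k where "k \<in> ZI" "(cmod (z - k))\<^sup>2 \<le> 1 / 2"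
proof
  let ?k = "Complex (of_int (round (Re z))) (of_int (round (Im z)))"
  show "?k \<in> ZI" by (rule ZI_Complex)
  have "\<bar>Re z - of_int (round (Re z))\<bar> \<le> 1 / 2" "\<bar>Im z - of_int (round (Im z))\<bar> \<le> 1 / 2"
    using of_int_round_abs_le[of "Re z"] of_int_round_abs_le[of "Im z"]
    by (simp_all add: abs_minus_commute)
  then have "(Re z - of_int (round (Re z)))\<^sup>2 \<le> (1 / 2)\<^sup>2" "(Im z - of_int (round (Im z)))\<^sup>2 \<le> (1 / 2)\<^sup>2"
    using abs_le_square_iff[of "Re z - of_int (round (Re z))" "1 / 2"]
      abs_le_square_iff[of "Im z - of_int (round (Im z))" "1 / 2"] by auto
  moreover have "(cmod (z - ?k))\<^sup>2 = (Re z - of_int (round (Re z)))\<^sup>2 + (Im z - of_int (round (Im z)))\<^sup>2"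
    by (simp add: cmod_power2)
  ultimately show "(cmod (z - ?k))\<^sup>2 \<le> 1 / 2"
    by (simp add: power_divide)
qed

lemma finite_ZI_shift: "finite {z. z - \<theta> \<in> ZI \<and> (cmod z)\<^sup>2 \<le> R}"
proof -
  define r where "r = sqrt \<bar>R\<bar> + cmod \<theta>"
  have "{z. z - \<theta> \<in> ZI \<and> (cmod z)\<^sup>2 \<le> R} \<subseteq>
     (\<lambda>(a, b). Complex (of_int a) (of_int b) + \<theta>) ` ({\<lfloor>-r\<rfloor>..\<lceil>r\<rceil>} \<times> {\<lfloor>-r\<rfloor>..\<lceil>r\<rceil>})"
  proof
    fix z assume "z \<in> {z. z - \<theta> \<in> ZI \<and> (cmod z)\<^sup>2 \<le> R}"
    then have z: "z - \<theta> \<in> ZI" "(cmod z)\<^sup>2 \<le> R" by auto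
    obtain a b where ab: "z - \<theta> = Complex (of_int a) (of_int b)" using z(1) by (rule ZI_cases)
    have "cmod z \<le> sqrt \<bar>R\<bar>" using z(2) by (intro real_le_rsqrt) linarith
    then have "cmod (z - \<theta>) \<le> r" unfolding r_def using norm_triangle_ineq4[of z \<theta>] by linarith
    then have "\<bar>of_int a\<bar> \<le> r" "\<bar>of_int b\<bar> \<le> r"
      using abs_Re_le_cmod[of "z - \<theta>"] abs_Im_le_cmod[of "z - \<theta>"] ab by auto
    then have "a \<in> {\<lfloor>-r\<rfloor>..\<lceil>r\<rceil>}" "b \<in> {\<lfloor>-r\<rfloor>..\<lceil>r\<rceil>}"
      by (auto simp: abs_le_iff) linarith+
    then show "z \<in> (\<lambda>(a, b). Complex (of_int a) (of_int b) + \<theta>) ` ({\<lfloor>-r\<rfloor>..\<lceil>r\<rceil>} \<times> {\<lfloor>-r\<rfloor>..\<lceil>r\<rceil>})"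
      using ab by (intro image_eqI[of _ _ "(a, b)"]) (auto simp: algebra_simps)
  qed
  then show ?thesis by (rule finite_subset) auto
qed

lemma finite_ZI_ball: "finite {z \<in> ZI. (cmod z)\<^sup>2 \<le> R}"
  using finite_ZI_shift[of 0 R] by simp

section \<open>Divisibility, Bezout identities and units in Z[i]\<close>

definition gdvd :: "complex \<Rightarrow> complex \<Rightarrow> bool" where
  "gdvd a b \<longleftrightarrow> (\<exists>k\<in>ZI. b = a * k)"

text \<open>Coprimality is taken as a Bezout identity because this form directly yields matrices of
  determinant 1 and inverses modulo \<open>s\<close>.\<close>

definition gcop :: "complex \<Rightarrow> complex \<Rightarrow> bool" where
  "gcop a b \<longleftrightarrow> (\<exists>x\<in>ZI. \<exists>y\<in>ZI. x * a + y * b = 1)"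

text \<open>A nonzero element of least norm in the ideal of \<open>a\<close> and \<open>b\<close>
  divides the whole ideal: the remainder after rounding a quotient has at most half its
  norm.\<close>

lemma ZI_bezout:
  assumes a: "a \<in> ZI" and b: "b \<in> ZI" and ab: "a \<noteq> 0 \<or> b \<noteq> 0"
  obtains d x y where "d \<in> ZI" "d \<noteq> 0" "gdvd d a" "gdvd d b" "x \<in> ZI" "y \<in> ZI" "d = x * a + y * b"
proof -
  define I where "I = {d. d \<noteq> 0 \<and> (\<exists>x\<in>ZI. \<exists>y\<in>ZI. d = x * a + y * b)}"
  have "1 * a + 0 * b \<in> I \<or> 0 * a + 1 * b \<in> I"
  proof (cases "a = 0")
    case True
    then have "0 * a + 1 * b \<noteq> 0" using ab by auto
    then show ?thesis unfolding I_def using ZI_simps(1,2) by blast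
  next
    case False
    then have "1 * a + 0 * b \<noteq> 0" by auto
    then show ?thesis unfolding I_def using ZI_simps(1,2) by blast
  qed
  then obtain d0 where d0: "d0 \<in> I" by auto
  \<comment> \<open>Norms of Gaussian integers are natural numbers, so the floor loses nothing and
    well-ordering applies.\<close>
  have "\<exists>d. d \<in> I \<and> (\<forall>y. y \<in> I \<longrightarrow> nat \<lfloor>(cmod d)\<^sup>2\<rfloor> \<le> nat \<lfloor>(cmod y)\<^sup>2\<rfloor>)"
    using d0 by (rule ex_has_least_nat)
  then obtain d where d: "d \<in> I" and min0: "\<And>y. y \<in> I \<Longrightarrow> nat \<lfloor>(cmod d)\<^sup>2\<rfloor> \<le> nat \<lfloor>(cmod y)\<^sup>2\<rfloor>"
    by blast
  have IZ: "y \<in> ZI" if "y \<in> I" for y using that a b unfolding I_def by (auto intro!: ZI_closed)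
  have min: "(cmod d)\<^sup>2 \<le> (cmod y)\<^sup>2" if y: "y \<in> I" for y
  proof -
    obtain m n :: nat where "(cmod d)\<^sup>2 = real m" "(cmod y)\<^sup>2 = real n"
      using ZI_norm_nat[OF IZ[OF d]] ZI_norm_nat[OF IZ[OF y]] by metis
    with min0[OF y] show ?thesis by simp
  qed
  from d obtain x y where xy: "x \<in> ZI" "y \<in> ZI" "d = x * a + y * b" and dnz: "d \<noteq> 0"
    unfolding I_def by blast
  have dv: "gdvd d c" if c: "c = s * a + t * b" "s \<in> ZI" "t \<in> ZI" for c s t
  proof (rule ccontr)
    assume nd: "\<not> gdvd d c"
    obtain k where k: "k \<in> ZI" "(cmod (c / d - k))\<^sup>2 \<le> 1 / 2" by (rule ZI_round)
    have "c - d * k \<noteq> 0" using nd k(1) unfolding gdvd_def by auto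
    moreover have "c - d * k = (s - x * k) * a + (t - y * k) * b"
      using c(1) xy(3) by (simp add: algebra_simps)
    ultimately have "c - d * k \<in> I" using c k xy unfolding I_def by blast
    then have "(cmod d)\<^sup>2 \<le> (cmod (c - d * k))\<^sup>2" by (rule min)
    also have "c - d * k = d * (c / d - k)" using dnz by (simp add: algebra_simps)
    also have "(cmod \<dots>)\<^sup>2 = (cmod d)\<^sup>2 * (cmod (c / d - k))\<^sup>2" by (simp add: norm_mult power_mult_distrib)
    also have "\<dots> \<le> (cmod d)\<^sup>2 * (1 / 2)" using k(2) by (intro mult_left_mono) auto
    finally show False using dnz by simp
  qed
  have "gdvd d a" "gdvd d b" using dv[of a 1 0] dv[of b 0 1] by auto
  with dnz xy show thesis using IZ[OF d] that by blast
qed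

lemma ZI_coprime_part:
  assumes "a \<in> ZI" "b \<in> ZI" "a \<noteq> 0 \<or> b \<noteq> 0"
  obtains d a' b' where "d \<in> ZI" "d \<noteq> 0" "a' \<in> ZI" "b' \<in> ZI" "a = d * a'" "b = d * b'" "gcop a' b'"
proof -
  obtain d x y where d: "d \<in> ZI" "d \<noteq> 0" "gdvd d a" "gdvd d b" "x \<in> ZI" "y \<in> ZI" "d = x * a + y * b"
    using assms by (rule ZI_bezout)
  from d(3,4) obtain a' b' where ab: "a' \<in> ZI" "b' \<in> ZI" "a = d * a'" "b = d * b'"
    unfolding gdvd_def by auto
  have "d * 1 = x * (d * a') + y * (d * b')" using d(7) unfolding ab(3,4) by simp
  then have "d * 1 = d * (x * a' + y * b')" by (simp add: algebra_simps)
  then have "x * a' + y * b' = 1" using d(2) by (metis mult_left_cancel)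
  then have "gcop a' b'" using d unfolding gcop_def by blast
  with d ab that show thesis by blast
qed

definition gunits :: "complex set" where "gunits = {1, -1, \<i>, -\<i>}"

lemma ZI_unit:
  assumes "z \<in> ZI" "cmod z = 1"
  shows "z \<in> gunits"
proof -
  obtain a b where z: "z = Complex (of_int a) (of_int b)" using assms(1) by (rule ZI_cases)
  have "(cmod z)\<^sup>2 = of_int (a\<^sup>2 + b\<^sup>2)" by (simp add: z cmod_power2)
  then have e: "a\<^sup>2 + b\<^sup>2 = 1" using assms(2) by (metis of_int_eq_1_iff power_one)
  have "\<bar>a\<bar> \<le> 1" "\<bar>b\<bar> \<le> 1"
    using e abs_square_le_1[of a] abs_square_le_1[of b] zero_le_power2[of a] zero_le_power2[of b]
    by linarith+
  then have "a \<in> {-1,0,1}" "b \<in> {-1,0,1}" by auto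
  with e show ?thesis by (auto simp: z gunits_def complex_eq_iff)
qed

lemma gunits_ZI [simp, intro]: "z \<in> gunits \<Longrightarrow> z \<in> ZI"
  by (auto simp: gunits_def)

lemma gunits_norm: "z \<in> gunits \<Longrightarrow> cmod z = 1"
  by (auto simp: gunits_def)

lemma ZI_unit_mult:
  assumes "x \<in> ZI" "y \<in> ZI" "x * y = 1"
  shows "x \<in> gunits" "y \<in> gunits"
proof -
  have nz: "x \<noteq> 0" "y \<noteq> 0" using assms by auto
  have "cmod x * cmod y = 1" using assms(3) by (metis norm_mult norm_one)
  moreover have "cmod x \<ge> 1" "cmod y \<ge> 1" using nz assms ZI_norm_ge_1 by auto
  ultimately have "cmod x = 1" "cmod y = 1"
    by (smt (verit, best) mult_le_cancel_left1 mult_le_cancel_right1)+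
  then show "x \<in> gunits" "y \<in> gunits" using assms ZI_unit by auto
qed

lemma card_gunits: "card gunits = 4" and finite_gunits: "finite gunits"
  by (auto simp: gunits_def complex_eq_iff)

section \<open>Sums of two squares\<close>

definition chi4 :: "nat \<Rightarrow> int" where
  "chi4 n = (if n mod 4 = 1 then 1 else if n mod 4 = 3 then -1 else 0)"

lemma chi4_mult: "chi4 (m * n) = chi4 m * chi4 n"
proof -
  have "m mod 4 \<in> {0,1,2,3}" "n mod 4 \<in> {0,1,2,3}" by auto
  then show ?thesis
    unfolding chi4_def mod_mult_eq[of m 4 n, symmetric] by auto
qed

definition chi4_sum :: "nat \<Rightarrow> int" where "chi4_sum n = (\<Sum>d | d dvd n. chi4 d)"

text \<open>
  Jacobi's two-square theorem: divisor sums of the character modulo 4 and representation numbers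
  satisfy the same recursion from \<open>n\<close> to \<open>p * n\<close> for every prime \<open>p\<close>.
\<close>

lemma chi4_sum_prime:
  assumes p: "prime p" and n: "n > 0"
  shows "chi4_sum (p * n) = (1 + chi4 p) * chi4_sum n - chi4 p * (if p dvd n then chi4_sum (n div p) else 0)"
proof -
  let ?D = "{d. d dvd n}" and ?E = "(\<lambda>d. p * d) ` {d. d dvd n}"
  have p0: "p > 0" using p by (rule prime_gt_0_nat)
  have inj: "inj_on (\<lambda>d. p * d) X" for X using p0 by (auto simp: inj_on_def)
  \<comment> \<open>Inclusion-exclusion: the two families of divisors overlap in \<open>p\<close>
    times the divisors of \<open>n div p\<close>, which gives the correction term.\<close>
  have U: "{d. d dvd p * n} = ?D \<union> ?E"
  proof (intro equalityI subsetI)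
    fix d assume d: "d \<in> {d. d dvd p * n}"
    show "d \<in> ?D \<union> ?E"
    proof (cases "p dvd d")
      case True
      then obtain e where e: "d = p * e" by auto
      with d p0 have "e dvd n" by auto
      with e show ?thesis by auto
    next
      case False
      then have "coprime d p" using p by (metis prime_imp_coprime coprime_commute)
      with d have "d dvd n" by (auto simp: coprime_dvd_mult_right_iff)
      then show ?thesis by auto
    qed
  qed auto
  have I: "?D \<inter> ?E = (\<lambda>d. p * d) ` (if p dvd n then {d. d dvd n div p} else {})"
    using p0 by (auto elim!: dvdE)
  have fin: "finite ?D" "finite ?E" using n by auto
  have "chi4_sum (p * n) = sum chi4 ?D + sum chi4 ?E - sum chi4 (?D \<inter> ?E)"
    unfolding chi4_sum_def U by (rule sum_Un[OF fin])
  also have "sum chi4 ?E = chi4 p * chi4_sum n"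
    by (simp add: sum.reindex[OF inj] chi4_mult chi4_sum_def sum_distrib_left)
  also have "sum chi4 (?D \<inter> ?E) = chi4 p * (if p dvd n then chi4_sum (n div p) else 0)"
    unfolding I by (auto simp: sum.reindex[OF inj] chi4_mult chi4_sum_def sum_distrib_left)
  finally show ?thesis by (simp add: chi4_sum_def algebra_simps)
qed

definition two_sq :: "nat \<Rightarrow> (int \<times> int) set" where
  "two_sq n = {(a, b). a\<^sup>2 + b\<^sup>2 = int n}"

lemma finite_two_sq: "finite (two_sq n)"
proof (rule finite_subset)
  show "two_sq n \<subseteq> {- int n..int n} \<times> {- int n..int n}"
  proof
    fix z assume "z \<in> two_sq n"
    then obtain a b where z: "z = (a, b)" and ab: "a\<^sup>2 + b\<^sup>2 = int n" by (auto simp: two_sq_def)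
    have "\<bar>x\<bar> \<le> x\<^sup>2" for x :: int
      using self_le_power[of "\<bar>x\<bar>" 2] by (cases "x = 0") auto
    from this[of a] this[of b] have "\<bar>a\<bar> \<le> int n" "\<bar>b\<bar> \<le> int n"
      using ab zero_le_power2[of a] zero_le_power2[of b] by linarith+
    then show "z \<in> {- int n..int n} \<times> {- int n..int n}" by (auto simp: z)
  qed
qed auto

text \<open>Multiplication by the Gaussian integer a + b i in integer coordinates.\<close>

definition gmul :: "int \<Rightarrow> int \<Rightarrow> int \<times> int \<Rightarrow> int \<times> int" where
  "gmul a b = (\<lambda>(c, d). (a * c - b * d, a * d + b * c))"

lemma gmul_norm: "(a * c - b * d)\<^sup>2 + (a * d + b * c)\<^sup>2 = (a\<^sup>2 + b\<^sup>2) * (c\<^sup>2 + d\<^sup>2)" for a :: int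
  by (simp add: power2_eq_square algebra_simps)

lemma inj_gmul:
  assumes "a\<^sup>2 + b\<^sup>2 \<noteq> 0"
  shows "inj_on (gmul a b) X"
proof (rule inj_onI)
  fix z w assume zw: "gmul a b z = gmul a b w"
  obtain c d c' d' where [simp]: "z = (c, d)" "w = (c', d')" by (cases z; cases w) auto
  from zw have 1: "a * c - b * d = a * c' - b * d'" and 2: "a * d + b * c = a * d' + b * c'"
    by (auto simp: gmul_def)
  have "(a\<^sup>2 + b\<^sup>2) * c = a * (a * c - b * d) + b * (a * d + b * c)"
    by (simp add: power2_eq_square algebra_simps)
  also have "\<dots> = (a\<^sup>2 + b\<^sup>2) * c'" unfolding 1 2 by (simp add: power2_eq_square algebra_simps)
  finally have c: "c = c'" using assms mult_left_cancel by blast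
  have "(a\<^sup>2 + b\<^sup>2) * d = a * (a * d + b * c) - b * (a * c - b * d)"
    by (simp add: power2_eq_square algebra_simps)
  also have "\<dots> = (a\<^sup>2 + b\<^sup>2) * d'" unfolding 1 2 by (simp add: power2_eq_square algebra_simps)
  finally have "d = d'" using assms mult_left_cancel by blast
  with c show "z = w" by simp
qed

lemma two_sq_gmul:
  assumes "a\<^sup>2 + b\<^sup>2 = int p" "z \<in> two_sq n"
  shows "gmul a b z \<in> two_sq (p * n)"
  using assms by (cases z) (auto simp: two_sq_def gmul_def gmul_norm)

text \<open>The two divisibilities say that p = (a + b i)(a - b i) divides (e + f i)(a - b i), so
  that a + b i divides e + f i.\<close>

lemma two_sq_in_gmul:
  assumes ab: "a\<^sup>2 + b\<^sup>2 = int p" and p: "p > 0" and z: "(e, f) \<in> two_sq (p * n)"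
    and d1: "int p dvd a * e + b * f" and d2: "int p dvd a * f - b * e"
  shows "(e, f) \<in> gmul a b ` two_sq n"
proof -
  obtain c d where c: "a * e + b * f = int p * c" and d: "a * f - b * e = int p * d"
    using d1 d2 by (auto elim!: dvdE)
  have ef: "e\<^sup>2 + f\<^sup>2 = int p * int n" using z by (auto simp: two_sq_def)
  have "int p * (a * c - b * d) = a * (int p * c) - b * (int p * d)" by (simp add: algebra_simps)
  also have "\<dots> = (a\<^sup>2 + b\<^sup>2) * e" unfolding c[symmetric] d[symmetric] by (simp add: power2_eq_square algebra_simps)
  finally have 1: "a * c - b * d = e" using p ab by simp
  have "int p * (a * d + b * c) = a * (int p * d) + b * (int p * c)" by (simp add: algebra_simps)
  also have "\<dots> = (a\<^sup>2 + b\<^sup>2) * f" unfolding c[symmetric] d[symmetric] by (simp add: power2_eq_square algebra_simps)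
  finally have 2: "a * d + b * c = f" using p ab by simp
  have "int p * (c\<^sup>2 + d\<^sup>2) = int p * int n"
    using gmul_norm[of a c b d] ef unfolding 1 2 ab by (simp only:)
  then have "c\<^sup>2 + d\<^sup>2 = int n" using p mult_left_cancel[of "int p"] by (metis of_nat_0_less_iff less_irrefl)
  then have "(c, d) \<in> two_sq n" by (simp add: two_sq_def)
  then show ?thesis using 1 2 by (intro image_eqI[of _ _ "(c, d)"]) (auto simp: gmul_def)
qed

text \<open>Euler's criterion makes -1 a square, so \<open>p\<close> divides (x + i)(x - i) for some
  x. A generator \<open>d\<close> of the ideal of \<open>p\<close> and x + i has norm exactly
  \<open>p\<close>.\<close>

lemma prime_sum_two_squares:
  fixes p :: nat
  assumes p: "prime p" and p1: "p mod 4 = 1"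
  obtains a b where "a\<^sup>2 + b\<^sup>2 = int p"
proof -
  have p2: "p > 2" using p1 prime_ge_2_nat[OF p] by (cases "p = 2") auto
  have "even ((p - 1) div 2)" using p1 p2 by presburger
  then have "[Legendre (-1) (int p) = 1] (mod int p)"
    using euler_criterion[OF p p2, of "-1"] by simp
  moreover have "\<not> [-1 = 1] (mod int p)"
  proof
    assume "[-1 = 1] (mod int p)"
    then have "int p dvd - 2" by (simp add: cong_iff_dvd_diff)
    then have "int p dvd 2" by simp
    then show False using p2 by (auto dest: zdvd_imp_le)
  qed
  ultimately have "Legendre (-1) (int p) \<noteq> -1" by metis
  moreover have "\<not> [-1 = 0] (mod int p)"
    using p2 by (auto simp: cong_iff_dvd_diff)
  ultimately have "QuadRes (int p) (-1)"
    unfolding Legendre_def by (auto split: if_splits)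
  then obtain x where "[x\<^sup>2 = -1] (mod int p)" unfolding QuadRes_def by auto
  then obtain m where m: "x\<^sup>2 + 1 = int p * m"
    unfolding cong_iff_dvd_diff by (auto elim!: dvdE)
  define X where "X = Complex (of_int x) 1"
  have XI: "X \<in> ZI" unfolding X_def using ZI_Complex[of x 1] by simp
  have XX: "X * cnj X = of_nat p * of_int m"
  proof -
    have "X * cnj X = of_int (x\<^sup>2 + 1)"
      by (simp add: X_def complex_eq_iff power2_eq_square)
    then show ?thesis unfolding m by simp
  qed
  \<comment> \<open>\<open>p\<close> divides neither x + i nor x - i, whose imaginary parts are 1
    and -1.\<close>
  have no: False if kk: "k \<in> ZI" "Im (of_nat p * k) = 1 \<or> Im (of_nat p * k) = -1" for k
  proof -
    obtain a b where k: "k = Complex (of_int a) (of_int b)" by (rule ZI_cases[OF kk(1)])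
    with kk(2) have "of_int (int p * b) = (1::real) \<or> of_int (int p * b) = (-1::real)" by simp
    then have "int p * b = 1 \<or> int p * b = -1" by linarith
    then have "int p dvd 1" by (metis dvd_minus_iff dvd_triv_left)
    then show False using p2 by simp
  qed
  obtain d s t where d: "d \<in> ZI" "d \<noteq> 0" "gdvd d (of_nat p)" "gdvd d X" "s \<in> ZI" "t \<in> ZI"
    "d = s * of_nat p + t * X"
  proof (rule ZI_bezout)
    show "of_nat p \<in> ZI" by (simp add: gaussian_ints_def)
    show "X \<in> ZI" by (rule XI)
    show "of_nat p \<noteq> (0::complex) \<or> X \<noteq> 0" using p2 by simp
  qed
  obtain k where k: "k \<in> ZI" "of_nat p = d * k" using d(3) unfolding gdvd_def by auto
  obtain j where j: "j \<in> ZI" "X = d * j" using d(4) unfolding gdvd_def by auto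
  obtain nd where nd: "(cmod d)\<^sup>2 = real nd" using d(1) by (rule ZI_norm_nat)
  obtain nk where nk: "(cmod k)\<^sup>2 = real nk" using k(1) by (rule ZI_norm_nat)
  have "(cmod (of_nat p))\<^sup>2 = (cmod d)\<^sup>2 * (cmod k)\<^sup>2" unfolding k(2) by (simp add: norm_mult power_mult_distrib)
  then have "real (p ^ 2) = real (nd * nk)" by (simp add: nd nk)
  then have pp: "p ^ 2 = nd * nk" by (simp only: of_nat_eq_iff)
  then have "nd dvd p ^ 2" by simp
  then obtain e where e: "e \<le> 2" "nd = p ^ e" using p by (auto simp: divides_primepow_nat)
  have cc: "z * cnj z = 1" if "(cmod z)\<^sup>2 = 1" for z
    using that complex_norm_square[of z] by (metis of_real_1)
  have "e = 1"
  proof (rule ccontr)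
    assume "e \<noteq> 1"
    then consider "e = 0" | "e = 2" using e(1) by linarith
    then show False
    proof cases
      \<comment> \<open>If \<open>d\<close> is a unit, its Bezout identity multiplied by
        \<open>cnj X\<close> makes \<open>p\<close> divide \<open>cnj X\<close>.\<close>
      case 1
      then have "d * cnj d = 1" using nd e by (intro cc) simp
      then have "cnj X = cnj X * cnj d * d" by (simp add: algebra_simps)
      also have "\<dots> = cnj X * cnj d * s * of_nat p + cnj d * t * (X * cnj X)"
        by (subst d(7)) (simp add: algebra_simps)
      also have "\<dots> = of_nat p * (cnj X * cnj d * s + cnj d * t * of_int m)"
        unfolding XX by (simp add: algebra_simps)
      finally have eq: "cnj X = of_nat p * (cnj X * cnj d * s + cnj d * t * of_int m)" .
      have "of_int m \<in> ZI" by (simp add: gaussian_ints_def)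
      then have "cnj X * cnj d * s + cnj d * t * of_int m \<in> ZI"
        using XI d by (intro ZI_closed ZI_cnj)
      from no[OF this] show False unfolding eq[symmetric] by (simp add: X_def)
    next
      \<comment> \<open>If \<open>d\<close> has norm p^2, the cofactor \<open>k\<close> is a unit,
        so \<open>p\<close> is associated to \<open>d\<close> and divides \<open>X\<close>.\<close>
      case 2
      then have "nk = 1" using pp e p2 by simp
      then have "k * cnj k = 1" using nk by (intro cc) simp
      then have "X = (d * k) * (cnj k * j)" unfolding j(2) by (simp add: algebra_simps)
      then have eq: "X = of_nat p * (cnj k * j)" unfolding k(2) .
      have "cnj k * j \<in> ZI" using k j by (intro ZI_closed ZI_cnj)
      from no[OF this] show False unfolding eq[symmetric] by (simp add: X_def)
    qed
  qed
  obtain a b where ab: "d = Complex (of_int a) (of_int b)" using d(1) by (rule ZI_cases)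
  have "of_int (a\<^sup>2 + b\<^sup>2) = (cmod d)\<^sup>2" by (simp add: ab cmod_power2)
  also have "\<dots> = of_int (int p)" using nd e \<open>e = 1\<close> by simp
  finally have "a\<^sup>2 + b\<^sup>2 = int p" by (simp only: of_int_eq_iff)
  then show thesis by (rule that)
qed

text \<open>Otherwise raise a^2 = -b^2 to the power (p - 1) / 2, which is odd here; Fermat turns
  this into 1 = -1 modulo \<open>p\<close>.\<close>

lemma prime_3_mod_4_dvd:
  fixes p :: nat and a b :: int
  assumes p: "prime p" and p3: "p mod 4 = 3" and d: "int p dvd a\<^sup>2 + b\<^sup>2"
  shows "int p dvd b"
proof (rule ccontr)
  assume nb: "\<not> int p dvd b"
  define k where "k = p div 4"
  have pk: "p = 4 * k + 3" unfolding k_def using p3 by presburger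
  have pk1: "p - 1 = 2 * (2 * k + 1)" using pk by simp
  have c: "[a\<^sup>2 = - (b\<^sup>2)] (mod int p)"
    using d by (simp add: cong_iff_dvd_diff)
  have na: "\<not> int p dvd a"
  proof
    assume "int p dvd a"
    then have "int p dvd a\<^sup>2" by (simp add: power2_eq_square)
    then have "int p dvd b\<^sup>2" using d by (simp add: dvd_add_right_iff)
    then show False using nb p by (simp add: prime_dvd_power_iff)
  qed
  have fermat: "[x ^ (p - 1) = 1] (mod int p)" if "\<not> int p dvd x" for x
  proof -
    have "coprime x (int p)" using that p by (metis prime_imp_coprime coprime_commute prime_nat_int_transfer)
    define y where "y = nat (x mod int p)"
    have y: "int y = x mod int p" unfolding y_def using prime_gt_0_nat[OF p] by simp
    have "\<not> p dvd y" using that y by (metis dvd_mod_iff dvd_refl int_dvd_int_iff)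
    then have "[y ^ (p - 1) = 1] (mod p)" using p by (rule fermat_theorem[rotated])
    then have "[int y ^ (p - 1) = 1] (mod int p)" by (metis cong_int_iff of_nat_1 of_nat_power)
    moreover have "[x = int y] (mod int p)" by (simp add: y cong_def)
    ultimately show ?thesis by (metis cong_pow cong_trans)
  qed
  have "[(a\<^sup>2) ^ (2 * k + 1) = (- (b\<^sup>2)) ^ (2 * k + 1)] (mod int p)" using c by (rule cong_pow)
  also have "(a\<^sup>2) ^ (2 * k + 1) = a ^ (p - 1)" unfolding pk1 by (rule power_mult[symmetric])
  also have "(- (b\<^sup>2)) ^ (2 * k + 1) = - ((b\<^sup>2) ^ (2 * k + 1))"
    by (rule power_minus_odd) simp
  also have "(b\<^sup>2) ^ (2 * k + 1) = b ^ (p - 1)" unfolding pk1 by (rule power_mult[symmetric])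
  finally have "[a ^ (p - 1) = - (b ^ (p - 1))] (mod int p)" .
  moreover have "[- (b ^ (p - 1)) = -1] (mod int p)" using fermat[OF nb] by (simp add: cong_minus_minus_iff)
  ultimately have "[1 = -1] (mod int p)" using fermat[OF na] by (metis cong_sym cong_trans)
  then have "int p dvd 2" by (simp add: cong_iff_dvd_diff)
  then have "p dvd 2" by presburger
  then have "p \<le> 2" by (rule dvd_imp_le) simp
  then show False using pk by simp
qed

text \<open>The cases are the ramified prime 2, the inert primes and the split primes of Z[i]. For a
  split prime the correction term is inclusion-exclusion over its two conjugate factors.\<close>

lemma card_two_sq_prime:
  assumes p: "prime p" and n: "n > 0"
  shows "int (card (two_sq (p * n))) = (1 + chi4 p) * int (card (two_sq n))
     - chi4 p * (if p dvd n then int (card (two_sq (n div p))) else 0)"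
proof -
  have p0: "p > 0" using p by (rule prime_gt_0_nat)
  have pI: "prime (int p)" using p by simp
  consider "p = 2" | "p mod 4 = 1" | "p mod 4 = 3"
  proof -
    have "p = 2 \<or> odd p" using p prime_odd_nat prime_ge_2_nat[of p] by (cases "p = 2") auto
    moreover have "odd p \<Longrightarrow> p mod 4 = 1 \<or> p mod 4 = 3" by presburger
    ultimately show thesis using that by blast
  qed
  then show ?thesis
  proof cases
    case 1
    \<comment> \<open>Multiplication by 1 + i is onto, because an even norm forces equal parity of
      the coordinates.\<close>
    have "two_sq (2 * n) = gmul 1 1 ` two_sq n"
    proof (intro equalityI subsetI)
      fix z assume z: "z \<in> two_sq (2 * n)"
      obtain e f where ef: "z = (e, f)" by (cases z)
      have "e\<^sup>2 + f\<^sup>2 = 2 * int n" using z ef by (auto simp: two_sq_def)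
      then have "even (e\<^sup>2 + f\<^sup>2)" by simp
      then have "even (e + f)" by simp
      then have "even (e + f)" "even (f - e)" by auto
      then show "z \<in> gmul 1 1 ` two_sq n"
        using two_sq_in_gmul[of 1 1 2 e f n] z ef by simp
    next
      fix z assume "z \<in> gmul 1 1 ` two_sq n"
      then show "z \<in> two_sq (2 * n)" using two_sq_gmul[of 1 1 2] by auto
    qed
    then have "card (two_sq (2 * n)) = card (two_sq n)" by (simp add: card_image inj_gmul)
    then show ?thesis using 1 by (simp add: chi4_def)
  next
    case 3
    show ?thesis
    proof (cases "p dvd n")
      case False
      \<comment> \<open>An inert prime dividing the norm divides both coordinates, hence divides the
        norm twice.\<close>
      have "two_sq (p * n) = {}"
      proof (rule ccontr)
        assume "two_sq (p * n) \<noteq> {}"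
        then obtain e f where ef: "e\<^sup>2 + f\<^sup>2 = int (p * n)" by (auto simp: two_sq_def)
        then have d: "int p dvd e\<^sup>2 + f\<^sup>2" "int p dvd f\<^sup>2 + e\<^sup>2" by (auto simp: add.commute)
        obtain e' f' where "e = int p * e'" "f = int p * f'"
          using prime_3_mod_4_dvd[OF p 3 d(1)] prime_3_mod_4_dvd[OF p 3 d(2)] by (auto elim!: dvdE)
        with ef have "int p * (int p * (e'\<^sup>2 + f'\<^sup>2)) = int p * int n"
          by (simp add: power2_eq_square algebra_simps)
        then have "int p * (e'\<^sup>2 + f'\<^sup>2) = int n" using p0 by simp
        then have "int p dvd int n" by (metis dvd_triv_left)
        with False show False by simp
      qed
      with False 3 show ?thesis by (simp add: chi4_def)
    next
      case True
      then obtain m where m: "n = p * m" by auto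
      have "two_sq (p * n) = (\<lambda>(e, f). (int p * e, int p * f)) ` two_sq m"
      proof (intro equalityI subsetI)
        fix z assume z: "z \<in> two_sq (p * n)"
        obtain e f where ef: "z = (e, f)" by (cases z)
        have e1: "e\<^sup>2 + f\<^sup>2 = int p * (int p * int m)" using z ef by (auto simp: two_sq_def m)
        then have d: "int p dvd e\<^sup>2 + f\<^sup>2" "int p dvd f\<^sup>2 + e\<^sup>2" by (auto simp: add.commute)
        obtain e' f' where e2: "e = int p * e'" "f = int p * f'"
          using prime_3_mod_4_dvd[OF p 3 d(1)] prime_3_mod_4_dvd[OF p 3 d(2)] by (auto elim!: dvdE)
        with e1 have "int p * (int p * (e'\<^sup>2 + f'\<^sup>2)) = int p * (int p * int m)"
          by (simp add: power2_eq_square algebra_simps)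
        then have "(e', f') \<in> two_sq m" using p0 by (simp add: two_sq_def)
        then show "z \<in> (\<lambda>(e, f). (int p * e, int p * f)) ` two_sq m" using ef e2 by force
      next
        fix z assume "z \<in> (\<lambda>(e, f). (int p * e, int p * f)) ` two_sq m"
        then obtain e f where z: "z = (int p * e, int p * f)" and ef: "e\<^sup>2 + f\<^sup>2 = int m" by (auto simp: two_sq_def)
        have "(int p * e)\<^sup>2 + (int p * f)\<^sup>2 = int p * (int p * (e\<^sup>2 + f\<^sup>2))"
          by (simp add: power2_eq_square algebra_simps)
        then show "z \<in> two_sq (p * n)" by (simp add: z two_sq_def m ef)
      qed
      moreover have "inj_on (\<lambda>(e, f). (int p * e, int p * f)) (two_sq m)"
        using p0 by (auto simp: inj_on_def)
      ultimately have "card (two_sq (p * n)) = card (two_sq m)" by (simp add: card_image)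
      then show ?thesis using 3 True m p0 by (simp add: chi4_def)
    qed
  next
    case 2
    obtain a b where ab: "a\<^sup>2 + b\<^sup>2 = int p" using prime_sum_two_squares[OF p 2] .
    have ab': "a\<^sup>2 + (-b)\<^sup>2 = int p" using ab by simp
    have nz: "a\<^sup>2 + b\<^sup>2 \<noteq> 0" "a\<^sup>2 + (-b)\<^sup>2 \<noteq> 0" using ab p0 by auto
    have p2: "p > 2" using 2 prime_ge_2_nat[OF p] by (cases "p = 2") auto
    \<comment> \<open>If \<open>p\<close> divided one coordinate of x^2 + y^2 = p, it would divide
      both, and p^2 would divide \<open>p\<close>.\<close>
    have small: "\<not> int p dvd x" if "x\<^sup>2 + y\<^sup>2 = int p" for x y
    proof
      assume x: "int p dvd x"
      then have "int p dvd x\<^sup>2" by (simp add: power2_eq_square)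
      moreover have "int p dvd x\<^sup>2 + y\<^sup>2" using that by simp
      ultimately have "int p dvd y\<^sup>2" by (simp add: dvd_add_right_iff)
      then have "int p dvd y" using pI by (simp add: prime_dvd_power_iff)
      then obtain x' y' where "x = int p * x'" "y = int p * y'" using x by (auto elim!: dvdE)
      with that have "int p * (int p * (x'\<^sup>2 + y'\<^sup>2)) = int p * 1"
        by (simp add: power2_eq_square algebra_simps)
      then have "int p * (x'\<^sup>2 + y'\<^sup>2) = 1" using p0 by simp
      then have "int p dvd 1" by (metis dvd_triv_left)
      then show False using p2 by simp
    qed
    let ?A = "gmul a b ` two_sq n" and ?B = "gmul a (-b) ` two_sq n"
    have U: "two_sq (p * n) = ?A \<union> ?B"
    proof (intro equalityI subsetI)
      fix z assume z: "z \<in> two_sq (p * n)"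
      obtain e f where ef: "z = (e, f)" by (cases z)
      have e1: "e\<^sup>2 + f\<^sup>2 = int p * int n" using z ef by (auto simp: two_sq_def)
      \<comment> \<open>\<open>p\<close> divides this product, hence one factor, which decides
        whether a + b i or a - b i divides e + f i.\<close>
      have "(a * e + b * f) * (a * e - b * f) = a\<^sup>2 * (e\<^sup>2 + f\<^sup>2) - f\<^sup>2 * (a\<^sup>2 + b\<^sup>2)"
        by (simp add: power2_eq_square algebra_simps)
      also have "\<dots> = int p * (a\<^sup>2 * int n - f\<^sup>2)" unfolding ab e1 by (simp add: algebra_simps)
      finally have "int p dvd (a * e + b * f) * (a * e - b * f)" by simp
      then consider "int p dvd a * e + b * f" | "int p dvd a * e - b * f"
        using pI by (auto simp: prime_dvd_mult_iff)
      then show "z \<in> ?A \<union> ?B"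
      proof cases
        case 1
        have "(a * f - b * e)\<^sup>2 = (a\<^sup>2 + b\<^sup>2) * (e\<^sup>2 + f\<^sup>2) - (a * e + b * f)\<^sup>2"
          by (simp add: power2_eq_square algebra_simps)
        also have "int p dvd \<dots>" using 1 unfolding ab by (intro dvd_diff) (auto simp: power2_eq_square)
        finally have "int p dvd a * f - b * e" using pI by (simp add: prime_dvd_power_iff)
        then show ?thesis using two_sq_in_gmul[OF ab p0 _ 1] z ef by auto
      next
        case 2
        have "(a * f + b * e)\<^sup>2 = (a\<^sup>2 + b\<^sup>2) * (e\<^sup>2 + f\<^sup>2) - (a * e - b * f)\<^sup>2"
          by (simp add: power2_eq_square algebra_simps)
        also have "int p dvd \<dots>" using 2 unfolding ab by (intro dvd_diff) (auto simp: power2_eq_square)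
        finally have "int p dvd a * f + b * e" using pI by (simp add: prime_dvd_power_iff)
        then show ?thesis using two_sq_in_gmul[OF ab' p0, of e f n] z ef 2 by auto
      qed
    next
      fix z assume "z \<in> ?A \<union> ?B"
      then show "z \<in> two_sq (p * n)" using two_sq_gmul[OF ab] two_sq_gmul[OF ab'] by auto
    qed
    \<comment> \<open>Divisible by both conjugate factors means divisible by
      \<open>p\<close>.\<close>
    have I: "?A \<inter> ?B = (\<lambda>(e, f). (int p * e, int p * f)) ` (if p dvd n then two_sq (n div p) else {})"
      (is "_ = ?h ` ?C")
    proof (intro equalityI subsetI)
      fix z assume z: "z \<in> ?A \<inter> ?B"
      then obtain u w where "z = gmul a b u" "z = gmul a (-b) w" by blast
      moreover obtain c d c' d' where "u = (c, d)" "w = (c', d')" by (cases u; cases w)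
      ultimately have 1: "z = gmul a b (c, d)" "z = gmul a (-b) (c', d')" by auto
      obtain e f where ef: "z = (e, f)" by (cases z)
      have e: "e = a * c - b * d" "f = a * d + b * c" "e = a * c' + b * d'" "f = a * d' - b * c'"
        using 1 ef by (auto simp: gmul_def)
      have "a * e + b * f = (a\<^sup>2 + b\<^sup>2) * c" unfolding e(1,2) by (simp add: power2_eq_square algebra_simps)
      then have d1: "int p dvd a * e + b * f" unfolding ab by simp
      have "a * e - b * f = (a\<^sup>2 + b\<^sup>2) * c'" unfolding e(3,4) by (simp add: power2_eq_square algebra_simps)
      then have d2: "int p dvd a * e - b * f" unfolding ab by simp
      have "int p dvd 2 * (a * e)" using dvd_add[OF d1 d2] by (simp add: algebra_simps)
      moreover have "\<not> int p dvd 2" using p2 by (auto dest: zdvd_imp_le)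
      ultimately have "int p dvd e" using pI small[OF ab] by (auto simp: prime_dvd_mult_iff)
      moreover have "int p dvd b * f" using d1 calculation by (metis dvd_add_right_iff dvd_mult)
      then have "int p dvd f" using pI small[of b a] ab by (auto simp: prime_dvd_mult_iff add.commute)
      ultimately obtain e' f' where ef': "e = int p * e'" "f = int p * f'" by (auto elim!: dvdE)
      have "z \<in> two_sq (p * n)" using U z by auto
      then have "int p * (int p * (e'\<^sup>2 + f'\<^sup>2)) = int p * int n"
        unfolding two_sq_def ef ef' by (simp add: power2_eq_square algebra_simps)
      then have *: "int p * (e'\<^sup>2 + f'\<^sup>2) = int n" using p0 by simp
      then have "int p dvd int n" by (metis dvd_triv_left)
      then obtain m where m: "n = p * m" by auto
      have "(e', f') \<in> two_sq m" using * p0 by (simp add: m two_sq_def)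
      then show "z \<in> ?h ` ?C" using ef ef' m p0 by force
    next
      fix z assume "z \<in> ?h ` ?C"
      then obtain e f where z: "z = (int p * e, int p * f)" and ef: "(e, f) \<in> ?C" by auto
      then obtain m where m: "n = p * m" by (auto split: if_splits)
      with ef p0 have ef: "(e, f) \<in> two_sq m" by auto
      have A: "gmul a (-b) (e, f) \<in> two_sq n" "gmul a b (e, f) \<in> two_sq n"
        unfolding m using two_sq_gmul[OF ab ef] two_sq_gmul[OF ab' ef] by auto
      have "z = gmul a b (gmul a (-b) (e, f))" "z = gmul a (-b) (gmul a b (e, f))"
        by (simp_all add: z gmul_def ab[symmetric] power2_eq_square algebra_simps)
      then show "z \<in> ?A \<inter> ?B" using A by blast
    qed
    have "inj ?h" using p0 by (auto simp: inj_on_def)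
    then have cI: "card (?A \<inter> ?B) = card ?C" unfolding I by (rule card_image[OF inj_on_subset]) auto
    have "card ?A + card ?B = card (?A \<union> ?B) + card (?A \<inter> ?B)"
      by (rule card_Un_Int) (auto simp: finite_two_sq)
    moreover have "card ?A = card (two_sq n)" "card ?B = card (two_sq n)"
      using inj_gmul[OF nz(1)] inj_gmul[OF nz(2)] by (auto intro: card_image)
    ultimately have "2 * int (card (two_sq n)) = int (card (two_sq (p * n))) + int (card ?C)"
      unfolding U cI by linarith
    then show ?thesis using 2 by (simp add: chi4_def split: if_splits)
  qed
qed

lemma card_two_sq: "n > 0 \<Longrightarrow> int (card (two_sq n)) = 4 * chi4_sum n"
proof (induction n rule: less_induct)
  case (less n)
  show ?case
  proof (cases "n = 1")
    case True
    have "two_sq 1 = {(1,0),(-1,0),(0,1),(0,-1)}"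
    proof (intro equalityI subsetI)
      fix z assume "z \<in> two_sq 1"
      then obtain a b where z: "z = (a, b)" and e: "a\<^sup>2 + b\<^sup>2 = 1" by (auto simp: two_sq_def)
      have "\<bar>a\<bar> \<le> 1" "\<bar>b\<bar> \<le> 1"
        using e abs_square_le_1[of a] abs_square_le_1[of b] zero_le_power2[of a] zero_le_power2[of b]
        by linarith+
      then have "a \<in> {-1,0,1}" "b \<in> {-1,0,1}" by auto
      with e show "z \<in> {(1,0),(-1,0),(0,1),(0,-1)}" by (auto simp: z)
    qed (auto simp: two_sq_def)
    moreover have "chi4_sum 1 = 1" by (simp add: chi4_sum_def chi4_def)
    ultimately show ?thesis using True by simp
  next
    case False
    then obtain p where p: "prime p" "p dvd n" by (metis prime_factor_nat)
    then obtain m where m: "n = p * m" by auto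
    have m0: "m > 0" using less.prems m by auto
    have lt: "m < n" using m m0 prime_gt_1_nat[OF p(1)] by simp
    have "p dvd m \<Longrightarrow> m div p < n \<and> m div p > 0"
      using lt m0 prime_gt_0_nat[OF p(1)] by (metis div_le_dividend dvd_div_eq_0_iff gr0I le_less_trans neq0_conv)
    then show ?thesis
      unfolding m card_two_sq_prime[OF p(1) m0] chi4_sum_prime[OF p(1) m0]
      using less.IH[of m] less.IH[of "m div p"] lt m m0 by (auto simp: algebra_simps)
  qed
qed

section \<open>Dirichlet series and the sum of |z|^-4\<close>

lemma chi4_has_sum: "((\<lambda>n. of_int (chi4 n) / (real n)\<^sup>2) has_sum catalan) {1..}"
proof -
  have sm: "summable (\<lambda>n. 1 / (2 * real n + 1)\<^sup>2)"
  proof (rule summable_comparison_test')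
    show "summable (\<lambda>n. 1 / (real n + 1)\<^sup>2)"
      using sums_summable[OF inverse_squares_sums] by (simp add: add.commute)
    show "norm (1 / (2 * real n + 1)\<^sup>2) \<le> 1 / (real n + 1)\<^sup>2" if "n \<ge> 0" for n
      by (auto intro!: divide_left_mono power_mono mult_pos_pos)
  qed
  have nrm: "summable (\<lambda>n. norm ((-1) ^ n / (2 * real n + 1)\<^sup>2))"
    using sm by (simp add: norm_divide norm_power)
  have "((\<lambda>n. (-1) ^ n / (2 * real n + 1)\<^sup>2) has_sum catalan) UNIV"
    unfolding catalan_def using nrm
    by (rule norm_summable_imp_has_sum) (rule summable_sums[OF summable_norm_cancel[OF nrm]])
  then have "((\<lambda>n. of_int (chi4 (2 * n + 1)) / (real (2 * n + 1))\<^sup>2) has_sum catalan) UNIV"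
  proof (rule has_sum_cong[THEN iffD1, rotated])
    fix n :: nat
    have "of_int (chi4 (2 * n + 1)) = ((-1) ^ n :: real)"
    proof (cases "even n")
      case True
      then have "(2 * n + 1) mod 4 = 1" by presburger
      with True show ?thesis by (simp add: chi4_def)
    next
      case False
      then have "(2 * n + 1) mod 4 = 3" by presburger
      with False show ?thesis by (simp add: chi4_def)
    qed
    then show "(-1) ^ n / (2 * real n + 1)\<^sup>2 = of_int (chi4 (2 * n + 1)) / (real (2 * n + 1))\<^sup>2"
      by simp
  qed
  then have "((\<lambda>n. of_int (chi4 n) / (real n)\<^sup>2) has_sum catalan) ((\<lambda>n. 2 * n + 1) ` UNIV)"
    by (subst has_sum_reindex) (auto simp: inj_on_def o_def)
  then show ?thesis
  proof (rule has_sum_cong_neutral[THEN iffD1, rotated -1])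
    fix n :: nat assume "n \<in> {1..} - (\<lambda>n. 2 * n + 1) ` UNIV"
    then have "even n" by (metis DiffE oddE rangeI)
    then have "chi4 n = 0" unfolding chi4_def by presburger
    then show "of_int (chi4 n) / (real n)\<^sup>2 = 0" by simp
  qed auto
qed

lemma zeta_2_has_sum: "((\<lambda>n. 1 / (real n)\<^sup>2) has_sum (pi\<^sup>2 / 6)) {1..}"
proof -
  have "((\<lambda>n. 1 / (real n + 1)\<^sup>2) has_sum (pi\<^sup>2 / 6)) UNIV"
    using inverse_squares_sums by (intro norm_summable_imp_has_sum) (auto simp: sums_iff add.commute)
  then have "((\<lambda>n. 1 / (real n)\<^sup>2) has_sum (pi\<^sup>2 / 6)) (Suc ` UNIV)"
    by (subst has_sum_reindex) (auto simp: o_def add.commute)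
  also have "Suc ` UNIV = {1..}"
    using image_Suc_lessThan by (auto simp: image_iff Suc_le_eq gr0_conv_Suc)
  finally show ?thesis .
qed

text \<open>The sum of |z|^-4 over nonzero Gaussian integers, that is, 4 times the Dedekind zeta
  function of Q(i) at 2; see \<open>ZI_zeta_has_sum\<close>.\<close>

definition zeta_sum :: real where "zeta_sum = 4 * (pi\<^sup>2 / 6) * catalan"

lemma card_ZI_norm:
  "card {z \<in> ZI. (cmod z)\<^sup>2 = real n} = card (two_sq n)"
proof -
  have "{z \<in> ZI. (cmod z)\<^sup>2 = real n} = (\<lambda>(a, b). Complex (of_int a) (of_int b)) ` two_sq n"
  proof (intro equalityI subsetI)
    fix z assume z: "z \<in> {z \<in> ZI. (cmod z)\<^sup>2 = real n}"
    then obtain a b where ab: "z = Complex (of_int a) (of_int b)" by (auto elim: ZI_cases)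
    have "of_int (a\<^sup>2 + b\<^sup>2) = (cmod z)\<^sup>2" by (simp add: ab cmod_power2)
    also have "\<dots> = of_int (int n)" using z by simp
    finally have "a\<^sup>2 + b\<^sup>2 = int n" by (simp only: of_int_eq_iff)
    then show "z \<in> (\<lambda>(a, b). Complex (of_int a) (of_int b)) ` two_sq n"
      using ab by (intro image_eqI[of _ _ "(a, b)"]) (auto simp: two_sq_def)
  next
    fix z assume "z \<in> (\<lambda>(a, b). Complex (of_int a) (of_int b)) ` two_sq n"
    then obtain a b where ab: "z = Complex (of_int a) (of_int b)" and n: "a\<^sup>2 + b\<^sup>2 = int n"
      by (auto simp: two_sq_def)
    have "(cmod z)\<^sup>2 = of_int (a\<^sup>2 + b\<^sup>2)" by (simp add: ab cmod_power2)
    then show "z \<in> {z \<in> ZI. (cmod z)\<^sup>2 = real n}" unfolding n using ab ZI_Complex by simp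
  qed
  moreover have "inj_on (\<lambda>(a, b). Complex (of_int a) (of_int b)) (two_sq n)"
    by (auto simp: inj_on_def)
  ultimately show ?thesis by (simp add: card_image)
qed

text \<open>The product of the series for zeta(2) and G is summed over pairs (d, k), then regrouped
  by n = d k; this produces \<open>chi4_sum n\<close>, and Jacobi's theorem turns 4
  \<open>chi4_sum n\<close> into the number of z of norm n.\<close>

lemma ZI_zeta_has_sum: "((\<lambda>z. 1 / (cmod z) ^ 4) has_sum zeta_sum) (ZI - {0})"
proof -
  \<comment> \<open>Regrouping needs absolute convergence, obtained by comparison with the series
    without signs.\<close>
  have "(\<lambda>(d, k). 1 / (real d)\<^sup>2 * (1 / (real k)\<^sup>2)) summable_on {1..} \<times> {1..}"
  proof (rule summable_on_SigmaI)
    show "((\<lambda>y. case (x, y) of (d, k) \<Rightarrow> 1 / (real d)\<^sup>2 * (1 / (real k)\<^sup>2)) has_sum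
        1 / (real x)\<^sup>2 * (pi\<^sup>2 / 6)) {1..}" for x
      using has_sum_cmult_right[OF zeta_2_has_sum, of "1 / (real x)\<^sup>2"] by simp
    show "(\<lambda>x. 1 / (real x)\<^sup>2 * (pi\<^sup>2 / 6)) summable_on {1..}"
      by (rule has_sum_imp_summable[OF has_sum_cmult_left[OF zeta_2_has_sum]])
  qed auto
  then have "(\<lambda>x. norm ((\<lambda>(d, k). 1 / (real d)\<^sup>2 * (1 / (real k)\<^sup>2)) x)) summable_on {1..} \<times> {1..}"
    by (simp add: case_prod_unfold)
  then have "(\<lambda>x. norm ((\<lambda>(d, k). of_int (chi4 d) / (real d)\<^sup>2 * (1 / (real k)\<^sup>2) :: real) x)) summable_on {1..} \<times> {1..}"
    by (rule Infinite_Sum.abs_summable_on_comparison_test)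
       (auto simp: chi4_def field_simps)
  then have sp: "(\<lambda>(d, k). of_int (chi4 d) / (real d)\<^sup>2 * (1 / (real k)\<^sup>2) :: real) summable_on {1..} \<times> {1..}"
    by (rule abs_summable_summable)
  have "((\<lambda>(d, k). of_int (chi4 d) / (real d)\<^sup>2 * (1 / (real k)\<^sup>2)) has_sum (catalan * (pi\<^sup>2 / 6))) ({1..} \<times> {1..})"
  proof (rule has_sum_SigmaI[OF _ _ sp])
    show "((\<lambda>y. case (x, y) of (d, k) \<Rightarrow> of_int (chi4 d) / (real d)\<^sup>2 * (1 / (real k)\<^sup>2)) has_sum
        of_int (chi4 x) / (real x)\<^sup>2 * (pi\<^sup>2 / 6)) {1..}" for x
      using has_sum_cmult_right[OF zeta_2_has_sum, of "of_int (chi4 x) / (real x)\<^sup>2"] by simp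
    show "((\<lambda>x. of_int (chi4 x) / (real x)\<^sup>2 * (pi\<^sup>2 / 6)) has_sum catalan * (pi\<^sup>2 / 6)) {1..}"
      by (rule has_sum_cmult_left[OF chi4_has_sum])
  qed
  also have "?this \<longleftrightarrow> ((\<lambda>(n, d). of_int (chi4 d) / (real n)\<^sup>2) has_sum (catalan * (pi\<^sup>2 / 6)))
      (SIGMA n:{1..}. {d. d dvd n})"
    by (rule has_sum_reindex_bij_witness[of _ "\<lambda>(n, d). (d, n div d)" "\<lambda>(d, k). (d * k, d)"])
       (auto simp: power_mult_distrib field_simps elim!: dvdE dest: dvd_pos_nat simp: Suc_le_eq)
  finally have 1: "((\<lambda>(n, d). of_int (chi4 d) / (real n)\<^sup>2) has_sum (catalan * (pi\<^sup>2 / 6)))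
      (SIGMA n:{1..}. {d. d dvd n})" .
  have "((\<lambda>n. \<Sum>d | d dvd n. of_int (chi4 d) / (real n)\<^sup>2) has_sum (catalan * (pi\<^sup>2 / 6))) {1..}"
  proof (rule has_sum_SigmaD[OF 1])
    fix n :: nat assume "n \<in> {1..}"
    then have "finite {d. d dvd n}" by simp
    then show "((\<lambda>y. case (n, y) of (n, d) \<Rightarrow> of_int (chi4 d) / (real n)\<^sup>2) has_sum
        (\<Sum>d | d dvd n. of_int (chi4 d) / (real n)\<^sup>2)) {d. d dvd n}"
      by (simp add: has_sum_finite)
  qed
  then have "((\<lambda>n. 4 * (\<Sum>d | d dvd n. of_int (chi4 d) / (real n)\<^sup>2)) has_sum 4 * (catalan * (pi\<^sup>2 / 6))) {1..}"
    by (rule has_sum_cmult_right)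
  then have "((\<lambda>n. 4 * (\<Sum>d | d dvd n. of_int (chi4 d) / (real n)\<^sup>2)) has_sum zeta_sum) {1..}"
    by (simp add: zeta_sum_def mult_ac)
  then have 2: "((\<lambda>n. real (card (two_sq n)) / (real n)\<^sup>2) has_sum zeta_sum) {1..}"
  proof (rule has_sum_cong[THEN iffD1, rotated])
    fix n :: nat assume "n \<in> {1..}"
    then have "real (card (two_sq n)) = real_of_int (4 * chi4_sum n)" using card_two_sq[of n] by simp
    then show "4 * (\<Sum>d | d dvd n. of_int (chi4 d) / (real n)\<^sup>2) = real (card (two_sq n)) / (real n)\<^sup>2"
      by (simp add: chi4_sum_def sum_divide_distrib[symmetric])
  qed
  let ?B = "\<lambda>n. {z \<in> ZI. (cmod z)\<^sup>2 = real n}"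
  have B: "((\<lambda>z. 1 / (cmod (snd (n, z))) ^ 4) has_sum real (card (two_sq n)) / (real n)\<^sup>2) (?B n)"
    if "n \<in> {1..}" for n
  proof -
    have fin: "finite (?B n)" by (rule finite_subset[OF _ finite_ZI_ball[of "real n"]]) auto
    have "(\<Sum>z\<in>?B n. 1 / (cmod z) ^ 4) = (\<Sum>z\<in>?B n. 1 / (real n)\<^sup>2)"
      by (rule sum.cong) (auto simp: power2_eq_square power4_eq_xxxx mult_ac)
    also have "\<dots> = real (card (two_sq n)) / (real n)\<^sup>2" by (simp add: card_ZI_norm)
    finally show ?thesis using has_sum_finite[OF fin, of "\<lambda>z. 1 / (cmod z) ^ 4"] by simp
  qed
  have s: "(\<lambda>(n, z). 1 / (cmod z) ^ 4) summable_on (SIGMA n:{1..}. ?B n)"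
    using summable_on_SigmaI[OF B has_sum_imp_summable[OF 2]] by (simp add: case_prod_unfold)
  have F: "(cmod z)\<^sup>2 = real (nat \<lfloor>(cmod z)\<^sup>2\<rfloor>)" if "z \<in> ZI" for z
    by (rule ZI_norm_nat[OF that]) simp
  have "((\<lambda>(n, z). 1 / (cmod z) ^ 4) has_sum zeta_sum) (SIGMA n:{1..}. ?B n)"
    by (rule has_sum_SigmaI[OF _ 2 s]) (use B in simp)
  also have "?this \<longleftrightarrow> ?thesis"
    by (rule has_sum_reindex_bij_witness[of _ "\<lambda>z. (nat \<lfloor>(cmod z)\<^sup>2\<rfloor>, z)" snd])
       (use F ZI_norm_ge_1(1) in \<open>auto simp: le_nat_iff le_floor_iff\<close>)
  finally show ?thesis .
qed

section \<open>Lattice points in discs\<close>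

definition shifted_points :: "complex \<Rightarrow> real \<Rightarrow> real \<Rightarrow> complex set" where
  "shifted_points \<theta> C Y = {z. z - \<theta> \<in> ZI \<and> C \<le> (cmod z)\<^sup>2 \<and> (cmod z)\<^sup>2 \<le> Y}"

lemma finite_shifted_points [simp]: "finite (shifted_points \<theta> C Y)"
  by (rule finite_subset[OF _ finite_ZI_shift[of \<theta> Y]]) (auto simp: shifted_points_def)

lemma measure_unit_square:
  "measure lborel (box z (z + Complex 1 1)) = 1" "measure lborel (cbox z (z + Complex 1 1)) = 1"
  by (simp_all add: measure_lborel_box_eq measure_lborel_cbox_eq Basis_complex_def inner_complex_def)

lemma measure_disc: "r \<ge> 0 \<Longrightarrow> measure lborel (cball (0::complex) r) = pi * r\<^sup>2"
  using content_cball[of r "0::complex"] by (simp add: unit_ball_vol_2)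

text \<open>Each lattice point owns a unit square of diameter below 2; the squares cover the disc of
  radius r - 2 and stay inside that of radius r + 2. The constant is independent of \<theta>, on
  which all later uniformity rests.\<close>

lemma gauss_circle:
  assumes t: "t \<ge> 1"
  shows "\<bar>real (card (shifted_points \<theta> 0 t)) - pi * t\<bar> \<le> 8 * pi * sqrt t"
proof -
  let ?P = "shifted_points \<theta> 0 t" and ?e = "Complex 1 1"
  define r where "r = sqrt t"
  have r: "r \<ge> 1" "t = r\<^sup>2" using t by (auto simp: r_def)
  have P: "z \<in> ?P \<longleftrightarrow> z - \<theta> \<in> ZI \<and> cmod z \<le> r" for z
    using r by (auto simp: shifted_points_def)
  have e: "cmod (w - z) \<le> 2" if "w \<in> cbox z (z + ?e)" for w z
  proof -
    have "\<bar>Re (w - z)\<bar> \<le> 1" "\<bar>Im (w - z)\<bar> \<le> 1"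
      using that by (auto simp: in_cbox_complex_iff)
    then show ?thesis using cmod_le[of "w - z"] by linarith
  qed
  \<comment> \<open>Open squares are disjoint, which serves the upper bound; the lower bound uses
    closed squares, which cover.\<close>
  have "disjoint_family_on (\<lambda>z. box z (z + ?e)) ?P"
  proof (unfold disjoint_family_on_def, intro ballI impI)
    fix z w assume zw: "z \<in> ?P" "w \<in> ?P" "z \<noteq> w"
    show "box z (z + ?e) \<inter> box w (w + ?e) = {}"
    proof (rule ccontr)
      assume "\<not> ?thesis"
      then obtain x where x: "x \<in> box z (z + ?e)" "x \<in> box w (w + ?e)" by auto
      then have f: "gfloor (x - z) = 0" "gfloor (x - w) = 0"
        by (auto simp: gfloor_eq_0_iff in_box_complex_iff)
      have "z - \<theta> \<in> ZI" "w - \<theta> \<in> ZI" using zw by (simp_all add: P)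
      then have "(w - \<theta>) - (z - \<theta>) \<in> ZI" by (rule ZI_closed(2)[rotated])
      then have "(x - z) - (x - w) \<in> ZI" by simp
      then have "x - z = x - w" by (rule gfloor_eq_0_diff_ZI[OF f])
      with zw show False by simp
    qed
  qed
  then have "measure lborel (\<Union>z\<in>?P. box z (z + ?e)) = (\<Sum>z\<in>?P. measure lborel (box z (z + ?e)))"
    by (intro measure_UNION') (auto simp: emeasure_lborel_box_eq pairwise_def disjnt_def disjoint_family_on_def fmeasurable_box)
  then have "real (card ?P) = measure lborel (\<Union>z\<in>?P. box z (z + ?e))" by (simp add: measure_unit_square)
  also have "\<dots> \<le> measure lborel (cball (0::complex) (r + 2))"
  proof (rule measure_mono_fmeasurable)
    show "(\<Union>z\<in>?P. box z (z + ?e)) \<subseteq> cball 0 (r + 2)"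
    proof safe
      fix z w assume "z \<in> ?P" "w \<in> box z (z + ?e)"
      moreover from this have "w \<in> cbox z (z + ?e)" using box_subset_cbox by blast
      ultimately have "cmod z \<le> r" "cmod (w - z) \<le> 2" using e by (simp_all add: P)
      then show "w \<in> cball 0 (r + 2)" using norm_triangle_sub[of w z] by simp
    qed
  qed (auto intro: fmeasurable_compact)
  also have "\<dots> = pi * (r + 2)\<^sup>2" using r by (intro measure_disc) simp
  \<comment> \<open>The constant 8 is 4 + 4, because r is at least 1.\<close>
  also have "\<dots> = pi * t + (pi * 4) * r + (pi * 4) * 1" using r by (simp add: power2_eq_square algebra_simps)
  also have "\<dots> \<le> pi * t + (pi * 4) * r + (pi * 4) * r" using r by (intro add_left_mono mult_left_mono) auto
  finally have up: "real (card ?P) \<le> pi * t + 8 * pi * r" by simp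
  have lo: "pi * t - 8 * pi * r \<le> real (card ?P)"
  proof (cases "r \<ge> 2")
    case True
    have "pi * (r - 2)\<^sup>2 = measure lborel (cball (0::complex) (r - 2))" using True by (intro measure_disc[symmetric]) simp
    also have "\<dots> \<le> measure lborel (\<Union>z\<in>?P. cbox z (z + ?e))"
    proof (rule measure_mono_fmeasurable)
      show "cball 0 (r - 2) \<subseteq> (\<Union>z\<in>?P. cbox z (z + ?e))"
      proof
        fix w :: complex assume w: "w \<in> cball 0 (r - 2)"
        define z where "z = \<theta> + gfloor (w - \<theta>)"
        have "gfloor (w - z) = 0" using gfloor_diff_eq_0[of "w - \<theta>"] by (simp add: z_def algebra_simps)
        then have wz: "w \<in> cbox z (z + ?e)" by (auto simp: gfloor_eq_0_iff in_cbox_complex_iff)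
        then have "cmod z \<le> r" using e[OF wz] w norm_triangle_sub[of z w] by (simp add: norm_minus_commute)
        then have "z \<in> ?P" by (simp add: P z_def)
        with wz show "w \<in> (\<Union>z\<in>?P. cbox z (z + ?e))" by blast
      qed
    qed (auto intro!: fmeasurable_cbox fmeasurable.finite_UN)
    also have "\<dots> \<le> (\<Sum>z\<in>?P. measure lborel (cbox z (z + ?e)))"
      by (rule measure_UNION_le) auto
    also have "\<dots> = real (card ?P)" by (simp add: measure_unit_square)
    finally have "pi * (r - 2)\<^sup>2 \<le> real (card ?P)" .
    moreover have "pi * (r - 2)\<^sup>2 = pi * t - 4 * (pi * r) + 4 * pi" using r by (simp add: power2_eq_square algebra_simps)
    moreover have "pi * r \<ge> 0" using r by simp
    ultimately show ?thesis using pi_gt_zero by linarith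
  next
    case False
    then have "pi * t \<le> 8 * pi * r" using r by (simp add: power2_eq_square mult_right_mono)
    then show ?thesis by linarith
  qed
  show ?thesis using up lo unfolding r_def by linarith
qed

text \<open>
  Partial summation; \<open>F\<close> and \<open>H\<close> carry the integrals of \<open>- t f'(t)\<close> and \<open>- sqrt t f'(t)\<close>, so that no
  integral appears in the statement.
\<close>

lemma abel_count:
  fixes rr :: "'a \<Rightarrow> real" and f g F H :: "real \<Rightarrow> real"
  assumes fin: "finite A" and A: "\<And>z. z \<in> A \<Longrightarrow> C \<le> rr z \<and> rr z \<le> Y" and CY: "C \<le> Y"
    and f: "\<And>t. C \<le> t \<Longrightarrow> t \<le> Y \<Longrightarrow> (f has_real_derivative - g t) (at t)"
    and fY: "f Y = 0" and g: "\<And>t. C \<le> t \<Longrightarrow> t \<le> Y \<Longrightarrow> g t \<ge> 0"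
    and cnt: "\<And>t. C \<le> t \<Longrightarrow> t \<le> Y \<Longrightarrow> \<bar>real (card {z \<in> A. rr z \<le> t}) - pi * t\<bar> \<le> K * sqrt t"
    and F: "\<And>t. C \<le> t \<Longrightarrow> t \<le> Y \<Longrightarrow> (F has_real_derivative t * g t) (at t)"
    and H: "\<And>t. C \<le> t \<Longrightarrow> t \<le> Y \<Longrightarrow> (H has_real_derivative sqrt t * g t) (at t)"
  shows "\<bar>(\<Sum>z\<in>A. f (rr z)) - pi * (F Y - F C)\<bar> \<le> K * (H Y - H C)"
proof -
  have ftc: "(g' has_integral (G Y - G a)) {a..Y}"
    if "C \<le> a" "a \<le> Y" "\<And>t. C \<le> t \<Longrightarrow> t \<le> Y \<Longrightarrow> (G has_real_derivative g' t) (at t)" for G g' a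
    using that by (intro fundamental_theorem_of_calculus)
      (auto simp: has_real_derivative_iff_has_vector_derivative[symmetric] intro: has_field_derivative_at_within)
  \<comment> \<open>Because \<open>f Y = 0\<close>, each value of \<open>f\<close> is an integral of
    \<open>g\<close> up to \<open>Y\<close>; summing these integrals produces the counting function
    as a weight.\<close>
  have single: "((\<lambda>t. if rr z \<le> t then g t else 0) has_integral f (rr z)) {C..Y}" if z: "z \<in> A" for z
  proof -
    have "(g has_integral ((\<lambda>t. - f t) Y - (\<lambda>t. - f t) (rr z))) {rr z..Y}"
      using A[OF z] by (intro ftc) (auto intro!: derivative_eq_intros f)
    then have "(g has_integral f (rr z)) {rr z..Y}" by (simp add: fY)
    then have "((\<lambda>t. if t \<in> {rr z..Y} then g t else 0) has_integral f (rr z)) {C..Y}"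
      using A[OF z] by (subst has_integral_restrict) auto
    then show ?thesis by (rule has_integral_eq[rotated]) auto
  qed
  have "((\<lambda>t. \<Sum>z\<in>A. if rr z \<le> t then g t else 0) has_integral (\<Sum>z\<in>A. f (rr z))) {C..Y}"
    by (intro has_integral_sum fin single)
  moreover have "(\<Sum>z\<in>A. if rr z \<le> t then g t else 0) = real (card {z \<in> A. rr z \<le> t}) * g t" for t
  proof -
    have "(\<Sum>z\<in>A. if rr z \<le> t then g t else 0) = (\<Sum>z\<in>{z \<in> A. rr z \<le> t}. g t)"
      by (rule sum.inter_filter[OF fin, symmetric])
    then show ?thesis by simp
  qed
  ultimately have S: "((\<lambda>t. real (card {z \<in> A. rr z \<le> t}) * g t) has_integral (\<Sum>z\<in>A. f (rr z))) {C..Y}"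
    by simp
  have FF: "((\<lambda>t. t * g t) has_integral (F Y - F C)) {C..Y}" and HH: "((\<lambda>t. sqrt t * g t) has_integral (H Y - H C)) {C..Y}"
    using CY F H by (auto intro!: ftc)
  have up: "((\<lambda>t. pi * (t * g t) + K * (sqrt t * g t)) has_integral (pi * (F Y - F C) + K * (H Y - H C))) {C..Y}"
    by (intro has_integral_add has_integral_mult_right FF HH)
  have lo: "((\<lambda>t. pi * (t * g t) - K * (sqrt t * g t)) has_integral (pi * (F Y - F C) - K * (H Y - H C))) {C..Y}"
    by (intro has_integral_diff has_integral_mult_right FF HH)
  have "(\<Sum>z\<in>A. f (rr z)) \<le> pi * (F Y - F C) + K * (H Y - H C)"
  proof (rule has_integral_le[OF S up])
    fix t assume t: "t \<in> {C..Y}"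
    then have "real (card {z \<in> A. rr z \<le> t}) \<le> pi * t + K * sqrt t" using cnt[of t] by auto
    then have "real (card {z \<in> A. rr z \<le> t}) * g t \<le> (pi * t + K * sqrt t) * g t"
      using g t by (intro mult_right_mono) auto
    then show "real (card {z \<in> A. rr z \<le> t}) * g t \<le> pi * (t * g t) + K * (sqrt t * g t)"
      by (simp add: algebra_simps)
  qed
  moreover have "pi * (F Y - F C) - K * (H Y - H C) \<le> (\<Sum>z\<in>A. f (rr z))"
  proof (rule has_integral_le[OF lo S])
    fix t assume t: "t \<in> {C..Y}"
    then have "pi * t - K * sqrt t \<le> real (card {z \<in> A. rr z \<le> t})" using cnt[of t] by auto
    then have "(pi * t - K * sqrt t) * g t \<le> real (card {z \<in> A. rr z \<le> t}) * g t"
      using g t by (intro mult_right_mono) auto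
    then show "pi * (t * g t) - K * (sqrt t * g t) \<le> real (card {z \<in> A. rr z \<le> t}) * g t"
      by (simp add: algebra_simps)
  qed
  ultimately show ?thesis by linarith
qed

text \<open>8 pi comes from \<open>gauss_circle\<close>; the rest bounds the points of norm below
  \<open>C\<close> that the annulus omits.\<close>

definition count_const :: "real \<Rightarrow> real" where "count_const C = 8 * pi + (pi * C + 8 * pi * sqrt C)"

lemma count_const_ge: "C \<ge> 1 \<Longrightarrow> count_const C \<ge> 8 * pi" "C \<ge> 1 \<Longrightarrow> count_const C \<ge> 0"
  by (auto simp: count_const_def)

lemma card_shifted_points:
  assumes C: "C \<ge> 1" and t: "C \<le> t"
  shows "\<bar>real (card (shifted_points \<theta> C t)) - pi * t\<bar> \<le> count_const C * sqrt t"
proof -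
  have "shifted_points \<theta> 0 t = shifted_points \<theta> C t \<union> {z \<in> shifted_points \<theta> 0 C. (cmod z)\<^sup>2 < C}"
    using t by (auto simp: shifted_points_def)
  then have "card (shifted_points \<theta> 0 t) = card (shifted_points \<theta> C t) + card {z \<in> shifted_points \<theta> 0 C. (cmod z)\<^sup>2 < C}"
    by (simp only:) (rule card_Un_disjoint, simp, simp, auto simp: shifted_points_def[of \<theta> C t])
  moreover have "card {z \<in> shifted_points \<theta> 0 C. (cmod z)\<^sup>2 < C} \<le> card (shifted_points \<theta> 0 C)"
    by (rule card_mono) auto
  moreover have "real (card (shifted_points \<theta> 0 C)) \<le> pi * C + 8 * pi * sqrt C"
    using gauss_circle[OF C, of \<theta>] by linarith
  moreover have "\<bar>real (card (shifted_points \<theta> 0 t)) - pi * t\<bar> \<le> 8 * pi * sqrt t"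
    using C t by (intro gauss_circle) simp
  moreover have "(pi * C + 8 * pi * sqrt C) * 1 \<le> (pi * C + 8 * pi * sqrt C) * sqrt t"
    using C t by (intro mult_left_mono) auto
  ultimately show ?thesis unfolding count_const_def by (simp add: algebra_simps)
qed

lemma shifted_points_filter:
  "C \<le> t \<Longrightarrow> t \<le> Y \<Longrightarrow> {z \<in> shifted_points \<theta> C Y. (cmod z)\<^sup>2 \<le> t} = shifted_points \<theta> C t"
  by (auto simp: shifted_points_def)

section \<open>Sums of norm powers over shifted lattices\<close>

lemma abel_shifted_points:
  assumes C: "C \<ge> 1" and CY: "C \<le> Y"
    and f: "\<And>t. C \<le> t \<Longrightarrow> t \<le> Y \<Longrightarrow> (f has_real_derivative - g t) (at t)"
    and fY: "f Y = 0" and g: "\<And>t. C \<le> t \<Longrightarrow> t \<le> Y \<Longrightarrow> g t \<ge> 0"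
    and F: "\<And>t. C \<le> t \<Longrightarrow> t \<le> Y \<Longrightarrow> (F has_real_derivative t * g t) (at t)"
    and H: "\<And>t. C \<le> t \<Longrightarrow> t \<le> Y \<Longrightarrow> (H has_real_derivative sqrt t * g t) (at t)"
  shows "\<bar>(\<Sum>z\<in>shifted_points \<theta> C Y. f ((cmod z)\<^sup>2)) - pi * (F Y - F C)\<bar> \<le> count_const C * (H Y - H C)"
  using C CY f fY g F H
  by (intro abel_count[where g = g]) (auto simp: shifted_points_filter card_shifted_points, auto simp: shifted_points_def)

text \<open>Partial summation with 1 / t - 1 / Y, shifted so as to vanish at \<open>Y\<close>. The
  removed part is the number of points over \<open>Y\<close>, hence bounded, and the error integral
  of t^(-3/2) converges.\<close>

lemma sum_inverse_norm_sq:
  assumes C: "C \<ge> 1" and CY: "C \<le> Y"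
  shows "\<bar>(\<Sum>z\<in>shifted_points \<theta> C Y. 1 / (cmod z)\<^sup>2) - pi * ln (Y / C)\<bar> \<le> pi + 3 * count_const C"
proof -
  have Y: "Y \<ge> 1" using C CY by simp
  have "\<bar>(\<Sum>z\<in>shifted_points \<theta> C Y. 1 / (cmod z)\<^sup>2 - 1 / Y) - pi * (ln Y - ln C)\<bar>
     \<le> count_const C * ((- 2 / sqrt Y) - (- 2 / sqrt C))"
  proof (rule abel_shifted_points[OF C CY, where g = "\<lambda>t. 1 / t\<^sup>2"])
    fix t assume t: "C \<le> t" "t \<le> Y"
    show "((\<lambda>t. 1 / t - 1 / Y) has_real_derivative - (1 / t\<^sup>2)) (at t)"
      using C t by (auto intro!: derivative_eq_intros simp: power2_eq_square)
    show "(ln has_real_derivative t * (1 / t\<^sup>2)) (at t)"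
      using C t by (auto intro!: derivative_eq_intros simp: power2_eq_square)
    have "t = sqrt t * sqrt t" using C t by simp
    then show "((\<lambda>t. - 2 / sqrt t) has_real_derivative sqrt t * (1 / t\<^sup>2)) (at t)"
      using C t by (auto intro!: derivative_eq_intros simp: power2_eq_square field_simps)
  qed auto
  moreover have "\<dots> \<le> count_const C * 2"
  proof (intro mult_left_mono count_const_ge C)
    have "2 / sqrt C \<le> 2" "0 \<le> 2 / sqrt Y" using C Y by (auto simp: field_simps)
    moreover have "- 2 / sqrt Y - - 2 / sqrt C = 2 / sqrt C - 2 / sqrt Y" by simp
    ultimately show "- 2 / sqrt Y - - 2 / sqrt C \<le> 2" by linarith
  qed
  moreover have "(\<Sum>z\<in>shifted_points \<theta> C Y. 1 / (cmod z)\<^sup>2 - 1 / Y) =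
     (\<Sum>z\<in>shifted_points \<theta> C Y. 1 / (cmod z)\<^sup>2) - real (card (shifted_points \<theta> C Y)) / Y"
    by (simp add: sum_subtractf)
  moreover have "real (card (shifted_points \<theta> C Y)) / Y \<le> pi + count_const C"
  proof -
    have "real (card (shifted_points \<theta> C Y)) \<le> pi * Y + count_const C * sqrt Y"
      using card_shifted_points[OF C CY, of \<theta>] by linarith
    also have "sqrt Y \<le> Y" using Y by (intro real_le_lsqrt) (auto simp: power2_eq_square)
    then have "pi * Y + count_const C * sqrt Y \<le> pi * Y + count_const C * Y" using count_const_ge(2)[OF C] by (intro add_left_mono mult_left_mono)
    finally show ?thesis using Y by (simp add: field_simps)
  qed
  moreover have "real (card (shifted_points \<theta> C Y)) / Y \<ge> 0" using Y by simp
  moreover have "ln (Y / C) = ln Y - ln C" using C Y by (simp add: ln_div)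
  ultimately show ?thesis using pi_gt_zero count_const_ge(2)[OF C] by (simp only:)
qed

text \<open>Bounds the circle errors accumulated over the first coordinate in
  \<open>card_pair_points\<close>.\<close>

lemma sum_inverse_norm:
  assumes C: "C \<ge> 1" and CY: "C \<le> Y"
  shows "(\<Sum>z\<in>shifted_points \<theta> C Y. 1 / cmod z) \<le> (2 * pi + 2 * count_const C) * sqrt Y"
proof -
  have Y: "Y \<ge> 1" using C CY by simp
  have "\<bar>(\<Sum>z\<in>shifted_points \<theta> C Y. 1 / sqrt ((cmod z)\<^sup>2) - 1 / sqrt Y) - pi * (sqrt Y - sqrt C)\<bar>
     \<le> count_const C * (ln Y / 2 - ln C / 2)"
  proof (rule abel_shifted_points[OF C CY, where g = "\<lambda>t. 1 / (2 * (t * sqrt t))"])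
    fix t assume t: "C \<le> t" "t \<le> Y"
    have tt: "t = sqrt t * sqrt t" using C t by simp
    show "((\<lambda>t. 1 / sqrt t - 1 / sqrt Y) has_real_derivative - (1 / (2 * (t * sqrt t)))) (at t)"
      using C t tt by (auto intro!: derivative_eq_intros simp: power2_eq_square field_simps)
    show "(sqrt has_real_derivative t * (1 / (2 * (t * sqrt t)))) (at t)"
      using C t by (auto intro!: derivative_eq_intros simp: field_simps)
    show "((\<lambda>t. ln t / 2) has_real_derivative sqrt t * (1 / (2 * (t * sqrt t)))) (at t)"
      using C t by (auto intro!: derivative_eq_intros simp: field_simps)
    show "0 \<le> 1 / (2 * (t * sqrt t))" using C t by simp
  qed auto
  moreover have "(\<Sum>z\<in>shifted_points \<theta> C Y. 1 / sqrt ((cmod z)\<^sup>2) - 1 / sqrt Y) =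
     (\<Sum>z\<in>shifted_points \<theta> C Y. 1 / cmod z) - real (card (shifted_points \<theta> C Y)) / sqrt Y"
    by (simp add: sum_subtractf)
  moreover have "real (card (shifted_points \<theta> C Y)) / sqrt Y \<le> pi * sqrt Y + count_const C"
  proof -
    have "real (card (shifted_points \<theta> C Y)) \<le> pi * Y + count_const C * sqrt Y"
      using card_shifted_points[OF C CY, of \<theta>] by linarith
    also have "\<dots> = (pi * sqrt Y + count_const C) * sqrt Y" using Y by (simp add: algebra_simps)
    finally show ?thesis using Y by (simp add: pos_divide_le_eq)
  qed
  moreover have "count_const C * (ln Y / 2 - ln C / 2) \<le> count_const C * sqrt Y"
  proof (intro mult_left_mono count_const_ge C)
    have "ln Y = 2 * ln (sqrt Y)" using Y by (simp add: ln_sqrt)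
    also have "\<dots> \<le> 2 * sqrt Y" using ln_le_minus_one[of "sqrt Y"] Y by simp
    finally show "ln Y / 2 - ln C / 2 \<le> sqrt Y" using C ln_ge_zero[of C] by linarith
  qed
  moreover have "pi * (sqrt Y - sqrt C) \<le> pi * sqrt Y" using C by simp
  moreover have "count_const C * 1 \<le> count_const C * sqrt Y" using Y count_const_ge(2)[OF C] by (intro mult_left_mono) auto
  ultimately show ?thesis by (simp only: ring_distribs mult_1_right)
qed

text \<open>Controls |z|^-4 with one factor |z| to spare, both in the tail of the zeta sum and when
  a logarithm is bounded by |z|.\<close>

lemma sum_inverse_norm_cubed:
  assumes Y: "Y \<ge> 1"
  shows "(\<Sum>z\<in>shifted_points 0 1 Y. 1 / cmod z ^ 3) \<le> 4 * pi + 3 * count_const 1"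
proof -
  have "\<bar>(\<Sum>z\<in>shifted_points 0 1 Y. 1 / ((cmod z)\<^sup>2 * sqrt ((cmod z)\<^sup>2)) - 1 / (Y * sqrt Y)) - pi * ((- 3 / sqrt Y) - (- 3 / sqrt 1))\<bar>
     \<le> count_const 1 * ((- (3/2) / Y) - (- (3/2) / 1))"
  proof (rule abel_shifted_points[where g = "\<lambda>t. 3 / (2 * (t\<^sup>2 * sqrt t))"])
    fix t :: real assume t: "1 \<le> t" "t \<le> Y"
    have tt: "t = sqrt t * sqrt t" using t by simp
    show "((\<lambda>t. 1 / (t * sqrt t) - 1 / (Y * sqrt Y)) has_real_derivative - (3 / (2 * (t\<^sup>2 * sqrt t)))) (at t)"
      using t tt by (auto intro!: derivative_eq_intros simp: power2_eq_square field_simps)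
    show "((\<lambda>t. - 3 / sqrt t) has_real_derivative t * (3 / (2 * (t\<^sup>2 * sqrt t)))) (at t)"
      using t tt by (auto intro!: derivative_eq_intros simp: power2_eq_square field_simps)
    show "((\<lambda>t. - (3/2) / t) has_real_derivative sqrt t * (3 / (2 * (t\<^sup>2 * sqrt t)))) (at t)"
      using t tt by (auto intro!: derivative_eq_intros simp: power2_eq_square field_simps)
    show "0 \<le> 3 / (2 * (t\<^sup>2 * sqrt t))" using t by simp
  qed (use Y in auto)
  moreover have "(\<Sum>z\<in>shifted_points 0 1 Y. 1 / ((cmod z)\<^sup>2 * sqrt ((cmod z)\<^sup>2)) - 1 / (Y * sqrt Y)) =
     (\<Sum>z\<in>shifted_points 0 1 Y. 1 / cmod z ^ 3) - real (card (shifted_points 0 1 Y)) / (Y * sqrt Y)"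
    by (simp add: sum_subtractf power2_eq_square power3_eq_cube mult_ac)
  moreover have "real (card (shifted_points 0 1 Y)) / (Y * sqrt Y) \<le> pi + count_const 1"
  proof -
    have s: "sqrt Y \<le> Y" "1 \<le> sqrt Y" using Y by (auto intro!: real_le_lsqrt simp: power2_eq_square)
    have "real (card (shifted_points 0 1 Y)) \<le> pi * Y + count_const 1 * sqrt Y"
      using card_shifted_points[of 1 Y 0] Y by linarith
    also have "\<dots> \<le> pi * (Y * sqrt Y) + count_const 1 * (Y * sqrt Y)"
      using s Y count_const_ge(2)[of 1] by (intro add_mono mult_left_mono) auto
    finally show ?thesis using Y by (simp add: pos_divide_le_eq algebra_simps)
  qed
  moreover have "(3/2) / Y \<ge> 0" using Y by simp
  then have "count_const 1 * ((- (3/2) / Y) - (- (3/2) / 1)) \<le> count_const 1 * 2"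
    by (intro mult_left_mono count_const_ge) linarith+
  moreover have "pi * ((- 3 / sqrt Y) - (- 3 / sqrt 1)) \<le> pi * 3" using Y by (intro mult_left_mono) auto
  ultimately show ?thesis by (simp only:)
qed

text \<open>Here (ln Y - ln t) / t vanishes at \<open>Y\<close> by itself. The main term is pi times
  the integral of (1 + ln Y - ln t) / t from 1 to \<open>Y\<close>, which is (ln Y)^2 / 2 + ln
  Y.\<close>

lemma sum_log_inverse_norm_sq:
  assumes Y: "Y \<ge> 1"
  shows "\<bar>(\<Sum>z\<in>shifted_points 0 1 Y. ln (Y / (cmod z)\<^sup>2) / (cmod z)\<^sup>2) - pi / 2 * (ln Y)\<^sup>2\<bar>
     \<le> (pi + 4 * count_const 1) * (ln Y + 1)"
proof -
  let ?L = "ln Y"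
  let ?F = "\<lambda>t. ln t * (1 + ?L) - (ln t)\<^sup>2 / 2" and ?H = "\<lambda>t. - 2 * (1 + ?L - ln t) / sqrt t + 4 / sqrt t"
  have "\<bar>(\<Sum>z\<in>shifted_points 0 1 Y. (?L - ln ((cmod z)\<^sup>2)) / (cmod z)\<^sup>2) - pi * (?F Y - ?F 1)\<bar>
     \<le> count_const 1 * (?H Y - ?H 1)"
  proof (rule abel_shifted_points[where g = "\<lambda>t. (1 + ?L - ln t) / t\<^sup>2"])
    fix t :: real assume t: "1 \<le> t" "t \<le> Y"
    have tt: "t = sqrt t * sqrt t" using t by simp
    \<comment> \<open>The polynomial identity that remains, with s = sqrt t, after clearing
      denominators in the derivative of \<open>?H\<close>.\<close>
    have gen: "t * (t * (t * (t * (s * (?L * 2))))) + t * (t * (t * (s * (s * (s * (ln t * 2)))))) =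
        t * (t * (t * (t * (s * (ln t * 2))))) + t * (t * (t * (s * (s * (s * (?L * 2))))))" if "t = s * s" for s
      by (rule eq_of_diff_multiple[OF that, where k = "2 * t * t * t * s * (?L - ln t)"]) (simp add: algebra_simps)
    show "((\<lambda>t. (?L - ln t) / t) has_real_derivative - ((1 + ?L - ln t) / t\<^sup>2)) (at t)"
      using t by (auto intro!: derivative_eq_intros simp: power2_eq_square field_simps)
    show "(?F has_real_derivative t * ((1 + ?L - ln t) / t\<^sup>2)) (at t)"
      using t by (auto intro!: derivative_eq_intros simp: power2_eq_square field_simps)
    show "(?H has_real_derivative sqrt t * ((1 + ?L - ln t) / t\<^sup>2)) (at t)"
      using t by (auto intro!: derivative_eq_intros simp: power2_eq_square field_simps) (rule gen[OF tt])
    have "ln t \<le> ln Y" using t by simp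
    then show "0 \<le> (1 + ?L - ln t) / t\<^sup>2" by simp
  qed (use Y in auto)
  moreover have "(\<Sum>z\<in>shifted_points 0 1 Y. (?L - ln ((cmod z)\<^sup>2)) / (cmod z)\<^sup>2) =
      (\<Sum>z\<in>shifted_points 0 1 Y. ln (Y / (cmod z)\<^sup>2) / (cmod z)\<^sup>2)"
  proof (rule sum.cong)
    fix z assume "z \<in> shifted_points 0 1 Y"
    then have "(cmod z)\<^sup>2 \<ge> 1" by (simp add: shifted_points_def)
    then show "(?L - ln ((cmod z)\<^sup>2)) / (cmod z)\<^sup>2 = ln (Y / (cmod z)\<^sup>2) / (cmod z)\<^sup>2"
      using Y by (subst ln_div) auto
  qed auto
  moreover have "pi * (?F Y - ?F 1) = pi / 2 * ?L\<^sup>2 + pi * ?L" by (simp add: power2_eq_square field_simps)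
  moreover have "count_const 1 * (?H Y - ?H 1) \<le> count_const 1 * (2 * ?L + 2)"
  proof (intro mult_left_mono count_const_ge)
    have "2 / sqrt Y \<le> 2" using Y by (simp add: field_simps)
    moreover have "?H Y - ?H 1 = 2 / sqrt Y + 2 * ?L - 2" by (simp add: field_simps)
    ultimately show "?H Y - ?H 1 \<le> 2 * ?L + 2" by linarith
  qed auto
  moreover have "pi * ?L \<ge> 0" "count_const 1 * ?L \<ge> 0" using Y count_const_ge(2)[of 1] by simp_all
  moreover have "count_const 1 \<ge> 0" by (rule count_const_ge) simp
  ultimately show ?thesis using pi_gt_zero by (simp only: ring_distribs)
qed

section \<open>Coprime residues\<close>

text \<open>Representatives modulo \<open>s\<close> in the half-open square spanned by
  \<open>s\<close> and \<open>\<i> * s\<close>; the same normalisation of \<open>u\<close> makes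
  tuples unique later.\<close>

definition residues :: "complex \<Rightarrow> complex set" where
  "residues s = {u \<in> ZI. gfloor (u / s) = 0}"

definition coprime_residues :: "complex \<Rightarrow> complex set" where
  "coprime_residues s = {u \<in> residues s. gcop u s}"

lemma finite_residues: "s \<noteq> 0 \<Longrightarrow> finite (residues s)"
proof (rule finite_subset)
  assume s: "s \<noteq> 0"
  show "residues s \<subseteq> {z \<in> ZI. (cmod z)\<^sup>2 \<le> (2 * cmod s)\<^sup>2}"
  proof
    fix u assume u: "u \<in> residues s"
    then have "\<bar>Re (u / s)\<bar> \<le> 1" "\<bar>Im (u / s)\<bar> \<le> 1" by (auto simp: residues_def gfloor_eq_0_iff)
    then have "cmod (u / s) \<le> 2" using cmod_le[of "u / s"] by linarith
    then have "cmod u \<le> 2 * cmod s" using s by (simp add: norm_divide field_simps)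
    then have "(cmod u)\<^sup>2 \<le> (2 * cmod s)\<^sup>2" by (intro power_mono) auto
    then show "u \<in> {z \<in> ZI. (cmod z)\<^sup>2 \<le> (2 * cmod s)\<^sup>2}" using u by (simp add: residues_def)
  qed
qed (rule finite_ZI_ball)

lemma finite_coprime_residues: "s \<noteq> 0 \<Longrightarrow> finite (coprime_residues s)"
  using finite_residues by (auto simp: coprime_residues_def)

text \<open>Dividing a residue class modulo \<open>s\<close> by \<open>s\<close> gives the lattice
  shifted by r / s.\<close>

lemma card_shifted_points_residues:
  assumes s: "s \<in> ZI" "s \<noteq> 0"
  shows "card (shifted_points 0 0 t) = (\<Sum>r\<in>residues s. card (shifted_points (r / s) 0 (t / (cmod s)\<^sup>2)))"
proof -
  let ?S = "SIGMA r:residues s. shifted_points (r / s) 0 (t / (cmod s)\<^sup>2)"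
  have nrm: "(cmod (z * s))\<^sup>2 \<le> t \<longleftrightarrow> (cmod z)\<^sup>2 \<le> t / (cmod s)\<^sup>2" for z
    using s by (simp add: norm_mult power_mult_distrib field_simps)
  have "bij_betw (\<lambda>(r, z). z * s) ?S (shifted_points 0 0 t)"
  proof (rule bij_betw_byWitness[where f' = "\<lambda>w. (w - gfloor (w / s) * s, w / s)"], goal_cases)
    case 1
    show ?case
    proof safe
      fix r z assume r: "r \<in> residues s" and z: "z \<in> shifted_points (r / s) 0 (t / (cmod s)\<^sup>2)"
      have "gfloor (r / s + (z - r / s)) = gfloor (r / s) + (z - r / s)"
        using z by (intro gfloor_add) (simp add: shifted_points_def)
      then have "gfloor z = z - r / s" using r by (simp add: residues_def)
      then have "z = gfloor z + r / s" by simp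
      then have "z * s = gfloor z * s + r" using s by (metis distrib_right nonzero_eq_divide_eq)
      moreover show zs: "z * s / s = z" using s by simp
      ultimately show "z * s - gfloor (z * s / s) * s = r" unfolding zs by simp
    qed
  next
    case 2
    show ?case using s by auto
  next
    case 3
    show ?case
    proof safe
      fix r z assume r: "r \<in> residues s" and z: "z \<in> shifted_points (r / s) 0 (t / (cmod s)\<^sup>2)"
      have "z - r / s \<in> ZI" "r \<in> ZI" using r z by (simp_all add: residues_def shifted_points_def)
      then have "(z - r / s) * s + r \<in> ZI" using ZI_closed(1)[OF ZI_closed(3)[OF _ s(1)]] by simp
      then have "z * s \<in> ZI" using s by (simp add: algebra_simps)
      then show "z * s \<in> shifted_points 0 0 t" using z nrm[of z] by (simp add: shifted_points_def)
    qed
  next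
    case 4
    show ?case
    proof safe
      fix w assume w: "w \<in> shifted_points 0 0 t"
      then have wI: "w \<in> ZI" by (simp add: shifted_points_def)
      then have "w - gfloor (w / s) * s \<in> ZI" using s by (intro ZI_closed) auto
      moreover have q: "(w - gfloor (w / s) * s) / s = w / s - gfloor (w / s)" using s by (simp add: diff_divide_distrib)
      ultimately show "w - gfloor (w / s) * s \<in> residues s" by (simp add: residues_def gfloor_diff_eq_0)
      show "w / s \<in> shifted_points ((w - gfloor (w / s) * s) / s) 0 (t / (cmod s)\<^sup>2)"
        unfolding q using w nrm[of "w / s"] s by (simp add: shifted_points_def)
    qed
  qed
  then have "card ?S = card (shifted_points 0 0 t)" by (rule bij_betw_same_card)
  then show ?thesis using s by (simp add: finite_residues)
qed

text \<open>
  Both sides are densities: compare the number of lattice points in a large disc with the number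
  of points of each residue class in it.
\<close>

lemma card_residues:
  assumes s: "s \<in> ZI" "s \<noteq> 0"
  shows "real (card (residues s)) = (cmod s)\<^sup>2"
proof (rule ccontr)
  assume ne: "real (card (residues s)) \<noteq> (cmod s)\<^sup>2"
  let ?N = "(cmod s)\<^sup>2" and ?c = "real (card (residues s))"
  define K where "K = 8 * pi + ?c * (8 * pi)"
  have N1: "?N \<ge> 1" using s by (rule ZI_norm_ge_1)
  have K0: "K > 0" by (simp add: K_def add_pos_nonneg)
  \<comment> \<open>The circle estimates for the whole lattice and for its classes leave a linear
    term against an error of order sqrt t.\<close>
  have bd: "pi * \<bar>?c / ?N - 1\<bar> * t \<le> K * sqrt t" if t: "t \<ge> ?N" for t
  proof -
    have t1: "t \<ge> 1" using t N1 by linarith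
    have t2: "t / ?N \<ge> 1" using t N1 by (subst le_divide_eq_1_pos) linarith+
    have "\<bar>real (card (shifted_points (r / s) 0 (t / ?N))) - pi * (t / ?N)\<bar> \<le> 8 * pi * sqrt t" for r
    proof -
      have "t * 1 \<le> t * ?N" using N1 t1 by (intro mult_left_mono) auto
      then have "t / ?N \<le> t" using N1 by (subst pos_divide_le_eq) linarith+
      then have "8 * pi * sqrt (t / ?N) \<le> 8 * pi * sqrt t" by simp
      with gauss_circle[OF t2, of "r / s"] show ?thesis by linarith
    qed
    then have "\<bar>\<Sum>r\<in>residues s. (real (card (shifted_points (r / s) 0 (t / ?N))) - pi * (t / ?N))\<bar> \<le> (\<Sum>r\<in>residues s. 8 * pi * sqrt t)"
      by (intro order_trans[OF sum_abs] sum_mono)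
    then have "\<bar>real (card (shifted_points 0 0 t)) - ?c * (pi * (t / ?N))\<bar> \<le> ?c * (8 * pi * sqrt t)"
      by (simp add: card_shifted_points_residues[OF s] sum_subtractf)
    with gauss_circle[OF t1, of 0] have "\<bar>?c * (pi * (t / ?N)) - pi * t\<bar> \<le> K * sqrt t"
      unfolding K_def by (simp add: algebra_simps)
    also have "?c * (pi * (t / ?N)) - pi * t = pi * (?c / ?N - 1) * t" by (simp add: algebra_simps)
    finally show ?thesis using t1 by (simp add: abs_mult)
  qed
  define \<delta> where "\<delta> = pi * \<bar>?c / ?N - 1\<bar>"
  have "?c / ?N - 1 \<noteq> 0" using ne N1 s by (simp add: divide_eq_eq)
  then have d0: "\<delta> > 0" by (simp add: \<delta>_def)
  \<comment> \<open>At radius x = sqrt t the linear term exceeds the error; x >= |s| makes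
    \<open>bd\<close> applicable.\<close>
  define x where "x = max (cmod s) (K / \<delta> + 1)"
  have x: "x \<ge> cmod s" "x > K / \<delta>" by (auto simp: x_def)
  have "0 < cmod s" using s by simp
  with x(1) have "x > 0" by linarith
  note x = x this
  have "\<delta> * x\<^sup>2 \<le> K * x" using bd[of "x\<^sup>2"] x by (simp add: \<delta>_def power_mono)
  then have "\<delta> * x \<le> K" using x by (simp add: power2_eq_square)
  with x(2) d0 show False by (simp add: field_simps)
qed

section \<open>The Gaussian totient\<close>

definition phi :: "complex \<Rightarrow> real" where "phi s = real (card (coprime_residues s))"

lemma phi_nonneg [simp]: "phi s \<ge> 0" by (simp add: phi_def)

lemma phi_le:
  assumes "s \<in> ZI" "s \<noteq> 0"
  shows "phi s \<le> (cmod s)\<^sup>2"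
proof -
  have "card (coprime_residues s) \<le> card (residues s)" using assms by (intro card_mono finite_residues) (auto simp: coprime_residues_def)
  then show ?thesis using card_residues[OF assms] by (simp add: phi_def)
qed

definition divisors :: "complex \<Rightarrow> complex set" where
  "divisors n = {d \<in> ZI. gdvd d n}"

lemma gdvd_norm_le:
  assumes "gdvd d n" "n \<noteq> 0" "d \<in> ZI"
  shows "(cmod d)\<^sup>2 \<le> (cmod n)\<^sup>2" "d \<noteq> 0"
proof -
  obtain k where k: "k \<in> ZI" "n = d * k" using assms by (auto simp: gdvd_def)
  then show "d \<noteq> 0" using assms by auto
  have "cmod d * 1 \<le> cmod d * cmod k" using k assms ZI_norm_ge_1[of k] by (intro mult_left_mono) auto
  then show "(cmod d)\<^sup>2 \<le> (cmod n)\<^sup>2" using k by (intro power_mono) (auto simp: norm_mult)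
qed

lemma finite_divisors: "n \<noteq> 0 \<Longrightarrow> finite (divisors n)"
  using gdvd_norm_le(1)[of _ n] by (intro finite_subset[OF _ finite_ZI_ball[of "(cmod n)\<^sup>2"]]) (simp add: divisors_def subset_eq)

text \<open>As for Euler's totient, each fraction r / n is reduced to lowest terms u / d. Lowest
  terms are unique only up to units, and all four associates of \<open>d\<close> are counted, hence
  the factor 4.\<close>

lemma sum_phi_divisors:
  assumes n: "n \<in> ZI" "n \<noteq> 0"
  shows "(\<Sum>d\<in>divisors n. phi d) = 4 * (cmod n)\<^sup>2"
proof -
  let ?S = "SIGMA d:divisors n. coprime_residues d" and ?f = "\<lambda>(d, u). n / d * u"
  have d0: "d \<noteq> 0" if "d \<in> divisors n" for d using that n gdvd_norm_le by (auto simp: divisors_def)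
  have finS: "finite ?S" using n d0 by (auto intro!: finite_SigmaI finite_divisors finite_coprime_residues)
  have img: "?f ` ?S \<subseteq> residues n"
  proof safe
    fix d u assume d: "d \<in> divisors n" and u: "u \<in> coprime_residues d"
    obtain k where k: "k \<in> ZI" "n = d * k" using d by (auto simp: divisors_def gdvd_def)
    have "n / d * u = k * u" "n / d * u / n = u / d" using k n d0[OF d] by (simp_all add: field_simps)
    then show "n / d * u \<in> residues n" using k u unfolding residues_def coprime_residues_def by auto
  qed
  have fib: "card {p \<in> ?S. ?f p = r} = 4" if r: "r \<in> residues n" for r
  proof -
    have rI: "r \<in> ZI" "gfloor (r / n) = 0" using r by (auto simp: residues_def)
    obtain g r' n' where g: "g \<in> ZI" "g \<noteq> 0" "r' \<in> ZI" "n' \<in> ZI" "r = g * r'" "n = g * n'" "gcop r' n'"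
      using rI(1) n(1) disjI2[OF n(2)] by (rule ZI_coprime_part)
    then obtain a b where ab: "a \<in> ZI" "b \<in> ZI" "a * r' + b * n' = 1" by (auto simp: gcop_def)
    have n'0: "n' \<noteq> 0" using g n by auto
    have "{p \<in> ?S. ?f p = r} = (\<lambda>\<epsilon>. (n' * \<epsilon>, r' * \<epsilon>)) ` gunits"
    proof (intro equalityI subsetI)
      fix p assume "p \<in> {p \<in> ?S. ?f p = r}"
      then obtain d u where p: "p = (d, u)" and d: "d \<in> divisors n" and u: "u \<in> coprime_residues d" and e: "n / d * u = r"
        by auto
      obtain k where k: "k \<in> ZI" "n = d * k" using d by (auto simp: divisors_def gdvd_def)
      have dd: "d \<in> ZI" "d \<noteq> 0" using d d0 by (auto simp: divisors_def)
      have ku: "r = k * u" using e k dd by (simp add: field_simps)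
      obtain x y where xy: "x \<in> ZI" "y \<in> ZI" "x * u + y * d = 1" using u by (auto simp: coprime_residues_def gcop_def)
      have uI: "u \<in> ZI" using u by (auto simp: coprime_residues_def residues_def)
      \<comment> \<open>The two Bezout identities give k = g \<eta> and g = k \<zeta>, so these are
        mutually inverse units.\<close>
      define \<eta> \<zeta> where "\<eta> = x * r' + y * n'" and "\<zeta> = a * u + b * d"
      have eta: "\<eta> \<in> ZI" "\<zeta> \<in> ZI" unfolding \<eta>_def \<zeta>_def using xy g ab uI dd by (auto intro!: ZI_closed)
      have "k = k * (x * u + y * d)" using xy by simp
      also have "\<dots> = x * r + y * n" unfolding ku k(2) by (simp add: algebra_simps)
      also have "\<dots> = g * \<eta>" unfolding g(5,6) \<eta>_def by (simp add: algebra_simps)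
      finally have kg: "k = g * \<eta>" .
      have "g = g * (a * r' + b * n')" using ab by simp
      also have "\<dots> = a * r + b * n" unfolding g(5,6) by (simp add: algebra_simps)
      also have "\<dots> = k * \<zeta>" unfolding ku k(2) \<zeta>_def by (simp add: algebra_simps)
      finally have "g = g * \<eta> * \<zeta>" unfolding kg .
      then have ez: "\<eta> * \<zeta> = 1" using g(2) by simp
      have z: "\<zeta> \<in> gunits" by (rule ZI_unit_mult(2)[OF eta ez])
      have "g * n' = d * k" using g(6) k(2) by simp
      also have "\<dots> = g * (\<eta> * d)" unfolding kg by (simp add: mult_ac)
      finally have "n' = \<eta> * d" using g(2) mult_left_cancel by blast
      then have "d = n' * \<zeta>" using ez by (simp add: mult_ac)
      moreover have "g * r' = k * u" using g(5) ku by simp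
      then have "g * r' = g * (\<eta> * u)" unfolding kg by (simp add: mult_ac)
      then have "r' = \<eta> * u" using g(2) mult_left_cancel by blast
      then have "u = r' * \<zeta>" using ez by (simp add: mult_ac)
      ultimately show "p \<in> (\<lambda>\<epsilon>. (n' * \<epsilon>, r' * \<epsilon>)) ` gunits" using z p by blast
    next
      fix p assume "p \<in> (\<lambda>\<epsilon>. (n' * \<epsilon>, r' * \<epsilon>)) ` gunits"
      then obtain \<epsilon> where e: "\<epsilon> \<in> gunits" and p: "p = (n' * \<epsilon>, r' * \<epsilon>)" by auto
      have e2: "\<epsilon> * cnj \<epsilon> = 1" "\<epsilon> \<noteq> 0" "cnj \<epsilon> \<in> ZI" "\<epsilon> \<in> ZI" using e by (auto simp: gunits_def)
      have "n' * \<epsilon> * (g * cnj \<epsilon>) = g * n' * (\<epsilon> * cnj \<epsilon>)" by (simp only: mult_ac)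
      then have "n = n' * \<epsilon> * (g * cnj \<epsilon>)" using g(6) e2(1) by simp
      moreover have "g * cnj \<epsilon> \<in> ZI" "n' * \<epsilon> \<in> ZI" using e2 g ZI_closed(3) by blast+
      ultimately have 1: "n' * \<epsilon> \<in> divisors n" unfolding divisors_def gdvd_def by blast
      have "r' * \<epsilon> / (n' * \<epsilon>) = r / n" using g e2 by simp
      then have 2: "r' * \<epsilon> \<in> residues (n' * \<epsilon>)" using rI(2) g e2 by (auto simp: residues_def)
      have "(a * cnj \<epsilon>) * (r' * \<epsilon>) + (b * cnj \<epsilon>) * (n' * \<epsilon>) = (a * r' + b * n') * (\<epsilon> * cnj \<epsilon>)"
        by (simp add: algebra_simps)
      then have 3: "gcop (r' * \<epsilon>) (n' * \<epsilon>)" using ab e2 unfolding gcop_def by (metis ZI_closed(3) mult_1)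
      have "n / (n' * \<epsilon>) * (r' * \<epsilon>) = r" using g n'0 e2 by (simp add: field_simps)
      then show "p \<in> {p \<in> ?S. ?f p = r}" using 1 2 3 p by (simp add: coprime_residues_def)
    qed
    moreover have "inj_on (\<lambda>\<epsilon>. (n' * \<epsilon>, r' * \<epsilon>)) gunits" using n'0 by (auto simp: inj_on_def)
    ultimately show ?thesis by (simp add: card_image card_gunits)
  qed
  have "(\<Sum>d\<in>divisors n. phi d) = real (card ?S)"
    using n d0 by (simp add: phi_def finite_divisors finite_coprime_residues)
  also have "card ?S = (\<Sum>r\<in>residues n. card {p \<in> ?S. ?f p = r})"
    using sum.group[OF finS finite_residues[OF n(2)] img, of "\<lambda>_. 1::nat"] by simp
  also have "\<dots> = 4 * card (residues n)" using fib by simp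
  finally show ?thesis using card_residues[OF n] by simp
qed

text \<open>The four units alone contribute 4; the upper bound uses G <= 1 and pi^2 < 12.\<close>

lemma zeta_sum_bounds: "zeta_sum \<ge> 4" "zeta_sum < 8"
proof -
  have "(\<Sum>z\<in>gunits. 1 / (cmod z) ^ 4) \<le> zeta_sum"
    by (rule finite_sum_le_has_sum[OF ZI_zeta_has_sum]) (auto simp: finite_gunits gunits_def)
  moreover have "(\<Sum>z\<in>gunits. 1 / (cmod z) ^ 4) = 4" by (simp add: gunits_norm card_gunits)
  ultimately show "zeta_sum \<ge> 4" by simp
  have "catalan \<le> 1"
  proof -
    have m: "1 / (2 * real (Suc n) + 1)\<^sup>2 \<le> 1 / (2 * real n + 1)\<^sup>2" for n
      by (intro divide_left_mono power_mono) auto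
    have "(\<lambda>n. 1 / (2 * real n + 1)\<^sup>2) \<longlonglongrightarrow> 0" by real_asymp
    from summable_Leibniz'(4)[OF this _ m, of 0] show ?thesis
      unfolding catalan_def by simp
  qed
  moreover have "pi\<^sup>2 \<le> 3.15\<^sup>2" using pi_approx by (intro power_mono) auto
  then have "4 * (pi\<^sup>2 / 6) < 8" by (simp add: power2_eq_square)
  moreover have "catalan * pi\<^sup>2 \<le> 1 * pi\<^sup>2" using \<open>catalan \<le> 1\<close> by (rule mult_right_mono) simp
  moreover have "zeta_sum = 4 / 6 * (catalan * pi\<^sup>2)" by (simp add: zeta_sum_def)
  ultimately show "zeta_sum < 8" by linarith
qed

section \<open>Logarithmic averages of the totient\<close>

abbreviation "ZI_ball Y \<equiv> shifted_points 0 1 Y"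

lemma ZI_ball_iff: "z \<in> ZI_ball Y \<longleftrightarrow> z \<in> ZI \<and> z \<noteq> 0 \<and> (cmod z)\<^sup>2 \<le> Y"
  using ZI_norm_ge_1(1) by (auto simp: shifted_points_def)

lemma ZI_ball_ge_1: "z \<in> ZI_ball Y \<Longrightarrow> (cmod z)\<^sup>2 \<ge> 1"
  by (simp add: shifted_points_def)

definition phi_log_sum :: "real \<Rightarrow> real" where
  "phi_log_sum Y = (\<Sum>s\<in>ZI_ball Y. phi s / cmod s ^ 4 * ln (Y / (cmod s)\<^sup>2))"

text \<open>With n = e s the logarithm depends on \<open>n\<close> alone, so the totient is summed
  over the divisors of \<open>n\<close>. This replaces it by the plain sum of
  \<open>sum_log_inverse_norm_sq\<close>, at the price of a convolution that has to be
  undone.\<close>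

lemma phi_log_sum_convolution:
  "(\<Sum>e\<in>ZI_ball Y. 1 / cmod e ^ 4 * phi_log_sum (Y / (cmod e)\<^sup>2)) = 4 * (\<Sum>n\<in>ZI_ball Y. ln (Y / (cmod n)\<^sup>2) / (cmod n)\<^sup>2)"
proof -
  let ?g = "\<lambda>n d. ln (Y / (cmod n)\<^sup>2) / cmod n ^ 4 * phi d"
  have e: "(cmod e)\<^sup>2 > 0" if "e \<in> ZI_ball Y" for e using ZI_ball_ge_1[OF that] by linarith
  have "(\<Sum>e\<in>ZI_ball Y. 1 / cmod e ^ 4 * phi_log_sum (Y / (cmod e)\<^sup>2)) =
     (\<Sum>e\<in>ZI_ball Y. \<Sum>s\<in>ZI_ball (Y / (cmod e)\<^sup>2). ?g (e * s) s)"
    by (simp add: phi_log_sum_def sum_distrib_left norm_mult power_mult_distrib mult_ac)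
  also have "\<dots> = (\<Sum>(e, s)\<in>(SIGMA e:ZI_ball Y. ZI_ball (Y / (cmod e)\<^sup>2)). ?g (e * s) s)"
    by (subst sum.Sigma) auto
  also have "\<dots> = (\<Sum>(n, d)\<in>(SIGMA n:ZI_ball Y. divisors n). ?g n d)"
  proof (rule sum.reindex_bij_witness[of _ "\<lambda>(n, d). (n / d, d)" "\<lambda>(e, s). (e * s, s)"])
    fix p assume "p \<in> (SIGMA e:ZI_ball Y. ZI_ball (Y / (cmod e)\<^sup>2))"
    then obtain e s where p: "p = (e, s)" and es: "e \<in> ZI_ball Y" "s \<in> ZI_ball (Y / (cmod e)\<^sup>2)" by auto
    show "(case case p of (e, s) \<Rightarrow> (e * s, s) of (n, d) \<Rightarrow> (n / d, d)) = p" using es by (simp add: ZI_ball_iff p)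
    show "(case case p of (e, s) \<Rightarrow> (e * s, s) of (n, d) \<Rightarrow> ?g n d) = (case p of (e, s) \<Rightarrow> ?g (e * s) s)"
      by (simp add: p)
    have "(cmod s)\<^sup>2 * (cmod e)\<^sup>2 \<le> Y" using es e[of e] by (simp add: ZI_ball_iff field_simps)
    then have "e * s \<in> ZI_ball Y" using es by (auto simp: ZI_ball_iff norm_mult power_mult_distrib mult_ac)
    moreover have "s \<in> divisors (e * s)" using es by (auto simp: divisors_def gdvd_def ZI_ball_iff mult_ac)
    ultimately show "(case p of (e, s) \<Rightarrow> (e * s, s)) \<in> (SIGMA n:ZI_ball Y. divisors n)" by (simp add: p)
  next
    fix p assume "p \<in> (SIGMA n:ZI_ball Y. divisors n)"
    then obtain n d where p: "p = (n, d)" and n: "n \<in> ZI_ball Y" and d: "d \<in> divisors n" by auto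
    obtain k where k: "k \<in> ZI" "n = d * k" using d by (auto simp: divisors_def gdvd_def)
    have nz: "d \<noteq> 0" "k \<noteq> 0" using n k by (auto simp: ZI_ball_iff)
    have kd: "n / d = k" using k nz by simp
    have dI: "d \<in> ZI" using d by (simp add: divisors_def)
    have nrm: "(cmod d)\<^sup>2 * (cmod k)\<^sup>2 \<le> Y" using n k by (simp add: ZI_ball_iff norm_mult power_mult_distrib)
    have k1: "(cmod k)\<^sup>2 \<ge> 1" "(cmod d)\<^sup>2 \<ge> 1" using k dI nz ZI_norm_ge_1 by auto
    have "1 * (cmod k)\<^sup>2 \<le> (cmod d)\<^sup>2 * (cmod k)\<^sup>2" using k1 by (intro mult_right_mono) auto
    then have "(cmod k)\<^sup>2 \<le> Y" using nrm by linarith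
    then have kB: "k \<in> ZI_ball Y" using k nz by (simp add: ZI_ball_iff)
    have "(cmod d)\<^sup>2 \<le> Y / (cmod k)\<^sup>2" using nrm nz by (simp add: field_simps)
    then have "d \<in> ZI_ball (Y / (cmod k)\<^sup>2)" using dI nz by (auto simp: ZI_ball_iff)
    then show "(case p of (n, d) \<Rightarrow> (n / d, d)) \<in> (SIGMA e:ZI_ball Y. ZI_ball (Y / (cmod e)\<^sup>2))" using kB by (simp add: p kd)
    show "(case case p of (n, d) \<Rightarrow> (n / d, d) of (e, s) \<Rightarrow> (e * s, s)) = p" using nz by (simp add: p)
  qed
  also have "\<dots> = (\<Sum>n\<in>ZI_ball Y. \<Sum>d\<in>divisors n. ?g n d)"
    by (subst sum.Sigma) (auto simp: finite_divisors ZI_ball_iff)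
  also have "\<dots> = (\<Sum>n\<in>ZI_ball Y. 4 * (ln (Y / (cmod n)\<^sup>2) / (cmod n)\<^sup>2))"
  proof (rule sum.cong)
    fix n assume n: "n \<in> ZI_ball Y"
    have "(\<Sum>d\<in>divisors n. ?g n d) = ln (Y / (cmod n)\<^sup>2) / cmod n ^ 4 * (4 * (cmod n)\<^sup>2)"
      using n sum_phi_divisors[of n] by (simp only: sum_distrib_left[symmetric] ZI_ball_iff not_False_eq_True)
    then show "(\<Sum>d\<in>divisors n. ?g n d) = 4 * (ln (Y / (cmod n)\<^sup>2) / (cmod n)\<^sup>2)"
      using n by (simp add: ZI_ball_iff power2_eq_square power4_eq_xxxx field_simps)
  qed auto
  also have "\<dots> = 4 * (\<Sum>n\<in>ZI_ball Y. ln (Y / (cmod n)\<^sup>2) / (cmod n)\<^sup>2)" by (simp add: sum_distrib_left)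
  finally show ?thesis .
qed

definition cube_const :: real where "cube_const = 4 * pi + 3 * count_const 1"

lemma cube_const_pos: "cube_const > 0" using count_const_ge(2)[of 1] by (simp add: cube_const_def add_pos_nonneg)

lemma zeta_partial_le: "(\<Sum>e\<in>ZI_ball Y. 1 / cmod e ^ 4) \<le> zeta_sum"
  by (rule finite_sum_le_has_sum[OF ZI_zeta_has_sum]) (auto simp: ZI_ball_iff)

text \<open>Outside the ball 1 / |e| is at most 1 / sqrt Y, and the remaining |e|^-3 is
  summable.\<close>

lemma zeta_tail:
  assumes Y: "Y \<ge> 1"
  shows "zeta_sum \<le> (\<Sum>e\<in>ZI_ball Y. 1 / cmod e ^ 4) + cube_const / sqrt Y"
proof (rule has_sum_le_finite_sums[OF ZI_zeta_has_sum])
  fix F :: "complex set" assume F: "finite F" "F \<subseteq> ZI - {0}"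
  define Y' where "Y' = Max (insert 1 ((\<lambda>e. (cmod e)\<^sup>2) ` F))"
  have Y'1: "Y' \<ge> 1" unfolding Y'_def using F by (intro Max_ge) auto
  have FY: "F \<subseteq> ZI_ball Y'"
  proof
    fix e assume e: "e \<in> F"
    then have "(cmod e)\<^sup>2 \<le> Y'" unfolding Y'_def using F by (intro Max_ge) auto
    then show "e \<in> ZI_ball Y'" using F e by (auto simp: ZI_ball_iff)
  qed
  have "(\<Sum>e\<in>F. 1 / cmod e ^ 4) = (\<Sum>e\<in>F \<inter> ZI_ball Y. 1 / cmod e ^ 4) + (\<Sum>e\<in>F - ZI_ball Y. 1 / cmod e ^ 4)"
    using F by (subst sum.union_disjoint[symmetric]) (auto intro: arg_cong[of _ _ "sum _"])
  also have "(\<Sum>e\<in>F \<inter> ZI_ball Y. 1 / cmod e ^ 4) \<le> (\<Sum>e\<in>ZI_ball Y. 1 / cmod e ^ 4)"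
    by (rule sum_mono2) auto
  also have "(\<Sum>e\<in>F - ZI_ball Y. 1 / cmod e ^ 4) \<le> (\<Sum>e\<in>F - ZI_ball Y. 1 / sqrt Y * (1 / cmod e ^ 3))"
  proof (rule sum_mono)
    fix e assume e: "e \<in> F - ZI_ball Y"
    then have "e \<in> ZI" "e \<noteq> 0" "(cmod e)\<^sup>2 > Y" using F by (auto simp: ZI_ball_iff)
    then have "sqrt Y \<le> cmod e" by (simp add: real_le_lsqrt)
    then have "1 / cmod e \<le> 1 / sqrt Y" using Y \<open>e \<noteq> 0\<close> by (intro divide_left_mono mult_pos_pos) auto
    then have "1 / cmod e * (1 / cmod e ^ 3) \<le> 1 / sqrt Y * (1 / cmod e ^ 3)" by (intro mult_right_mono) auto
    then show "1 / cmod e ^ 4 \<le> 1 / sqrt Y * (1 / cmod e ^ 3)" by (simp add: power4_eq_xxxx power3_eq_cube mult_ac)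
  qed
  also have "\<dots> = 1 / sqrt Y * (\<Sum>e\<in>F - ZI_ball Y. 1 / cmod e ^ 3)" by (simp only: sum_distrib_left)
  also have "(\<Sum>e\<in>F - ZI_ball Y. 1 / cmod e ^ 3) \<le> (\<Sum>e\<in>ZI_ball Y'. 1 / cmod e ^ 3)"
    using FY by (intro sum_mono2) auto
  also have "\<dots> \<le> cube_const" unfolding cube_const_def by (rule sum_inverse_norm_cubed[OF Y'1])
  finally show "(\<Sum>e\<in>F. 1 / cmod e ^ 4) \<le> (\<Sum>e\<in>ZI_ball Y. 1 / cmod e ^ 4) + cube_const / sqrt Y"
    using Y by (simp add: divide_right_mono mult_left_mono)
qed

text \<open>With L = ln Y and x = ln |e|^2 the difference of squares x (2 L - x) is at most 4 L |e|,
  leaving |e|^-3. The constant 6 is this 4 plus 2 from the tail, where L <= 2 sqrt Y.\<close>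

lemma zeta_log_sum:
  assumes Y: "Y \<ge> 1"
  shows "\<bar>(\<Sum>e\<in>ZI_ball Y. 1 / cmod e ^ 4 * (ln (Y / (cmod e)\<^sup>2))\<^sup>2) - zeta_sum * (ln Y)\<^sup>2\<bar> \<le> 6 * cube_const * ln Y"
proof -
  let ?L = "ln Y"
  have L: "?L \<ge> 0" using Y by simp
  have l: "0 \<le> ?L\<^sup>2 - (ln (Y / (cmod e)\<^sup>2))\<^sup>2 \<and> ?L\<^sup>2 - (ln (Y / (cmod e)\<^sup>2))\<^sup>2 \<le> 4 * ?L * cmod e" if e: "e \<in> ZI_ball Y" for e
  proof -
    have e1: "(cmod e)\<^sup>2 \<ge> 1" "(cmod e)\<^sup>2 \<le> Y" using e by (auto simp: ZI_ball_iff ZI_ball_ge_1)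
    then have c1: "cmod e > 0" by (metis less_le_not_le norm_ge_zero not_one_le_zero zero_eq_power2 order_le_less)
    define x where "x = ln ((cmod e)\<^sup>2)"
    have "0 < (cmod e)\<^sup>2" using e1 by linarith
    then have x: "0 \<le> x" "x \<le> ?L" unfolding x_def using e1 by (simp_all only: ln_mono ln_ge_zero)
    have "x = 2 * ln (cmod e)" unfolding x_def using c1 by (simp add: ln_realpow)
    then have x2: "x \<le> 2 * cmod e" using ln_le_minus_one[OF c1] by linarith
    have lx: "ln (Y / (cmod e)\<^sup>2) = ?L - x" unfolding x_def using e1 Y by (subst ln_div) auto
    have *: "?L\<^sup>2 - (?L - x)\<^sup>2 = x * (2 * ?L - x)" by (simp add: power2_eq_square algebra_simps)
    have "x * (2 * ?L - x) \<le> (2 * cmod e) * (2 * ?L)" using x x2 L by (intro mult_mono) auto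
    moreover have "0 \<le> x * (2 * ?L - x)" using x by simp
    ultimately show ?thesis unfolding lx * by (simp add: mult_ac)
  qed
  let ?A = "\<Sum>e\<in>ZI_ball Y. 1 / cmod e ^ 4" and ?B = "\<Sum>e\<in>ZI_ball Y. 1 / cmod e ^ 4 * (ln (Y / (cmod e)\<^sup>2))\<^sup>2"
  have "?A * ?L\<^sup>2 - ?B = (\<Sum>e\<in>ZI_ball Y. 1 / cmod e ^ 4 * (?L\<^sup>2 - (ln (Y / (cmod e)\<^sup>2))\<^sup>2))"
    by (simp add: sum_distrib_right right_diff_distrib sum_subtractf)
  moreover have "(\<Sum>e\<in>ZI_ball Y. 1 / cmod e ^ 4 * (?L\<^sup>2 - (ln (Y / (cmod e)\<^sup>2))\<^sup>2)) \<le> (\<Sum>e\<in>ZI_ball Y. 4 * ?L * (1 / cmod e ^ 3))"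
  proof (rule sum_mono)
    fix e assume e: "e \<in> ZI_ball Y"
    then have "1 / cmod e ^ 4 * (?L\<^sup>2 - (ln (Y / (cmod e)\<^sup>2))\<^sup>2) \<le> 1 / cmod e ^ 4 * (4 * ?L * cmod e)"
      using l[OF e] by (intro mult_left_mono) auto
    also have "\<dots> = 4 * ?L * (1 / cmod e ^ 3)"
      using e by (simp add: ZI_ball_iff power4_eq_xxxx power3_eq_cube)
    finally show "1 / cmod e ^ 4 * (?L\<^sup>2 - (ln (Y / (cmod e)\<^sup>2))\<^sup>2) \<le> 4 * ?L * (1 / cmod e ^ 3)" .
  qed
  moreover have "(\<Sum>e\<in>ZI_ball Y. 4 * ?L * (1 / cmod e ^ 3)) \<le> 4 * ?L * cube_const"
    unfolding sum_distrib_left[symmetric] using sum_inverse_norm_cubed[OF Y] L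
    by (intro mult_left_mono) (auto simp: cube_const_def)
  moreover have "0 \<le> (\<Sum>e\<in>ZI_ball Y. 1 / cmod e ^ 4 * (?L\<^sup>2 - (ln (Y / (cmod e)\<^sup>2))\<^sup>2))"
    using l by (intro sum_nonneg mult_nonneg_nonneg) auto
  moreover have "?A * ?L\<^sup>2 \<le> zeta_sum * ?L\<^sup>2" by (intro mult_right_mono zeta_partial_le) auto
  moreover have "zeta_sum * ?L\<^sup>2 \<le> ?A * ?L\<^sup>2 + 2 * cube_const * ?L"
  proof -
    have "?L = 2 * ln (sqrt Y)" using Y by (simp add: ln_sqrt)
    also have "\<dots> \<le> 2 * sqrt Y" using ln_le_minus_one[of "sqrt Y"] Y by simp
    finally have "?L / sqrt Y \<le> 2" using Y by (simp add: pos_divide_le_eq)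
    then have "(cube_const * ?L) * (?L / sqrt Y) \<le> (cube_const * ?L) * 2" using L cube_const_pos by (intro mult_left_mono) auto
    moreover have "zeta_sum * ?L\<^sup>2 \<le> (?A + cube_const / sqrt Y) * ?L\<^sup>2" by (intro mult_right_mono zeta_tail Y) auto
    ultimately show ?thesis by (simp add: algebra_simps power2_eq_square)
  qed
  ultimately show ?thesis using L cube_const_pos by (simp add: abs_le_iff mult_ac)
qed

text \<open>Chosen so that kappa times \<open>zeta_sum\<close> equals 4 * (pi / 2): then the terms
  of order (ln Y)^2 cancel in \<open>phi_log_error_convolution\<close>.\<close>

definition kappa :: real where "kappa = 2 * pi / zeta_sum"

definition conv_const :: real where "conv_const = 4 * (pi + 4 * count_const 1) + kappa * (6 * cube_const)"

lemma kappa_pos: "kappa > 0" using zeta_sum_bounds by (simp add: kappa_def)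

lemma conv_const_nonneg: "conv_const \<ge> 0" using kappa_pos cube_const_pos count_const_ge(2)[of 1] by (simp add: conv_const_def)

definition phi_log_error :: "real \<Rightarrow> real" where "phi_log_error Y = phi_log_sum Y - kappa * (ln Y)\<^sup>2"

lemma phi_log_error_convolution:
  assumes Y: "Y \<ge> 1"
  shows "\<bar>\<Sum>e\<in>ZI_ball Y. 1 / cmod e ^ 4 * phi_log_error (Y / (cmod e)\<^sup>2)\<bar> \<le> conv_const * (ln Y + 1)"
proof -
  let ?L = "ln Y"
  let ?S = "\<Sum>n\<in>ZI_ball Y. ln (Y / (cmod n)\<^sup>2) / (cmod n)\<^sup>2"
  let ?B = "\<Sum>e\<in>ZI_ball Y. 1 / cmod e ^ 4 * (ln (Y / (cmod e)\<^sup>2))\<^sup>2"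
  have "(\<Sum>e\<in>ZI_ball Y. 1 / cmod e ^ 4 * phi_log_error (Y / (cmod e)\<^sup>2)) = 4 * ?S - kappa * ?B"
    unfolding phi_log_sum_convolution[symmetric] by (simp add: phi_log_error_def right_diff_distrib sum_subtractf sum_distrib_left mult_ac)
  also have "\<dots> = 4 * (?S - pi / 2 * ?L\<^sup>2) - kappa * (?B - zeta_sum * ?L\<^sup>2)"
  proof -
    have kz: "kappa * zeta_sum = 2 * pi" using zeta_sum_bounds by (simp add: kappa_def)
    have "kappa * (?B - zeta_sum * ?L\<^sup>2) = kappa * ?B - kappa * zeta_sum * ?L\<^sup>2"
      by (simp only: right_diff_distrib mult.assoc)
    then show ?thesis unfolding kz by simp
  qed
  finally have "\<bar>\<Sum>e\<in>ZI_ball Y. 1 / cmod e ^ 4 * phi_log_error (Y / (cmod e)\<^sup>2)\<bar> =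
      \<bar>4 * (?S - pi / 2 * ?L\<^sup>2) - kappa * (?B - zeta_sum * ?L\<^sup>2)\<bar>" by (rule arg_cong)
  also have "\<dots> \<le> 4 * \<bar>?S - pi / 2 * ?L\<^sup>2\<bar> + kappa * \<bar>?B - zeta_sum * ?L\<^sup>2\<bar>"
  proof -
    have "\<bar>4 * a - kappa * b\<bar> \<le> 4 * \<bar>a\<bar> + kappa * \<bar>b\<bar>" for a b :: real
      using abs_triangle_ineq4[of "4 * a" "kappa * b"] kappa_pos by (simp add: abs_mult)
    then show ?thesis .
  qed
  also have "\<dots> \<le> 4 * ((pi + 4 * count_const 1) * (?L + 1)) + kappa * (6 * cube_const * (?L + 1))"
  proof (rule add_mono)
    show "4 * \<bar>?S - pi / 2 * ?L\<^sup>2\<bar> \<le> 4 * ((pi + 4 * count_const 1) * (?L + 1))"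
      by (rule mult_left_mono[OF sum_log_inverse_norm_sq[OF Y]]) simp
    have "6 * cube_const * ?L \<le> 6 * cube_const * (?L + 1)" using cube_const_pos by simp
    then have "\<bar>?B - zeta_sum * ?L\<^sup>2\<bar> \<le> 6 * cube_const * (?L + 1)" using zeta_log_sum[OF Y] by linarith
    then show "kappa * \<bar>?B - zeta_sum * ?L\<^sup>2\<bar> \<le> kappa * (6 * cube_const * (?L + 1))"
      using kappa_pos by (intro mult_left_mono) simp_all
  qed
  also have "\<dots> = conv_const * (?L + 1)" by (simp add: conv_const_def algebra_simps)
  finally show ?thesis .
qed

text \<open>The solution M of 4 M = \<open>conv_const\<close> + (\<open>zeta_sum\<close> - 4) M, so
  that the induction step below reproduces its own bound.\<close>

definition phi_log_const :: real where "phi_log_const = conv_const / (8 - zeta_sum)"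

text \<open>
  The bound \<open>zeta_sum < 8\<close> replaces Moebius inversion: the four units contribute
  \<open>4 * phi_log_error Y\<close> to the convolution, the other terms involve \<open>phi_log_error\<close> at arguments at most \<open>Y / 2\<close> with total
  weight \<open>zeta_sum - 4 < 4\<close>.
\<close>

lemma phi_log_error_bound_aux: "1 \<le> Y \<Longrightarrow> Y < 2 ^ n \<Longrightarrow> \<bar>phi_log_error Y\<bar> \<le> phi_log_const * (ln Y + 1)"
proof (induction n arbitrary: Y)
  case 0
  then show ?case by simp
next
  case (Suc n)
  have M0: "phi_log_const \<ge> 0" using conv_const_nonneg zeta_sum_bounds by (simp add: phi_log_const_def)
  let ?R = "ZI_ball Y - gunits"
  have U: "gunits \<subseteq> ZI_ball Y" using Suc.prems by (auto simp: ZI_ball_iff gunits_norm) (auto simp: gunits_def)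
  have split: "(\<Sum>e\<in>ZI_ball Y. h e) = (\<Sum>e\<in>?R. h e) + (\<Sum>e\<in>gunits. h e)" for h :: "complex \<Rightarrow> real"
    by (rule sum.subset_diff[OF U]) simp
  have "(\<Sum>e\<in>gunits. 1 / cmod e ^ 4 * phi_log_error (Y / (cmod e)\<^sup>2)) = 4 * phi_log_error Y"
    by (simp add: gunits_norm card_gunits)
  then have "4 * phi_log_error Y = (\<Sum>e\<in>ZI_ball Y. 1 / cmod e ^ 4 * phi_log_error (Y / (cmod e)\<^sup>2)) - (\<Sum>e\<in>?R. 1 / cmod e ^ 4 * phi_log_error (Y / (cmod e)\<^sup>2))"
    using split[of "\<lambda>e. 1 / cmod e ^ 4 * phi_log_error (Y / (cmod e)\<^sup>2)"] by simp
  moreover have "\<bar>\<Sum>e\<in>?R. 1 / cmod e ^ 4 * phi_log_error (Y / (cmod e)\<^sup>2)\<bar> \<le> (\<Sum>e\<in>?R. 1 / cmod e ^ 4 * (phi_log_const * (ln Y + 1)))"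
  proof (rule order_trans[OF sum_abs], rule sum_mono)
    fix e assume e: "e \<in> ?R"
    then have eI: "e \<in> ZI" "e \<noteq> 0" "(cmod e)\<^sup>2 \<le> Y" and nu: "e \<notin> gunits" by (auto simp: ZI_ball_iff)
    obtain m :: nat where m: "(cmod e)\<^sup>2 = real m" using eI(1) by (rule ZI_norm_nat)
    have "(cmod e)\<^sup>2 > 0" using eI(2) by simp
    then have "m \<noteq> 0" using m by simp
    moreover have "m \<noteq> 1"
    proof
      assume "m = 1"
      then have "cmod e = 1" using m by (simp add: power2_eq_1_iff) (use norm_ge_zero[of e] in linarith)
      then show False using ZI_unit eI nu by blast
    qed
    ultimately have "m \<ge> 2" by linarith
    \<comment> \<open>A nonunit at least halves the argument, which drives the dyadic induction on
      \<open>n\<close>.\<close>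
    then have m2: "(cmod e)\<^sup>2 \<ge> 2" using m by simp
    have Y1: "1 \<le> Y / (cmod e)\<^sup>2" using eI m2 by (simp add: pos_le_divide_eq)
    have Y2: "Y / (cmod e)\<^sup>2 \<le> Y / 2" using m2 Suc.prems by (intro divide_left_mono) auto
    moreover have "Y / 2 < 2 ^ n" using Suc.prems by simp
    ultimately have "Y / (cmod e)\<^sup>2 < 2 ^ n" by linarith
    then have "\<bar>phi_log_error (Y / (cmod e)\<^sup>2)\<bar> \<le> phi_log_const * (ln (Y / (cmod e)\<^sup>2) + 1)" by (rule Suc.IH[OF Y1])
    also have "\<dots> \<le> phi_log_const * (ln Y + 1)"
    proof (intro mult_left_mono add_right_mono M0)
      have "Y / (cmod e)\<^sup>2 \<le> Y" using Y2 Suc.prems by linarith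
      then show "ln (Y / (cmod e)\<^sup>2) \<le> ln Y" using Y1 by simp
    qed
    finally have "1 / cmod e ^ 4 * \<bar>phi_log_error (Y / (cmod e)\<^sup>2)\<bar> \<le> 1 / cmod e ^ 4 * (phi_log_const * (ln Y + 1))"
      by (intro mult_left_mono) auto
    then show "\<bar>1 / cmod e ^ 4 * phi_log_error (Y / (cmod e)\<^sup>2)\<bar> \<le> 1 / cmod e ^ 4 * (phi_log_const * (ln Y + 1))"
      by (simp add: abs_mult)
  qed
  moreover have "(\<Sum>e\<in>?R. 1 / cmod e ^ 4 * (phi_log_const * (ln Y + 1))) \<le> (zeta_sum - 4) * (phi_log_const * (ln Y + 1))"
  proof -
    have "(\<Sum>e\<in>gunits. 1 / cmod e ^ 4) = 4" by (simp add: gunits_norm card_gunits)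
    then have "(\<Sum>e\<in>?R. 1 / cmod e ^ 4) \<le> zeta_sum - 4"
      using split[of "\<lambda>e. 1 / cmod e ^ 4"] zeta_partial_le[of Y] by simp
    then show ?thesis unfolding sum_distrib_right[symmetric]
      using M0 Suc.prems by (intro mult_right_mono) auto
  qed
  moreover have "\<bar>\<Sum>e\<in>ZI_ball Y. 1 / cmod e ^ 4 * phi_log_error (Y / (cmod e)\<^sup>2)\<bar> \<le> conv_const * (ln Y + 1)"
    by (rule phi_log_error_convolution) (use Suc.prems in simp)
  moreover have K1eq: "conv_const = phi_log_const * (8 - zeta_sum)" using zeta_sum_bounds by (simp add: phi_log_const_def)
  have "conv_const * (ln Y + 1) + (zeta_sum - 4) * (phi_log_const * (ln Y + 1)) = 4 * (phi_log_const * (ln Y + 1))"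
    unfolding K1eq by (simp add: algebra_simps)
  ultimately show ?case by linarith
qed

lemma phi_log_sum_bound:
  assumes "Y \<ge> 1"
  shows "\<bar>phi_log_sum Y - kappa * (ln Y)\<^sup>2\<bar> \<le> phi_log_const * (ln Y + 1)"
proof -
  obtain n :: nat where "Y < 2 ^ n" using real_arch_pow[of 2 Y] by auto
  then show ?thesis using phi_log_error_bound_aux[OF assms] by (simp add: phi_log_error_def)
qed

section \<open>Counting tuples\<close>

definition pair_points :: "complex \<Rightarrow> complex \<Rightarrow> real \<Rightarrow> real \<Rightarrow> (complex \<times> complex) set" where
  "pair_points \<theta> \<theta>' C Z = {(z, z'). z - \<theta> \<in> ZI \<and> z' - \<theta>' \<in> ZI \<and> C \<le> (cmod z)\<^sup>2 \<and> C \<le> (cmod z')\<^sup>2 \<and> (cmod z)\<^sup>2 * (cmod z')\<^sup>2 \<le> Z}"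

lemma pair_points_Sigma:
  assumes C: "C \<ge> 1"
  shows "pair_points \<theta> \<theta>' C Z = (SIGMA z:shifted_points \<theta> C (Z / C). shifted_points \<theta>' C (Z / (cmod z)\<^sup>2))"
proof (intro equalityI subsetI)
  fix p assume "p \<in> pair_points \<theta> \<theta>' C Z"
  then obtain z z' where p: "p = (z, z')" and *: "z - \<theta> \<in> ZI" "z' - \<theta>' \<in> ZI" "C \<le> (cmod z)\<^sup>2" "C \<le> (cmod z')\<^sup>2"
    "(cmod z)\<^sup>2 * (cmod z')\<^sup>2 \<le> Z" by (auto simp: pair_points_def)
  have "(cmod z)\<^sup>2 * C \<le> (cmod z)\<^sup>2 * (cmod z')\<^sup>2" using * by (intro mult_left_mono) auto
  then have "(cmod z)\<^sup>2 \<le> Z / C" using * C by (subst pos_le_divide_eq) linarith+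
  moreover have "(cmod z')\<^sup>2 \<le> Z / (cmod z)\<^sup>2" using * C by (subst pos_le_divide_eq) (auto simp: mult_ac)
  ultimately show "p \<in> (SIGMA z:shifted_points \<theta> C (Z / C). shifted_points \<theta>' C (Z / (cmod z)\<^sup>2))"
    using * by (simp add: p shifted_points_def)
next
  fix p assume "p \<in> (SIGMA z:shifted_points \<theta> C (Z / C). shifted_points \<theta>' C (Z / (cmod z)\<^sup>2))"
  then obtain z z' where p: "p = (z, z')" and *: "z - \<theta> \<in> ZI" "z' - \<theta>' \<in> ZI" "C \<le> (cmod z)\<^sup>2" "C \<le> (cmod z')\<^sup>2"
    "(cmod z')\<^sup>2 \<le> Z / (cmod z)\<^sup>2" by (auto simp: shifted_points_def)
  have "0 < (cmod z)\<^sup>2" using * C by linarith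
  then have "(cmod z)\<^sup>2 * (cmod z')\<^sup>2 \<le> Z" using *(5) by (subst (asm) pos_le_divide_eq) (auto simp: mult_ac)
  then show "p \<in> pair_points \<theta> \<theta>' C Z" using * by (simp add: p pair_points_def)
qed

lemma finite_pair_points: "C \<ge> 1 \<Longrightarrow> finite (pair_points \<theta> \<theta>' C Z)"
  by (simp add: pair_points_Sigma)

text \<open>In order: the cutoff \<open>C\<close> inside the logarithm, the error of the sum of 1 /
  |z|^2, and the circle errors summed over z.\<close>

definition pair_const :: "real \<Rightarrow> real" where
  "pair_const C = 2 * pi\<^sup>2 * ln C + pi * (pi + 3 * count_const C) + count_const C * (2 * pi + 2 * count_const C)"

lemma pair_const_nonneg: "C \<ge> 1 \<Longrightarrow> pair_const C \<ge> 0"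
  using count_const_ge(2)[of C] by (simp add: pair_const_def)

text \<open>For each z the second point lies in a disc of area pi Z / |z|^2; summing over z gives
  pi^2 Z ln (Z / C^2). So \<open>C\<close> and the shifts affect only the O(Z) error, which lets
  counts with different \<open>C\<close> share one main term.\<close>

lemma card_pair_points:
  assumes C: "C \<ge> 1" and Z: "Z \<ge> 1"
  shows "\<bar>real (card (pair_points \<theta> \<theta>' C Z)) - pi\<^sup>2 * Z * ln Z\<bar> \<le> pair_const C * Z"
proof (cases "C * C \<le> Z")
  case False
  \<comment> \<open>For Z < C^2 there are no points, and ln Z <= 2 ln C puts the main term itself
    within the error.\<close>
  have e: "pair_points \<theta> \<theta>' C Z = {}"
  proof (rule ccontr)
    assume "pair_points \<theta> \<theta>' C Z \<noteq> {}"
    then obtain z z' :: complex where *: "C \<le> (cmod z)\<^sup>2" "C \<le> (cmod z')\<^sup>2" "(cmod z)\<^sup>2 * (cmod z')\<^sup>2 \<le> Z"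
      by (auto simp: pair_points_def)
    have "C * C \<le> (cmod z)\<^sup>2 * (cmod z')\<^sup>2" using * C by (intro mult_mono) auto
    with * False show False by linarith
  qed
  have "real (card (pair_points \<theta> \<theta>' C Z)) = 0" by (simp add: e)
  moreover have "ln Z \<le> ln (C * C)" using False Z by (intro ln_mono) auto
  then have "pi\<^sup>2 * Z * ln Z \<le> pi\<^sup>2 * Z * (2 * ln C)" using C Z by (intro mult_left_mono) (auto simp: ln_mult)
  moreover have "0 \<le> pi\<^sup>2 * Z * ln Z" using Z by simp
  moreover have "pi\<^sup>2 * Z * (2 * ln C) \<le> pair_const C * Z"
  proof -
    have "2 * pi\<^sup>2 * ln C \<le> pair_const C" using count_const_ge(2)[OF C] by (simp add: pair_const_def)
    then have "2 * pi\<^sup>2 * ln C * Z \<le> pair_const C * Z" using Z by (intro mult_right_mono) auto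
    then show ?thesis by (simp add: mult_ac)
  qed
  ultimately show ?thesis by linarith
next
  case True
  let ?A = "shifted_points \<theta> C (Z / C)"
  have ZC: "C \<le> Z / C" using True C by (simp add: pos_le_divide_eq)
  have K0: "count_const C \<ge> 0" using count_const_ge(2)[OF C] .
  have z: "\<bar>real (card (shifted_points \<theta>' C (Z / (cmod z)\<^sup>2))) - pi * Z * (1 / (cmod z)\<^sup>2)\<bar> \<le> count_const C * sqrt Z * (1 / cmod z)"
    if z: "z \<in> ?A" for z
  proof -
    have z1: "C \<le> (cmod z)\<^sup>2" "(cmod z)\<^sup>2 \<le> Z / C" using z by (auto simp: shifted_points_def)
    then have z0: "(cmod z)\<^sup>2 > 0" using C by linarith
    have "(cmod z)\<^sup>2 * C \<le> Z" using z1 C by (simp add: pos_le_divide_eq)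
    then have "C \<le> Z / (cmod z)\<^sup>2" using z0 by (subst pos_le_divide_eq) (auto simp: mult_ac)
    from card_shifted_points[OF C this, of \<theta>'] show ?thesis
      by (simp add: real_sqrt_divide)
  qed
  have "real (card (pair_points \<theta> \<theta>' C Z)) = (\<Sum>z\<in>?A. real (card (shifted_points \<theta>' C (Z / (cmod z)\<^sup>2))))"
    by (simp add: pair_points_Sigma[OF C])
  then have "real (card (pair_points \<theta> \<theta>' C Z)) - pi * Z * (\<Sum>z\<in>?A. 1 / (cmod z)\<^sup>2) =
     (\<Sum>z\<in>?A. real (card (shifted_points \<theta>' C (Z / (cmod z)\<^sup>2))) - pi * Z * (1 / (cmod z)\<^sup>2))"
    by (simp only: sum_subtractf sum_distrib_left)
  then have "\<bar>real (card (pair_points \<theta> \<theta>' C Z)) - pi * Z * (\<Sum>z\<in>?A. 1 / (cmod z)\<^sup>2)\<bar> =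
     \<bar>\<Sum>z\<in>?A. real (card (shifted_points \<theta>' C (Z / (cmod z)\<^sup>2))) - pi * Z * (1 / (cmod z)\<^sup>2)\<bar>"
    by (rule arg_cong)
  also have "\<dots> \<le> (\<Sum>z\<in>?A. count_const C * sqrt Z * (1 / cmod z))"
    by (rule order_trans[OF sum_abs], rule sum_mono, rule z)
  also have "\<dots> = count_const C * sqrt Z * (\<Sum>z\<in>?A. 1 / cmod z)" by (simp only: sum_distrib_left)
  also have "\<dots> \<le> count_const C * sqrt Z * ((2 * pi + 2 * count_const C) * sqrt (Z / C))"
    using K0 Z by (intro mult_left_mono sum_inverse_norm[OF C ZC]) auto
  also have "\<dots> \<le> count_const C * sqrt Z * ((2 * pi + 2 * count_const C) * sqrt Z)"
  proof -
    have "Z / C \<le> Z / 1" using C Z by (intro divide_left_mono) auto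
    then show ?thesis using K0 Z by (intro mult_left_mono) auto
  qed
  also have "\<dots> = count_const C * (2 * pi + 2 * count_const C) * Z" using Z by simp
  finally have 1: "\<bar>real (card (pair_points \<theta> \<theta>' C Z)) - pi * Z * (\<Sum>z\<in>?A. 1 / (cmod z)\<^sup>2)\<bar> \<le> count_const C * (2 * pi + 2 * count_const C) * Z" .
  have "\<bar>pi * Z * (\<Sum>z\<in>?A. 1 / (cmod z)\<^sup>2) - pi * Z * (pi * ln (Z / C / C))\<bar> =
      pi * Z * \<bar>(\<Sum>z\<in>?A. 1 / (cmod z)\<^sup>2) - pi * ln (Z / C / C)\<bar>"
    using Z by (simp only: right_diff_distrib[symmetric] abs_mult) simp
  also have "\<dots> \<le> pi * Z * (pi + 3 * count_const C)"
    using Z by (intro mult_left_mono sum_inverse_norm_sq[OF C ZC]) auto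
  finally have 2: "\<bar>pi * Z * (\<Sum>z\<in>?A. 1 / (cmod z)\<^sup>2) - pi * Z * (pi * ln (Z / C / C))\<bar> \<le> pi * Z * (pi + 3 * count_const C)" .
  have l: "ln (Z / C / C) = ln Z - 2 * ln C" using C Z by (simp add: ln_div ln_mult)
  have 3: "pi * Z * (pi * ln (Z / C / C)) = pi\<^sup>2 * Z * ln Z - 2 * pi\<^sup>2 * ln C * Z"
    unfolding l by (simp add: power2_eq_square algebra_simps)
  have 4: "0 \<le> 2 * pi\<^sup>2 * ln C * Z" using C Z by simp
  show ?thesis using 1 2 4 unfolding 3 pair_const_def by (simp add: algebra_simps)
qed

text \<open>
  \<open>(s, u, B, Q)\<close> encodes a pair of involutions up to conjugation, see \<open>tup_x\<close> and \<open>tup_y\<close> below; with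
  \<open>W = 2 * \<i> * u + B * s\<close> the trace of their product is \<open>Q * W + 2\<close>.
\<close>

definition tuples :: "real \<Rightarrow> real \<Rightarrow> (complex \<times> complex \<times> complex \<times> complex) set" where
  "tuples C X = {(s, u, B, Q). s \<in> ZI \<and> s \<noteq> 0 \<and> u \<in> coprime_residues s \<and> B \<in> ZI \<and> Q \<in> ZI \<and> gdvd s (2 * \<i> - Q * u) \<and>
     C * (cmod s)\<^sup>2 \<le> (cmod (2 * \<i> * u + B * s))\<^sup>2 \<and> C * (cmod s)\<^sup>2 \<le> (cmod Q)\<^sup>2 \<and>
     (cmod (Q * (2 * \<i> * u + B * s)))\<^sup>2 \<le> X}"

text \<open>An inverse of \<open>u\<close> modulo \<open>s\<close>; only its class modulo
  \<open>s\<close> matters.\<close>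

definition uinv :: "complex \<Rightarrow> complex \<Rightarrow> complex" where
  "uinv s u = (SOME x. x \<in> ZI \<and> (\<exists>y\<in>ZI. x * u + y * s = 1))"

lemma uinv:
  assumes "gcop u s"
  shows "uinv s u \<in> ZI" "\<exists>y\<in>ZI. uinv s u * u + y * s = 1"
proof -
  have "\<exists>x. x \<in> ZI \<and> (\<exists>y\<in>ZI. x * u + y * s = 1)" using assms by (auto simp: gcop_def)
  from someI_ex[OF this] show "uinv s u \<in> ZI" "\<exists>y\<in>ZI. uinv s u * u + y * s = 1"
    unfolding uinv_def by auto
qed

text \<open>Solving the congruence Q u = 2 i modulo \<open>s\<close> for \<open>Q\<close> places Q /
  s in a single coset of Z[i].\<close>

lemma gdvd_uinv_iff:
  assumes u: "gcop u s" "u \<in> ZI" and s: "s \<in> ZI" "s \<noteq> 0" and Q: "Q \<in> ZI"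
  shows "gdvd s (2 * \<i> - Q * u) \<longleftrightarrow> Q / s - 2 * \<i> * uinv s u / s \<in> ZI"
proof -
  define x where "x = uinv s u"
  obtain y where y: "y \<in> ZI" "x * u + y * s = 1" using uinv(2)[OF u(1)] by (auto simp: x_def)
  have x: "x \<in> ZI" unfolding x_def by (rule uinv(1)[OF u(1)])
  show ?thesis unfolding x_def[symmetric]
  proof
    assume "gdvd s (2 * \<i> - Q * u)"
    then obtain k where k: "k \<in> ZI" "2 * \<i> - Q * u = s * k" by (auto simp: gdvd_def)
    have "Q - 2 * \<i> * x = Q * (x * u + y * s) - 2 * \<i> * x" using y by simp
    also have "\<dots> = - x * (2 * \<i> - Q * u) + Q * y * s" by (simp add: algebra_simps)
    also have "\<dots> = s * (Q * y - x * k)" unfolding k(2) by (simp add: algebra_simps)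
    finally have "Q / s - 2 * \<i> * x / s = Q * y - x * k" using s by (simp add: field_simps)
    then show "Q / s - 2 * \<i> * x / s \<in> ZI" using Q y x k ZI_closed by metis
  next
    assume k: "Q / s - 2 * \<i> * x / s \<in> ZI"
    define k where "k = Q / s - 2 * \<i> * x / s"
    have Qk: "Q = 2 * \<i> * x + s * k" using s by (simp add: k_def field_simps)
    have "2 * \<i> - Q * u = 2 * \<i> * (x * u + y * s) - Q * u" using y by simp
    also have "\<dots> = s * (2 * \<i> * y - k * u)" unfolding Qk by (simp add: algebra_simps)
    finally have e: "2 * \<i> - Q * u = s * (2 * \<i> * y - k * u)" .
    have "2 * \<i> * y - k * u \<in> ZI" using y k u unfolding k_def[symmetric] by (intro ZI_closed) auto
    with e show "gdvd s (2 * \<i> - Q * u)" unfolding gdvd_def by blast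
  qed
qed

text \<open>For fixed \<open>s\<close> and \<open>u\<close>, dividing W and \<open>Q\<close> by
  \<open>s\<close> gives points of two shifted lattices whose norms multiply to at most X /
  |s|^4.\<close>

lemma card_tuples_eq:
  assumes C: "C \<ge> 1"
  shows "card (tuples C X) = (\<Sum>s\<in>ZI_ball (sqrt X). \<Sum>u\<in>coprime_residues s. card (pair_points (2 * \<i> * u / s) (2 * \<i> * uinv s u / s) C (X / cmod s ^ 4)))"
    and finite_tuples: "finite (tuples C X)"
proof -
  let ?P = "\<lambda>s u. pair_points (2 * \<i> * u / s) (2 * \<i> * uinv s u / s) C (X / cmod s ^ 4)"
  let ?S = "SIGMA s:ZI_ball (sqrt X). SIGMA u:coprime_residues s. ?P s u"
  have key: "(s, u, B, Q) \<in> tuples C X \<longleftrightarrow> s \<in> ZI_ball (sqrt X) \<and> u \<in> coprime_residues s \<and> (B + 2 * \<i> * u / s, Q / s) \<in> ?P s u"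
    for s u B Q
  proof (cases "s \<in> ZI \<and> s \<noteq> 0 \<and> u \<in> coprime_residues s")
    case False
    then show ?thesis by (auto simp: tuples_def ZI_ball_iff)
  next
    case True
    then have s: "s \<in> ZI" "s \<noteq> 0" and u: "u \<in> coprime_residues s" by auto
    then have u': "gcop u s" "u \<in> ZI" by (auto simp: coprime_residues_def residues_def)
    define W where "W = 2 * \<i> * u + B * s"
    have Ws: "B + 2 * \<i> * u / s = W / s" using s by (simp add: W_def field_simps)
    have QI: "Q \<in> ZI" if "Q / s - 2 * \<i> * uinv s u / s \<in> ZI"
    proof -
      have "(Q / s - 2 * \<i> * uinv s u / s) * s + 2 * \<i> * uinv s u \<in> ZI"
        using uinv(1)[OF u'(1)] that s by (intro ZI_closed(1,3)) auto
      then show ?thesis using s by (simp add: field_simps)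
    qed
    have n0: "(cmod s)\<^sup>2 > 0" using s by simp
    have n1: "C \<le> (cmod (w / s))\<^sup>2 \<longleftrightarrow> C * (cmod s)\<^sup>2 \<le> (cmod w)\<^sup>2" for w
      using n0 by (simp add: norm_divide power_divide pos_le_divide_eq)
    have n2: "(cmod (W / s))\<^sup>2 * (cmod (Q / s))\<^sup>2 \<le> X / cmod s ^ 4 \<longleftrightarrow> (cmod (Q * W))\<^sup>2 \<le> X"
      using s by (simp add: norm_divide norm_mult power_divide power_mult_distrib power4_eq_xxxx power2_eq_square field_simps)
    \<comment> \<open>Both |W| and |Q| are at least |s|, so |s|^4 <= X; this makes the range of
      \<open>s\<close> finite.\<close>
    have n3: "(cmod s)\<^sup>2 \<le> sqrt X" if "C * (cmod s)\<^sup>2 \<le> (cmod W)\<^sup>2" "C * (cmod s)\<^sup>2 \<le> (cmod Q)\<^sup>2" "(cmod (Q * W))\<^sup>2 \<le> X"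
    proof -
      have "1 * (cmod s)\<^sup>2 \<le> C * (cmod s)\<^sup>2" using C by (intro mult_right_mono) auto
      then have "(cmod s)\<^sup>2 \<le> (cmod Q)\<^sup>2" "(cmod s)\<^sup>2 \<le> (cmod W)\<^sup>2" using that by linarith+
      then have "(cmod s)\<^sup>2 * (cmod s)\<^sup>2 \<le> (cmod Q)\<^sup>2 * (cmod W)\<^sup>2" by (rule mult_mono) simp_all
      also have "\<dots> \<le> X" using that(3) by (simp add: norm_mult power_mult_distrib)
      finally show ?thesis by (intro real_le_rsqrt) (simp add: power2_eq_square)
    qed
    show ?thesis
      unfolding Ws pair_points_def tuples_def using s u QI gdvd_uinv_iff[OF u' s] n1[of W] n1[of Q] n2 n3
      by (auto simp: W_def[symmetric] Ws[symmetric] ZI_ball_iff; simp add: Ws)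
  qed
  have "bij_betw (\<lambda>(s, u, B, Q). (s, u, B + 2 * \<i> * u / s, Q / s)) (tuples C X) ?S"
  proof (rule bij_betw_byWitness[where f' = "\<lambda>(s, u, z, z'). (s, u, z - 2 * \<i> * u / s, z' * s)"], goal_cases)
    case 1
    show ?case by (auto simp: tuples_def)
  next
    case 2
    show ?case by (auto simp: ZI_ball_iff)
  next
    case 3
    show ?case using key by auto
  next
    case 4
    show ?case using key by (auto simp: ZI_ball_iff)
  qed
  moreover have "finite ?S"
    using C by (auto intro!: finite_SigmaI finite_coprime_residues finite_pair_points simp: ZI_ball_iff)
  moreover have "card ?S = (\<Sum>s\<in>ZI_ball (sqrt X). \<Sum>u\<in>coprime_residues s. card (?P s u))"
  proof -
    have f: "finite (coprime_residues s)" "\<And>u. finite (?P s u)" if "s \<in> ZI_ball (sqrt X)" for s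
      using that C by (auto intro: finite_coprime_residues finite_pair_points simp: ZI_ball_iff)
    have "card ?S = (\<Sum>s\<in>ZI_ball (sqrt X). card (SIGMA u:coprime_residues s. ?P s u))"
      by (rule card_SigmaI) (use f in auto)
    also have "\<dots> = (\<Sum>s\<in>ZI_ball (sqrt X). \<Sum>u\<in>coprime_residues s. card (?P s u))"
      by (intro sum.cong refl card_SigmaI) (use f in auto)
    finally show ?thesis .
  qed
  ultimately show "card (tuples C X) = (\<Sum>s\<in>ZI_ball (sqrt X). \<Sum>u\<in>coprime_residues s. card (?P s u))" "finite (tuples C X)"
    by (auto simp: bij_betw_same_card bij_betw_finite)
qed

definition tuple_const :: "real \<Rightarrow> real" where
  "tuple_const C = pair_const C * (2 * pi + 3 * count_const 1) + 2 * pi\<^sup>2 * phi_log_const"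

text \<open>As ln (X / |s|^4) = 2 ln (sqrt X / |s|^2), the main term is 2 pi^2 X times
  \<open>phi_log_sum\<close> at sqrt X, and (ln sqrt X)^2 = (ln X)^2 / 4 gives the constant. The
  errors sum to a multiple of X times the sum of phi(s) / |s|^4, which is O(ln X + 1) by
  \<open>phi_le\<close>.\<close>

lemma card_tuples:
  assumes C: "C \<ge> 1" and X: "X \<ge> 1"
  shows "\<bar>real (card (tuples C X)) - pi\<^sup>2 * kappa / 2 * X * (ln X)\<^sup>2\<bar> \<le> tuple_const C * X * (ln X + 1)"
proof -
  let ?Y = "sqrt X"
  let ?P = "\<lambda>s u. pair_points (2 * \<i> * u / s) (2 * \<i> * uinv s u / s) C (X / cmod s ^ 4)"
  let ?m = "\<lambda>s. pi\<^sup>2 * (X / cmod s ^ 4) * ln (X / cmod s ^ 4)"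
  have Y: "?Y \<ge> 1" using X by simp
  have sX: "X / cmod s ^ 4 \<ge> 1" "ln (X / cmod s ^ 4) = 2 * ln (?Y / (cmod s)\<^sup>2)" if "s \<in> ZI_ball ?Y" for s
  proof -
    have s: "(cmod s)\<^sup>2 \<ge> 1" "(cmod s)\<^sup>2 \<le> ?Y" using that ZI_ball_ge_1 by (auto simp: ZI_ball_iff)
    have "?Y / (cmod s)\<^sup>2 \<ge> 1" using s by (subst le_divide_eq_1_pos) linarith+
    moreover have e: "X / cmod s ^ 4 = (?Y / (cmod s)\<^sup>2)\<^sup>2"
      using X by (simp add: power_divide power2_eq_square power4_eq_xxxx)
    ultimately show "X / cmod s ^ 4 \<ge> 1" by simp
    show "ln (X / cmod s ^ 4) = 2 * ln (?Y / (cmod s)\<^sup>2)" unfolding e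
      using \<open>?Y / (cmod s)\<^sup>2 \<ge> 1\<close> by (subst ln_realpow) auto
  qed
  have "real (card (tuples C X)) - (\<Sum>s\<in>ZI_ball ?Y. phi s * ?m s) = (\<Sum>s\<in>ZI_ball ?Y. \<Sum>u\<in>coprime_residues s. real (card (?P s u)) - ?m s)"
    by (simp add: card_tuples_eq[OF C] sum_subtractf phi_def)
  then have "\<bar>real (card (tuples C X)) - (\<Sum>s\<in>ZI_ball ?Y. phi s * ?m s)\<bar> = \<bar>\<Sum>s\<in>ZI_ball ?Y. \<Sum>u\<in>coprime_residues s. real (card (?P s u)) - ?m s\<bar>"
    by (rule arg_cong)
  also have "\<dots> \<le> (\<Sum>s\<in>ZI_ball ?Y. \<Sum>u\<in>coprime_residues s. pair_const C * (X / cmod s ^ 4))"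
    by (rule order_trans[OF sum_abs], rule sum_mono, rule order_trans[OF sum_abs], rule sum_mono)
       (intro card_pair_points C sX)
  also have "\<dots> = (\<Sum>s\<in>ZI_ball ?Y. pair_const C * X * (phi s / cmod s ^ 4))"
    by (simp add: phi_def mult_ac)
  also have "\<dots> \<le> (\<Sum>s\<in>ZI_ball ?Y. pair_const C * X * (1 / (cmod s)\<^sup>2))"
  proof (intro sum_mono mult_left_mono)
    fix s assume s: "s \<in> ZI_ball ?Y"
    then have "phi s / cmod s ^ 4 \<le> (cmod s)\<^sup>2 / cmod s ^ 4"
      by (intro divide_right_mono phi_le) (auto simp: ZI_ball_iff)
    also have "\<dots> = 1 / (cmod s)\<^sup>2" using s by (simp add: ZI_ball_iff power4_eq_xxxx power2_eq_square)
    finally show "phi s / cmod s ^ 4 \<le> 1 / (cmod s)\<^sup>2" .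
  qed (use C X pair_const_nonneg in auto)
  also have "\<dots> = pair_const C * X * (\<Sum>s\<in>ZI_ball ?Y. 1 / (cmod s)\<^sup>2)" by (simp only: sum_distrib_left)
  also have "\<dots> \<le> pair_const C * X * ((2 * pi + 3 * count_const 1) * (ln X + 1))"
  proof (intro mult_left_mono)
    have "(\<Sum>s\<in>ZI_ball ?Y. 1 / (cmod s)\<^sup>2) \<le> pi * ln ?Y + (pi + 3 * count_const 1)"
      using sum_inverse_norm_sq[of 1 ?Y 0] Y by simp
    also have "ln ?Y \<le> ln X" using X by (simp add: ln_sqrt)
    then have "pi * ln ?Y + (pi + 3 * count_const 1) \<le> (2 * pi + 3 * count_const 1) * (ln X + 1)"
    proof -
      have a: "pi * ln ?Y \<le> pi * ln X" by (rule mult_left_mono[OF \<open>ln ?Y \<le> ln X\<close>]) simp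
      have b: "0 \<le> (pi + 3 * count_const 1) * ln X" using X count_const_ge(2)[of 1] by simp
      have "(2 * pi + 3 * count_const 1) * (ln X + 1) = pi * ln X + (pi + 3 * count_const 1) * ln X + (pi + 3 * count_const 1) + pi"
        by (simp add: algebra_simps)
      then show ?thesis using a b pi_ge_zero by linarith
    qed
    finally show "(\<Sum>s\<in>ZI_ball ?Y. 1 / (cmod s)\<^sup>2) \<le> (2 * pi + 3 * count_const 1) * (ln X + 1)" .
  qed (use C X pair_const_nonneg in auto)
  finally have 1: "\<bar>real (card (tuples C X)) - (\<Sum>s\<in>ZI_ball ?Y. phi s * ?m s)\<bar> \<le> pair_const C * X * ((2 * pi + 3 * count_const 1) * (ln X + 1))" .
  have "(\<Sum>s\<in>ZI_ball ?Y. phi s * ?m s) = (\<Sum>s\<in>ZI_ball ?Y. 2 * pi\<^sup>2 * X * (phi s / cmod s ^ 4 * ln (?Y / (cmod s)\<^sup>2)))"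
    by (rule sum.cong) (simp_all add: sX(2) mult_ac)
  also have "\<dots> = 2 * pi\<^sup>2 * X * phi_log_sum ?Y" by (simp only: phi_log_sum_def sum_distrib_left)
  finally have 2: "(\<Sum>s\<in>ZI_ball ?Y. phi s * ?m s) = 2 * pi\<^sup>2 * X * phi_log_sum ?Y" .
  have "\<bar>2 * pi\<^sup>2 * X * phi_log_sum ?Y - 2 * pi\<^sup>2 * X * (kappa * (ln ?Y)\<^sup>2)\<bar> = 2 * pi\<^sup>2 * X * \<bar>phi_log_sum ?Y - kappa * (ln ?Y)\<^sup>2\<bar>"
    using X by (simp only: right_diff_distrib[symmetric] abs_mult) simp
  also have "\<dots> \<le> 2 * pi\<^sup>2 * X * (phi_log_const * (ln ?Y + 1))"
    using X Y by (intro mult_left_mono phi_log_sum_bound) auto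
  also have "\<dots> \<le> 2 * pi\<^sup>2 * X * (phi_log_const * (ln X + 1))"
    using X conv_const_nonneg zeta_sum_bounds by (intro mult_left_mono) (auto simp: ln_sqrt phi_log_const_def)
  finally have 3: "\<bar>2 * pi\<^sup>2 * X * phi_log_sum ?Y - 2 * pi\<^sup>2 * X * (kappa * (ln ?Y)\<^sup>2)\<bar> \<le> 2 * pi\<^sup>2 * X * (phi_log_const * (ln X + 1))" .
  have 4: "2 * pi\<^sup>2 * X * (kappa * (ln ?Y)\<^sup>2) = pi\<^sup>2 * kappa / 2 * X * (ln X)\<^sup>2"
    using X by (simp add: ln_sqrt power_divide)
  have 5: "tuple_const C * X * (ln X + 1) = pair_const C * X * ((2 * pi + 3 * count_const 1) * (ln X + 1)) + 2 * pi\<^sup>2 * X * (phi_log_const * (ln X + 1))"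
    by (simp add: tuple_const_def algebra_simps)
  show ?thesis using 1 3 unfolding 2 4 5 by linarith
qed

section \<open>Matrices and conjugacy classes\<close>

definition mk :: "complex \<Rightarrow> complex \<Rightarrow> complex \<Rightarrow> complex \<Rightarrow> complex^2^2" where
  "mk a b c d = (\<chi> i j. if i = 1 then (if j = 1 then a else b) else (if j = 1 then c else d))"

lemma mk_nth [simp]: "mk a b c d $ 1 $ 1 = a" "mk a b c d $ 1 $ 2 = b" "mk a b c d $ 2 $ 1 = c" "mk a b c d $ 2 $ 2 = d"
  by (auto simp: mk_def)

lemma mk_eq_iff [simp]: "mk a b c d = mk a' b' c' d' \<longleftrightarrow> a = a' \<and> b = b' \<and> c = c' \<and> d = d'"
  by (simp add: mat_eq_2_iff)

lemma mk_eta: "A = mk (A$1$1) (A$1$2) (A$2$1) (A$2$2)"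
  by (simp add: mat_eq_2_iff)

lemma mk_cases: obtains a b c d where "A = mk a b c d"
  using mk_eta by blast

lemma mk_mult [simp]: "mk a b c d ** mk a' b' c' d' = mk (a * a' + b * c') (a * b' + b * d') (c * a' + d * c') (c * b' + d * d')"
  by (simp add: mat_eq_2_iff matrix_mult_2)

lemma mk_uminus [simp]: "- mk a b c d = mk (- a) (- b) (- c) (- d)"
  by (simp add: mat_eq_2_iff)

lemma mat1_mk: "mat 1 = mk 1 0 0 1"
  by (simp add: mat_eq_2_iff mat_def)

lemma det_mk [simp]: "det (mk a b c d) = a * d - b * c"
  by (simp add: det_2)

lemma trace_mk [simp]: "trace (mk a b c d) = a + d"
  by (simp add: trace_def sum_2)

abbreviation Gam :: "(complex^2^2) set" where "Gam \<equiv> carrier (SL2 ZI)"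

lemma Gam_mk [simp]: "mk a b c d \<in> Gam \<longleftrightarrow> a \<in> ZI \<and> b \<in> ZI \<and> c \<in> ZI \<and> d \<in> ZI \<and> a * d - b * c = 1"
  by (auto simp: SL2_def forall_2)

lemma Gam_cases:
  assumes "A \<in> Gam"
  obtains a b c d where "A = mk a b c d" "a \<in> ZI" "b \<in> ZI" "c \<in> ZI" "d \<in> ZI" "a * d - b * c = 1"
  using assms mk_eta[of A] that by (metis Gam_mk)

text \<open>The adjugate agrees with the inverse for determinant 1 but is linear in the entries,
  which is what \<open>reverser_D\<close> exploits.\<close>

definition adj :: "complex^2^2 \<Rightarrow> complex^2^2" where
  "adj A = mk (A$2$2) (- (A$1$2)) (- (A$2$1)) (A$1$1)"

lemma adj_mk [simp]: "adj (mk a b c d) = mk d (- b) (- c) a"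
  by (simp add: adj_def)

lemma adj_adj [simp]: "adj (adj A) = A"
  by (cases A rule: mk_cases) simp

lemma adj_uminus [simp]: "adj (- A) = - adj A"
  by (cases A rule: mk_cases) simp

lemma adj_mult: "adj (A ** B) = adj B ** adj A"
  by (cases A rule: mk_cases; cases B rule: mk_cases) (simp add: mult_ac)

lemma Gam_adj [simp, intro]: "A \<in> Gam \<Longrightarrow> adj A \<in> Gam"
  by (erule Gam_cases) (simp add: mult_ac)

lemma Gam_mult [simp, intro]: "A \<in> Gam \<Longrightarrow> B \<in> Gam \<Longrightarrow> A ** B \<in> Gam"
  using monoid.m_closed[OF group.is_monoid[OF complex_subring.group_SL2[OF complex_subring_gaussian_ints]]]
  by (simp add: SL2_def)

lemma Gam_uminus [simp]: "- A \<in> Gam \<longleftrightarrow> A \<in> Gam"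
  by (cases A rule: mk_cases) simp

lemma Gam_one [simp, intro]: "mat 1 \<in> Gam"
  by (simp add: mat1_mk)

lemma Gam_inverse:
  assumes "A \<in> Gam"
  shows "A ** adj A = mat 1" "adj A ** A = mat 1"
  using assms by (auto elim!: Gam_cases simp: mat1_mk algebra_simps)

lemma mult_one [simp]: "(A :: complex^2^2) ** mat 1 = A" "mat 1 ** (A :: complex^2^2) = A"
  by (simp_all add: matrix_mul_lid matrix_mul_rid)

lemma Gam_cancel:
  assumes "X \<in> Gam"
  shows "adj X ** (X ** A) = A" "X ** (adj X ** A) = A" "(A ** X) ** adj X = A" "(A ** adj X) ** X = A"
proof -
  have "adj X ** (X ** A) = (adj X ** X) ** A" "X ** (adj X ** A) = (X ** adj X) ** A"
    by (simp_all only: matrix_mul_assoc)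
  moreover have "(A ** X) ** adj X = A ** (X ** adj X)" "(A ** adj X) ** X = A ** (adj X ** X)"
    by (simp_all only: matrix_mul_assoc)
  ultimately show "adj X ** (X ** A) = A" "X ** (adj X ** A) = A" "(A ** X) ** adj X = A" "(A ** adj X) ** X = A"
    using Gam_inverse[OF assms] by simp_all
qed

definition mconj :: "complex^2^2 \<Rightarrow> complex^2^2 \<Rightarrow> complex^2^2" where
  "mconj X A = X ** A ** adj X"

lemma mconj_Gam [simp, intro]: "X \<in> Gam \<Longrightarrow> A \<in> Gam \<Longrightarrow> mconj X A \<in> Gam"
  by (simp add: mconj_def)

lemma mconj_uminus [simp]: "mconj X (- A) = - mconj X A" "mconj (- X) A = mconj X A"
  by (simp_all add: mconj_def mat_uminus_mult)

lemma mconj_one [simp]: "mconj (mat 1) A = A"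
  by (cases A rule: mk_cases) (simp add: mconj_def mat1_mk)

lemma mconj_mconj: "mconj X (mconj Y A) = mconj (X ** Y) A"
  by (simp add: mconj_def adj_mult matrix_mul_assoc)

lemma mconj_mult: "X \<in> Gam \<Longrightarrow> mconj X (A ** B) = mconj X A ** mconj X B"
  unfolding mconj_def by (metis Gam_cancel(1) matrix_mul_assoc)

lemma mconj_adj_cancel [simp]: "X \<in> Gam \<Longrightarrow> mconj (adj X) (mconj X A) = A" "X \<in> Gam \<Longrightarrow> mconj X (mconj (adj X) A) = A"
  by (simp_all add: mconj_mconj Gam_inverse)

lemma trace_mconj: "X \<in> Gam \<Longrightarrow> trace (mconj X A) = trace A"
  unfolding mconj_def by (metis Gam_cancel(1) trace_mul_sym)

lemma mconj_eq_iff: "X \<in> Gam \<Longrightarrow> mconj X A = B \<longleftrightarrow> X ** A = B ** X"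
  unfolding mconj_def by (metis Gam_cancel(3,4))

lemma trace_uminus2 [simp]: "trace (- A) = - trace (A :: complex^2^2)"
  by (cases A rule: mk_cases) simp

section \<open>Conjugacy and reversibility in PSL(2, Z[i]) in terms of matrices\<close>

lemma psl_mult:
  "A \<in> Gam \<Longrightarrow> B \<in> Gam \<Longrightarrow> {A, - A} \<otimes>\<^bsub>PSL2 ZI\<^esub> {B, - B} = {A ** B, - (A ** B)}"
  by (auto simp: PSL2_def FactGroup_def set_mult_def SL2_def mat_uminus_mult)

lemma psl_carrier: "A \<in> Gam \<Longrightarrow> {A, - A} \<in> carrier (PSL2 ZI)"
  by (auto simp: carrier_PSL2)

lemma psl_one: "\<one>\<^bsub>PSL2 ZI\<^esub> = {mat 1, - mat 1}"
  by (simp add: PSL2_def FactGroup_def)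

lemma psl_inv:
  assumes "A \<in> Gam"
  shows "inv\<^bsub>PSL2 ZI\<^esub> {A, - A} = {adj A, - adj A}"
proof (rule group.inv_equality[OF complex_subring.group_PSL2[OF complex_subring_gaussian_ints]])
  show "{adj A, - adj A} \<otimes>\<^bsub>PSL2 ZI\<^esub> {A, - A} = \<one>\<^bsub>PSL2 ZI\<^esub>"
    using assms by (simp add: psl_mult psl_one Gam_inverse)
qed (use assms in \<open>auto intro: psl_carrier\<close>)

definition mat_class :: "complex^2^2 \<Rightarrow> (complex^2^2) set set" where
  "mat_class A = conj_class (PSL2 ZI) {A, - A}"

lemma mat_class_eq:
  assumes A: "A \<in> Gam"
  shows "mat_class A = {{mconj X A, - mconj X A} | X. X \<in> Gam}"
proof -
  have e: "{X, - X} \<otimes>\<^bsub>PSL2 ZI\<^esub> {A, - A} \<otimes>\<^bsub>PSL2 ZI\<^esub> inv\<^bsub>PSL2 ZI\<^esub> {X, - X} = {mconj X A, - mconj X A}" if "X \<in> Gam" for X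
    using that A by (simp add: psl_mult psl_inv mconj_def)
  have "mat_class A = {x \<otimes>\<^bsub>PSL2 ZI\<^esub> {A, - A} \<otimes>\<^bsub>PSL2 ZI\<^esub> inv\<^bsub>PSL2 ZI\<^esub> x | x. \<exists>X. x = {X, - X} \<and> X \<in> Gam}"
    unfolding mat_class_def conj_class_def carrier_PSL2 by simp
  also have "\<dots> = {{mconj X A, - mconj X A} | X. X \<in> Gam}"
    using e by (intro Collect_cong iffI; elim exE conjE; simp) blast+
  finally show ?thesis .
qed

lemma mat_class_eq_iff:
  assumes A: "A \<in> Gam" and B: "B \<in> Gam"
  shows "mat_class A = mat_class B \<longleftrightarrow> (\<exists>X\<in>Gam. B = mconj X A \<or> B = - mconj X A)"
proof
  assume e: "mat_class A = mat_class B"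
  have "{mconj (mat 1) B, - mconj (mat 1) B} \<in> mat_class B" using mat_class_eq[OF B] by blast
  then have "{B, - B} \<in> mat_class A" using e by simp
  then obtain X where "X \<in> Gam" "{B, - B} = {mconj X A, - mconj X A}" using mat_class_eq[OF A] by auto
  then show "\<exists>X\<in>Gam. B = mconj X A \<or> B = - mconj X A" by (metis insertI1 insertE singletonD)
next
  have sub: "mat_class B \<subseteq> mat_class A" if hyp: "A \<in> Gam" "B \<in> Gam" "X \<in> Gam" "B = mconj X A \<or> B = - mconj X A" for A B X
  proof
    fix g assume "g \<in> mat_class B"
    then obtain Y where Y: "Y \<in> Gam" "g = {mconj Y B, - mconj Y B}" using mat_class_eq[OF hyp(2)] by auto
    then have "g = {mconj (Y ** X) A, - mconj (Y ** X) A}" using hyp by (auto simp: mconj_mconj)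
    then show "g \<in> mat_class A" using mat_class_eq[OF hyp(1)] Y hyp by auto
  qed
  assume "\<exists>X\<in>Gam. B = mconj X A \<or> B = - mconj X A"
  then obtain X where X: "X \<in> Gam" "B = mconj X A \<or> B = - mconj X A" by auto
  then have "A = mconj (adj X) B \<or> A = - mconj (adj X) B" by auto
  then show "mat_class A = mat_class B" using sub[OF A B X] sub[OF B A, of "adj X"] X by auto
qed

lemma reversible_iff:
  assumes A: "A \<in> Gam"
  shows "reversible (PSL2 ZI) {A, - A} \<longleftrightarrow> (\<exists>X\<in>Gam. adj A = mconj X A \<or> adj A = - mconj X A)"
proof -
  have "reversible (PSL2 ZI) {A, - A} \<longleftrightarrow> {adj A, - adj A} \<in> mat_class A"
    by (simp add: reversible_def psl_inv[OF A] mat_class_def)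
  also have "\<dots> \<longleftrightarrow> (\<exists>X\<in>Gam. {adj A, - adj A} = {mconj X A, - mconj X A})"
    by (auto simp: mat_class_eq[OF A])
  also have "\<dots> \<longleftrightarrow> (\<exists>X\<in>Gam. adj A = mconj X A \<or> adj A = - mconj X A)"
    by (metis doubleton_eq_iff minus_minus)
  finally show ?thesis .
qed

lemma rev_lox_classes_eq:
  "rev_lox_classes T = {mat_class A | A. A \<in> Gam \<and> reversible (PSL2 ZI) {A, - A} \<and> loxodromic {A, - A} \<and> (cmod (trace A))\<^sup>2 \<le> T}"
  unfolding rev_lox_classes_def carrier_PSL2 mat_class_def by (auto simp: trace_norm_lifts)

section \<open>Loxodromic elements recognised by their trace\<close>

lemma not_elliptic:
  assumes A: "A \<in> Gam" and tr: "trace A \<notin> complex_of_real ` {-2..2}"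
  shows "\<not> elliptic {A, - A}"
proof
  assume "elliptic {A, - A}"
  then obtain z t where t: "t > 0" and f: "hyp3_act A (z, t) = (z, t)"
    by (auto simp: elliptic_def hyp3_def)
  obtain a b c d where m: "A = mk a b c d" and det: "a * d - b * c = 1" using A by (rule Gam_cases)
  define p where "p = c * z + d"
  define q where "q = (cmod p)\<^sup>2 + (cmod c)\<^sup>2 * t\<^sup>2"
  have e: "((a * z + b) * cnj p + a * cnj c * (of_real t)\<^sup>2) / of_real q = z" "t / q = t"
    using f unfolding hyp3_act_def Let_def m p_def q_def by auto
  \<comment> \<open>Equal heights give |p|^2 + |c|^2 t^2 = 1, hence |p| <= 1; the equation for
    \<open>z\<close> then identifies the trace with 2 Re p.\<close>
  then have q1: "q = 1" using t by (simp add: divide_eq_eq split: if_splits)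
  have pc: "p * cnj p + c * cnj c * (of_real t)\<^sup>2 = 1"
    using q1 unfolding q_def complex_norm_square[symmetric] by (metis of_real_1 of_real_add of_real_mult of_real_power)
  have z: "(a * z + b) * cnj p + a * cnj c * (of_real t)\<^sup>2 = z" using e(1) q1 by simp
  have p1: "cmod p \<le> 1"
  proof -
    have "(cmod p)\<^sup>2 \<le> 1" using q1 unfolding q_def by (smt (verit) zero_le_mult_iff zero_le_power2)
    then show ?thesis by (simp add: power_le_one_iff abs_square_le_1)
  qed
  have "a + d = p + cnj p"
  proof (cases "c = 0")
    case True
    then have pd: "p = d" "d * cnj d = 1" using pc by (auto simp: p_def)
    have "a = a * (d * cnj d)" using pd by simp
    also have "\<dots> = cnj d" using det True by (simp add: mult_ac)
    finally show ?thesis using pd by simp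
  next
    case False
    have "c * z = (c * (a * z + b)) * cnj p + a * (c * cnj c * (of_real t)\<^sup>2)"
      by (subst z[symmetric]) (simp add: algebra_simps)
    also have "c * (a * z + b) = a * p - 1" using det by (simp add: p_def algebra_simps)
    also have "c * cnj c * (of_real t)\<^sup>2 = 1 - p * cnj p" using pc by (simp add: algebra_simps)
    finally have "c * z = a - cnj p" by (simp add: algebra_simps)
    then show ?thesis by (simp add: p_def algebra_simps)
  qed
  then have "trace A = complex_of_real (2 * Re p)" by (simp add: m complex_add_cnj)
  moreover have "2 * Re p \<in> {-2..2}" using p1 abs_Re_le_cmod[of p] by auto
  ultimately show False using tr by blast
qed

text \<open>The finite fixed points are the roots of c z^2 + (d - a) z - b, whose discriminant is (a
  + d)^2 - 4.\<close>

lemma fixed_points_finite: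
  assumes det: "a * d - b * c = 1" and c: "c \<noteq> 0"
  obtains z1 z2 where "{w. boundary_act (mk a b c d) w = w} = {Some z1, Some z2}" "z1 = z2 \<longleftrightarrow> (a + d)\<^sup>2 = 4"
proof -
  define r where "r = csqrt ((a + d)\<^sup>2 - 4)"
  have r2: "r * r = (a + d)\<^sup>2 - 4" unfolding r_def by (metis power2_csqrt power2_eq_square)
  define z1 z2 where "z1 = (a - d + r) / (2 * c)" and "z2 = (a - d - r) / (2 * c)"
  have "z1 = z2 \<longleftrightarrow> r = 0" using c by (simp add: z1_def z2_def)
  also have "\<dots> \<longleftrightarrow> (a + d)\<^sup>2 = 4" using r2 by auto
  finally have z12: "z1 = z2 \<longleftrightarrow> (a + d)\<^sup>2 = 4" .
  have quad: "c * z * z + (d - a) * z - b = c * (z - z1) * (z - z2)" for z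
  proof -
    have e: "2 * c * z1 = a - d + r" "2 * c * z2 = a - d - r" using c by (simp_all add: z1_def z2_def)
    have "4 * c * (c * (z - z1) * (z - z2)) = (2 * c * z - 2 * c * z1) * (2 * c * z - 2 * c * z2)"
      by (simp add: algebra_simps)
    also have "\<dots> = 4 * c * (c * z * z + (d - a) * z - b)" unfolding e
      by (rule eq_of_diff_combination[OF r2 det, where k = "- 1" and k' = "- 4"]) (simp add: power2_eq_square algebra_simps)
    finally show ?thesis using c by simp
  qed
  have "boundary_act (mk a b c d) w = w \<longleftrightarrow> w = Some z1 \<or> w = Some z2" for w
  proof (cases w)
    case None
    then show ?thesis using c by (simp add: boundary_act_def)
  next
    case (Some z)
    have "boundary_act (mk a b c d) w = w \<longleftrightarrow> c * z * z + (d - a) * z - b = 0"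
    proof (cases "c * z + d = 0")
      \<comment> \<open>At the pole both sides are false: the image is infinity, and c (a z + b) =
        -1 keeps the quadratic from vanishing.\<close>
      case True
      have "c * z * z + (d - a) * z - b = (c * z + d) * z - (a * z + b)" by (simp add: algebra_simps)
      moreover have "c * (a * z + b) = a * (c * z + d) - 1" using det by (simp add: algebra_simps)
      ultimately show ?thesis using True Some by (auto simp: boundary_act_def)
    next
      case cz: False
      have "(a * z + b) / (c * z + d) = z \<longleftrightarrow> a * z + b = z * (c * z + d)" using cz by (simp add: divide_eq_eq)
      also have "\<dots> \<longleftrightarrow> c * z * z + (d - a) * z - b = 0"
      proof -
        have "z * (c * z + d) - (a * z + b) = c * z * z + (d - a) * z - b" by (simp add: algebra_simps)
        then show ?thesis by (metis eq_iff_diff_eq_0)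
      qed
      finally show ?thesis using cz Some by (simp add: boundary_act_def)
    qed
    then show ?thesis using Some c by (simp add: quad)
  qed
  then have "{w. boundary_act (mk a b c d) w = w} = {Some z1, Some z2}" by auto
  then show thesis using z12 by (rule that)
qed

lemma card_fixed_points:
  assumes A: "A \<in> Gam"
  shows "card {w. \<forall>B\<in>{A, - A}. boundary_act B w = w} = 2 \<longleftrightarrow> (trace A)\<^sup>2 \<noteq> 4"
proof -
  obtain a b c d where m: "A = mk a b c d" and det: "a * d - b * c = 1" using A by (rule Gam_cases)
  have S: "{w. \<forall>B\<in>{A, - A}. boundary_act B w = w} = {w. boundary_act A w = w}"
    by (simp add: boundary_act_uminus)
  show ?thesis
  proof (cases "c = 0")
    case True
    have d0: "d \<noteq> 0" using det True by auto
    have sq: "(a + d)\<^sup>2 - 4 = (d - a)\<^sup>2" using det True by (simp add: power2_eq_square algebra_simps)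
    have fx: "boundary_act A w = w \<longleftrightarrow> w = None \<or> (\<exists>z. w = Some z \<and> b = z * (d - a))" for w
    proof (cases w)
      case None
      then show ?thesis by (simp add: boundary_act_def m True)
    next
      case (Some z)
      have "(a * z + b) / d = z \<longleftrightarrow> a * z + b = z * d" using d0 by (simp add: divide_eq_eq)
      also have "\<dots> \<longleftrightarrow> b = z * (d - a)" by (auto simp: algebra_simps)
      finally show ?thesis using d0 Some by (simp add: boundary_act_def m True)
    qed
    show ?thesis
    proof (cases "a = d")
      case True
      then have "{w. boundary_act A w = w} = (if b = 0 then UNIV else {None})" using fx by (auto simp: not_None_eq)
      moreover have "infinite (UNIV :: complex option set)"
        using infinite_UNIV_char_0[where 'a = complex] by (simp add: finite_option_UNIV)
      moreover have "(trace A)\<^sup>2 = 4" using sq True m by simp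
      ultimately show ?thesis unfolding S by simp
    next
      case False
      then have "boundary_act A w = w \<longleftrightarrow> w = None \<or> w = Some (b / (d - a))" for w
        unfolding fx by (auto simp: eq_divide_eq)
      then have "{w. boundary_act A w = w} = {None, Some (b / (d - a))}" by auto
      moreover have "(trace A)\<^sup>2 \<noteq> 4" using sq False m by auto
      ultimately show ?thesis unfolding S by simp
    qed
  next
    case False
    obtain z1 z2 where e: "{w. boundary_act (mk a b c d) w = w} = {Some z1, Some z2}" and z: "z1 = z2 \<longleftrightarrow> (a + d)\<^sup>2 = 4"
      using fixed_points_finite[OF det False] .
    have "card {Some z1, Some z2} = 2 \<longleftrightarrow> z1 \<noteq> z2" by (simp add: card_insert_if)
    then show ?thesis unfolding S unfolding m e by (simp add: z)
  qed
qed

lemma elliptic_real_trace: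
  assumes A: "A \<in> Gam" and x: "trace A = of_real x" "\<bar>x\<bar> < 2"
  shows "elliptic {A, - A}"
proof -
  obtain a b c d where m: "A = mk a b c d" and I: "a \<in> ZI" "d \<in> ZI" and det: "a * d - b * c = 1" using A by (rule Gam_cases)
  have x2: "x\<^sup>2 < 4" using x(2) abs_square_less_1[of "x / 2"] by (simp add: power_divide)
  have ad: "a + d = of_real x" using x m by simp
  have "\<exists>z t. t > 0 \<and> hyp3_act A (z, t) = (z, t)"
  proof (cases "c = 0")
    case True
    then have "a * d = 1" using det by simp
    then have "a \<in> gunits" using I ZI_unit_mult by blast
    moreover have "a \<noteq> 1 \<and> a \<noteq> -1"
    proof safe
      assume "a = 1" then have "of_real x = (of_real 2 :: complex)" using ad \<open>a * d = 1\<close> by simp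
      then show False using x(2) by (simp only: of_real_eq_iff)
    next
      assume "a = -1"
      moreover have "d = -1" using \<open>a * d = 1\<close> \<open>a = -1\<close> by (metis minus_minus mult_minus1)
      ultimately have "of_real x = (of_real (-2) :: complex)" using ad by simp
      then show False using x(2) by (simp only: of_real_eq_iff)
    qed
    ultimately have ai: "a = \<i> \<or> a = - \<i>" by (auto simp: gunits_def)
    then have aa: "a * a = -1" by auto
    have "a * d = a * (- a)" using aa \<open>a * d = 1\<close> by simp
    then have d: "d = - a" using \<open>a * d = 1\<close> mult_left_cancel[of a d "- a"] ai by auto
    have "cnj d = a" "cmod d = 1" using ai unfolding d by auto
    moreover have "(a * (a * b / 2) + b) * a = (a * a) * (a * b) / 2 + a * b" by (simp add: field_simps)
    then have "(a * (a * b / 2) + b) * a = a * b / 2" unfolding aa by simp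
    \<comment> \<open>\<open>A\<close> rotates about the vertical line over its finite fixed point b
      / (d - a), which is a b / 2 since d = -a and a^2 = -1.\<close>
    ultimately have "hyp3_act A (a * b / 2, 1) = (a * b / 2, 1)"
      by (simp add: hyp3_act_def m True)
    then show ?thesis by (intro exI[of _ "a * b / 2"] exI[of _ 1]) simp
  next
    case False
    \<comment> \<open>The top of the geodesic joining the two boundary fixed points:
      \<open>z\<close> is their midpoint and \<open>t\<close> half their distance.\<close>
    define z t where "z = (a - d) / (2 * c)" and "t = sqrt (4 - x\<^sup>2) / (2 * cmod c)"
    have t0: "t > 0" using x2 False by (simp add: t_def)
    have "c * z + d = (a + d) / 2" using False by (simp add: z_def field_simps)
    then have cz: "c * z + d = of_real (x / 2)" unfolding ad by simp
    have ct: "(cmod c)\<^sup>2 * t\<^sup>2 = 1 - (x / 2)\<^sup>2" using x2 False by (simp add: t_def power_divide power_mult_distrib field_simps)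
    then have ct': "c * cnj c * (of_real t)\<^sup>2 = 1 - (of_real (x / 2))\<^sup>2"
      unfolding complex_norm_square[symmetric] by (metis of_real_1 of_real_diff of_real_mult of_real_power)
    have q: "(cmod (c * z + d))\<^sup>2 + (cmod c)\<^sup>2 * t\<^sup>2 = 1" unfolding cz ct by (simp add: power_divide)
    have cab: "c * (a * z + b) = a * (c * z + d) - 1" using det by (simp add: algebra_simps)
    have "c * ((a * z + b) * of_real (x / 2) + a * cnj c * (of_real t)\<^sup>2) =
        (c * (a * z + b)) * of_real (x / 2) + a * (c * cnj c * (of_real t)\<^sup>2)"
      by (simp only: ring_distribs mult_ac)
    also have "\<dots> = (a * (c * z + d) - 1) * of_real (x / 2) + a * (c * cnj c * (of_real t)\<^sup>2)"
      unfolding cab ..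
    also have "\<dots> = a - of_real (x / 2)" unfolding cz ct' by (simp add: power2_eq_square algebra_simps)
    also have "\<dots> = a - (a + d) / 2" unfolding ad by simp
    also have "\<dots> = c * z" using False by (simp add: z_def field_simps)
    finally have "(a * z + b) * of_real (x / 2) + a * cnj c * (of_real t)\<^sup>2 = z" using False by simp
    then have "(a * z + b) * cnj (c * z + d) + a * cnj c * (of_real t)\<^sup>2 = z" unfolding cz by simp
    then have "hyp3_act A (z, t) = (z, t)"
      by (simp only: hyp3_act_def m Let_def mk_nth q prod.case of_real_1 div_by_1)
    then show ?thesis using t0 by blast
  qed
  then show ?thesis unfolding elliptic_def hyp3_def by (auto simp: hyp3_act_uminus)
qed

lemma trace_sq_4_iff: "z\<^sup>2 = 4 \<longleftrightarrow> z = 2 \<or> z = (-2 :: complex)"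
proof -
  have "z\<^sup>2 - 4 = (z - 2) * (z + 2)" by (simp add: power2_eq_square algebra_simps)
  then show ?thesis by (auto simp: eq_neg_iff_add_eq_0)
qed

lemma loxodromic_iff:
  assumes A: "A \<in> Gam"
  shows "loxodromic {A, - A} \<longleftrightarrow> trace A \<notin> complex_of_real ` {-2..2}"
proof
  assume tr: "trace A \<notin> complex_of_real ` {-2..2}"
  have "complex_of_real 2 \<in> complex_of_real ` {-2..2}" "complex_of_real (-2) \<in> complex_of_real ` {-2..2}"
    by (rule imageI, simp)+
  then have "(trace A)\<^sup>2 \<noteq> 4" using tr unfolding trace_sq_4_iff by auto
  then show "loxodromic {A, - A}" unfolding loxodromic_def using not_elliptic[OF A tr] card_fixed_points[OF A] by simp
next
  assume lox: "loxodromic {A, - A}"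
  show "trace A \<notin> complex_of_real ` {-2..2}"
  proof
    assume "trace A \<in> complex_of_real ` {-2..2}"
    then obtain x where x: "trace A = of_real x" "\<bar>x\<bar> \<le> 2" by auto
    have "(trace A)\<^sup>2 \<noteq> 4" using lox card_fixed_points[OF A] by (simp add: loxodromic_def)
    then have "x \<noteq> 2" "x \<noteq> -2" unfolding trace_sq_4_iff x(1) by auto
    then have "elliptic {A, - A}" using x by (intro elliptic_real_trace[OF A x(1)]) linarith
    then show False using lox by (simp add: loxodromic_def)
  qed
qed

section \<open>Pairs of involutions\<close>

type_synonym cvec = "complex \<times> complex"

definition app :: "complex^2^2 \<Rightarrow> cvec \<Rightarrow> cvec" where
  "app A v = (A$1$1 * fst v + A$1$2 * snd v, A$2$1 * fst v + A$2$2 * snd v)"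

definition smul :: "complex \<Rightarrow> cvec \<Rightarrow> cvec" where
  "smul e v = (e * fst v, e * snd v)"

definition detv :: "cvec \<Rightarrow> cvec \<Rightarrow> complex" where
  "detv v w = fst v * snd w - snd v * fst w"

lemma app_mk [simp]: "app (mk a b c d) (p, q) = (a * p + b * q, c * p + d * q)"
  by (simp add: app_def)

lemma smul_pair [simp]: "smul e (p, q) = (e * p, e * q)"
  by (simp add: smul_def)

lemma detv_pair [simp]: "detv (a, b) (c, d) = a * d - b * c"
  by (simp add: detv_def)

lemma app_mult: "app (A ** B) v = app A (app B v)"
  by (simp add: app_def matrix_mult_2 algebra_simps)

lemma app_one [simp]: "app (mat 1) v = v"
  by (simp add: app_def mat1_mk)

lemma app_uminus [simp]: "app (- A) v = smul (-1) (app A v)"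
  by (simp add: app_def smul_def)

lemma app_smul: "app A (smul e v) = smul e (app A v)"
  by (simp add: app_def smul_def algebra_simps)

lemma smul_smul [simp]: "smul a (smul b v) = smul (a * b) v"
  by (simp add: smul_def mult_ac)

lemma smul_one [simp]: "smul 1 v = v"
  by (simp add: smul_def)

lemma smul_cancel: "smul a v = smul a w \<longleftrightarrow> a = 0 \<or> v = w"
  by (auto simp: smul_def prod_eq_iff)

lemma detv_smul [simp]: "detv (smul a v) w = a * detv v w" "detv v (smul a w) = a * detv v w"
  by (simp_all add: detv_def smul_def algebra_simps)

lemma detv_app: "detv (app A v) (app A w) = det A * detv v w"
  by (cases v; cases w; cases A rule: mk_cases) (simp add: algebra_simps)

lemma det_Gam: "A \<in> Gam \<Longrightarrow> det A = 1"
  by (simp add: SL2_def)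

lemma app_Gam_cancel [simp]:
  "A \<in> Gam \<Longrightarrow> app (adj A) (app A v) = v" "A \<in> Gam \<Longrightarrow> app A (app (adj A) v) = v"
  by (simp_all add: app_mult[symmetric] Gam_inverse)

definition prim :: "cvec \<Rightarrow> bool" where
  "prim v \<longleftrightarrow> fst v \<in> ZI \<and> snd v \<in> ZI \<and> gcop (fst v) (snd v)"

lemma prim_pair [simp]: "prim (p, q) \<longleftrightarrow> p \<in> ZI \<and> q \<in> ZI \<and> gcop p q"
  by (simp add: prim_def)

lemma prim_app:
  assumes A: "A \<in> Gam" and v: "prim v"
  shows "prim (app A v)"
proof -
  obtain p q where pq: "v = (p, q)" by (cases v)
  obtain a b c d where m: "A = mk a b c d" "a \<in> ZI" "b \<in> ZI" "c \<in> ZI" "d \<in> ZI" "a * d - b * c = 1"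
    using A by (rule Gam_cases)
  obtain x y where xy: "x \<in> ZI" "y \<in> ZI" "x * p + y * q = 1" using v by (auto simp: pq gcop_def)
  have pqI: "p \<in> ZI" "q \<in> ZI" using v by (auto simp: pq)
  have "(x * d - y * c) * (a * p + b * q) + (y * a - x * b) * (c * p + d * q) = (a * d - b * c) * (x * p + y * q)"
    by (simp add: algebra_simps)
  then have "(x * d - y * c) * (a * p + b * q) + (y * a - x * b) * (c * p + d * q) = 1" using m xy by simp
  moreover have "x * d - y * c \<in> ZI" "y * a - x * b \<in> ZI" "a * p + b * q \<in> ZI" "c * p + d * q \<in> ZI"
    using xy m pqI by (auto intro!: ZI_closed)
  ultimately show ?thesis unfolding pq m(1) app_mk prim_pair gcop_def by blast
qed

text \<open>
  Trace 0 and determinant 1 force the eigenvalues \<open>\<i>\<close> and \<open>- \<i>\<close>, so eigenvectors can be chosen primitive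
  over the Gaussian integers. The sign of a lift selects one of the two fixed points.
\<close>

definition isev :: "complex^2^2 \<Rightarrow> cvec \<Rightarrow> bool" where
  "isev x v \<longleftrightarrow> prim v \<and> app x v = smul \<i> v"

definition Invol :: "(complex^2^2) set" where "Invol = {x \<in> Gam. trace x = 0}"

lemma Invol_Gam: "x \<in> Invol \<Longrightarrow> x \<in> Gam" by (simp add: Invol_def)

lemma Invol_cases:
  assumes "x \<in> Invol"
  obtains a b c where "x = mk a b c (- a)" "a \<in> ZI" "b \<in> ZI" "c \<in> ZI" "a * a + b * c = - 1"
proof -
  from assms have "x \<in> Gam" "trace x = 0" by (auto simp: Invol_def)
  then obtain a b c d where "x = mk a b c d" "a \<in> ZI" "b \<in> ZI" "c \<in> ZI" "d \<in> ZI" and det: "a * d - b * c = 1"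
    using Gam_cases by metis
  moreover have "d = - a" using \<open>trace x = 0\<close> calculation by (simp add: eq_neg_iff_add_eq_0 add.commute)
  moreover have "a * a + b * c = - 1"
  proof -
    have "a * a + b * c = - (a * d - b * c)" using \<open>d = - a\<close> by simp
    also have "a * d - b * c = 1" by (rule det)
    finally show ?thesis .
  qed
  ultimately show thesis using that by simp
qed

lemma Invol_uminus [simp]: "- x \<in> Invol \<longleftrightarrow> x \<in> Invol"
  by (simp add: Invol_def)

lemma Invol_mconj: "k \<in> Gam \<Longrightarrow> x \<in> Invol \<Longrightarrow> mconj k x \<in> Invol"
  by (simp add: Invol_def trace_mconj)

lemma Invol_adj: "x \<in> Invol \<Longrightarrow> adj x = - x"
  by (erule Invol_cases) simp

lemma Invol_sq: "x \<in> Invol \<Longrightarrow> x ** x = - mat 1"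
  by (erule Invol_cases) (simp add: mat1_mk mult.commute add.commute)

lemma prim_part:
  assumes "p \<in> ZI" "q \<in> ZI" "p \<noteq> 0 \<or> q \<noteq> 0"
  obtains d v where "d \<in> ZI" "d \<noteq> 0" "prim v" "(p, q) = smul d v"
proof -
  obtain d p' q' where "d \<in> ZI" "d \<noteq> 0" "p' \<in> ZI" "q' \<in> ZI" "p = d * p'" "q = d * q'" "gcop p' q'"
    using assms by (rule ZI_coprime_part)
  then show thesis using that[of d "(p', q')"] by simp
qed

text \<open>Since (x - i)(x + i) = x^2 + 1 = 0, any nonzero column of x + i is an eigenvector;
  dividing by its content makes it primitive.\<close>

lemma isev_exists:
  assumes "x \<in> Invol"
  shows "\<exists>v. isev x v"
proof -
  obtain a b c where x: "x = mk a b c (- a)" "a \<in> ZI" "b \<in> ZI" "c \<in> ZI" and det: "a * a + b * c = - 1"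
    using assms by (rule Invol_cases)
  have bc: "b * c = - 1 - a * a" using det by (simp add: eq_diff_eq add.commute)
  have "\<exists>p q. p \<in> ZI \<and> q \<in> ZI \<and> (p \<noteq> 0 \<or> q \<noteq> 0) \<and> app x (p, q) = smul \<i> (p, q)"
  proof (cases "a = - \<i> \<and> c = 0")
    case True
    \<comment> \<open>The first column of x + i vanishes here; the second is (b, 2 i).\<close>
    then show ?thesis using x by (intro exI[of _ b] exI[of _ "2 * \<i>"]) (auto intro!: ZI_closed)
  next
    case False
    have "a + \<i> \<in> ZI" using x by auto
    moreover have "app x (a + \<i>, c) = smul \<i> (a + \<i>, c)" by (simp add: x(1) bc algebra_simps)
    moreover have "a + \<i> \<noteq> 0 \<or> c \<noteq> 0" using False by (simp add: eq_neg_iff_add_eq_0)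
    ultimately show ?thesis using x by blast
  qed
  then obtain p q where pq: "p \<in> ZI" "q \<in> ZI" "p \<noteq> 0 \<or> q \<noteq> 0" "app x (p, q) = smul \<i> (p, q)" by blast
  obtain d v where d: "d \<in> ZI" "d \<noteq> 0" "prim v" "(p, q) = smul d v" using pq(1-3) by (rule prim_part)
  have "smul d (app x v) = smul d (smul \<i> v)"
    using pq(4) unfolding d(4) by (simp add: app_smul mult.commute)
  then have "app x v = smul \<i> v" using d(2) by (simp only: smul_cancel simp_thms)
  then show ?thesis using d(3) unfolding isev_def by blast
qed

lemma detv_zero:
  assumes v: "prim v" and u: "fst u \<in> ZI" "snd u \<in> ZI" "detv v u = 0"
  obtains l where "l \<in> ZI" "u = smul l v"
proof -
  obtain p q where pq: "v = (p, q)" by (cases v)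
  obtain r s where rs: "u = (r, s)" by (cases u)
  have e: "p * s = q * r" using u by (simp add: pq rs)
  obtain a b where ab: "a \<in> ZI" "b \<in> ZI" "a * p + b * q = 1" using v by (auto simp: pq gcop_def)
  have "(a * r + b * s) * p = (a * p + b * q) * r" using e by (simp add: algebra_simps)
  moreover have "(a * r + b * s) * q = (a * p + b * q) * s" using e by (simp add: algebra_simps)
  ultimately have "u = smul (a * r + b * s) v" using ab(3) by (simp add: pq rs)
  moreover have "a * r + b * s \<in> ZI" using ab u by (auto simp: rs intro!: ZI_closed)
  ultimately show thesis using that by blast
qed

text \<open>\<open>x\<close> preserves determinants but multiplies that of two \<i>-eigenvectors by
  -1, so it is 0 and the vectors are parallel.\<close>

lemma isev_unique:
  assumes x: "x \<in> Gam" and v: "isev x v" and u: "fst u \<in> ZI" "snd u \<in> ZI" "app x u = smul \<i> u"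
  obtains l where "l \<in> ZI" "u = smul l v"
proof -
  have "detv (app x v) (app x u) = detv v u" using det_Gam[OF x] by (simp add: detv_app)
  then have "\<i> * \<i> * detv v u = detv v u" using v u by (simp add: isev_def)
  then have "detv v u = 0" by simp
  moreover have "prim v" using v by (simp add: isev_def)
  ultimately show thesis using detv_zero u that by blast
qed

lemma prim_smul_unit:
  assumes "prim (smul l v)" "l \<in> ZI" "prim v"
  shows "l \<in> gunits"
proof -
  obtain p q where pq: "v = (p, q)" by (cases v)
  obtain a b where ab: "a \<in> ZI" "b \<in> ZI" "a * (l * p) + b * (l * q) = 1" using assms(1) by (auto simp: pq gcop_def)
  then have "l * (a * p + b * q) = 1" by (simp add: algebra_simps)
  moreover have "a * p + b * q \<in> ZI" using ab assms by (auto simp: pq intro!: ZI_closed)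
  ultimately show ?thesis using ZI_unit_mult(1) assms(2) by blast
qed

lemma isev_unit:
  assumes "x \<in> Gam" "isev x v" "isev x u"
  obtains e where "e \<in> gunits" "u = smul e v"
proof -
  have "fst u \<in> ZI" "snd u \<in> ZI" "app x u = smul \<i> u" using assms(3) by (auto simp: isev_def prim_def)
  then obtain l where l: "l \<in> ZI" "u = smul l v" using isev_unique[OF assms(1,2)] by metis
  have "l \<in> gunits" using prim_smul_unit[of l v] l assms by (simp add: isev_def)
  then show thesis using l that by blast
qed

lemma isev_smul:
  assumes "isev x v" "e \<in> gunits"
  shows "isev x (smul e v)"
proof -
  obtain p q where pq: "v = (p, q)" by (cases v)
  obtain a b where ab: "a \<in> ZI" "b \<in> ZI" "a * p + b * q = 1" "p \<in> ZI" "q \<in> ZI"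
    using assms by (auto simp: pq isev_def gcop_def)
  have e: "e * cnj e = 1" "e \<in> ZI" "cnj e \<in> ZI" using assms(2) by (auto simp: gunits_def)
  have "(a * cnj e) * (e * p) + (b * cnj e) * (e * q) = (e * cnj e) * (a * p + b * q)" by (simp add: algebra_simps)
  then have "(a * cnj e) * (e * p) + (b * cnj e) * (e * q) = 1" using e ab by simp
  moreover have "a * cnj e \<in> ZI" "b * cnj e \<in> ZI" "e * p \<in> ZI" "e * q \<in> ZI" using ab e by (auto intro: ZI_closed)
  ultimately have "prim (smul e v)" unfolding pq smul_pair prim_pair gcop_def by blast
  moreover have "app x (smul e v) = smul \<i> (smul e v)"
    using assms by (simp add: app_smul isev_def mult.commute)
  ultimately show ?thesis by (simp add: isev_def)
qed

lemma isev_mconj: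
  assumes "k \<in> Gam" "isev x v"
  shows "isev (mconj k x) (app k v)"
  using assms by (simp add: isev_def prim_app mconj_def app_mult app_smul)

text \<open>Primitive eigenvectors are unique up to units, so the value does not depend on the
  choices. It is |s|^2 in the normal form, the quantity minimised over signs.\<close>

definition det_norm :: "complex^2^2 \<Rightarrow> complex^2^2 \<Rightarrow> real" where
  "det_norm x y = (cmod (detv (SOME v. isev x v) (SOME w. isev y w)))\<^sup>2"

lemma det_norm_eq:
  assumes "x \<in> Gam" "y \<in> Gam" "isev x v" "isev y w"
  shows "det_norm x y = (cmod (detv v w))\<^sup>2"
proof -
  have "isev x (SOME v. isev x v)" "isev y (SOME w. isev y w)" using assms by (auto intro: someI)
  then obtain e f where "e \<in> gunits" "(SOME v. isev x v) = smul e v" "f \<in> gunits" "(SOME w. isev y w) = smul f w"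
    using isev_unit assms by metis
  then show ?thesis by (simp add: det_norm_def norm_mult gunits_norm)
qed

lemma det_norm_mconj:
  assumes k: "k \<in> Gam" and x: "x \<in> Invol" and y: "y \<in> Invol"
  shows "det_norm (mconj k x) (mconj k y) = det_norm x y"
proof -
  obtain v w where "isev x v" "isev y w" using isev_exists x y by blast
  then show ?thesis using det_norm_eq[of x y v w] det_norm_eq[OF _ _ isev_mconj[OF k] isev_mconj[OF k], of x y v w] k x y
    by (simp add: Invol_Gam detv_app det_Gam)
qed

text \<open>
  Normal form of a pair of involutions with \<open>\<i>\<close>-eigenvectors \<open>v\<close>, \<open>w\<close> after moving \<open>v\<close> to \<open>(1, 0)\<close>: then
  \<open>w = (u, s)\<close> with \<open>s\<close> the determinant of \<open>v\<close>, \<open>w\<close>, and \<open>u\<close> matters only modulo \<open>s\<close>. Writing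
  \<open>x + \<i> = v \<otimes> l\<close> and \<open>y + \<i> = w \<otimes> m\<close> gives \<open>l = (2 * \<i>, B)\<close> and \<open>m = (Q, n)\<close> with \<open>Q * u + n * s = 2 * \<i>\<close>.
\<close>

definition tup_x :: "complex \<times> complex \<times> complex \<times> complex \<Rightarrow> complex^2^2" where
  "tup_x = (\<lambda>(s, u, B, Q). mk \<i> B 0 (- \<i>))"

definition tup_y :: "complex \<times> complex \<times> complex \<times> complex \<Rightarrow> complex^2^2" where
  "tup_y = (\<lambda>(s, u, B, Q). mk (u * Q - \<i>) (u * ((2 * \<i> - Q * u) / s)) (s * Q) (\<i> - Q * u))"

definition tup_w :: "complex \<times> complex \<times> complex \<times> complex \<Rightarrow> cvec" where
  "tup_w = (\<lambda>(s, u, B, Q). (u, s))"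

definition Tuples :: "(complex \<times> complex \<times> complex \<times> complex) set" where
  "Tuples = {(s, u, B, Q). s \<in> ZI \<and> s \<noteq> 0 \<and> u \<in> coprime_residues s \<and> B \<in> ZI \<and> Q \<in> ZI \<and> gdvd s (2 * \<i> - Q * u)}"

lemma Tuples_cases:
  assumes "t \<in> Tuples"
  obtains s u B Q n where "t = (s, u, B, Q)" "s \<in> ZI" "s \<noteq> 0" "u \<in> ZI" "gfloor (u / s) = 0" "gcop u s" "B \<in> ZI" "Q \<in> ZI"
    "n \<in> ZI" "2 * \<i> - Q * u = s * n" "tup_x t = mk \<i> B 0 (- \<i>)" "tup_y t = mk (u * Q - \<i>) (u * n) (s * Q) (s * n - \<i>)"
proof -
  obtain s u B Q where t: "t = (s, u, B, Q)" by (cases t)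
  then have *: "s \<in> ZI" "s \<noteq> 0" "u \<in> coprime_residues s" "B \<in> ZI" "Q \<in> ZI" "gdvd s (2 * \<i> - Q * u)" using assms by (auto simp: Tuples_def)
  then obtain n where n: "n \<in> ZI" "2 * \<i> - Q * u = s * n" by (auto simp: gdvd_def)
  have "\<i> - Q * u = s * n - \<i>" using n(2) by (simp add: algebra_simps)
  then have "tup_y t = mk (u * Q - \<i>) (u * n) (s * Q) (s * n - \<i>)" using n * by (simp add: tup_y_def t)
  moreover have "tup_x t = mk \<i> B 0 (- \<i>)" by (simp add: tup_x_def t)
  ultimately show thesis using that[OF t] * n by (auto simp: coprime_residues_def residues_def)
qed

lemma tup_x_tup_y:
  assumes "t \<in> Tuples"
  shows "tup_x t \<in> Invol" "tup_y t \<in> Invol" "isev (tup_x t) (1, 0)" "isev (tup_y t) (tup_w t)"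
proof -
  obtain s u B Q n where t: "t = (s, u, B, Q)" "s \<in> ZI" "s \<noteq> 0" "u \<in> ZI" "gfloor (u / s) = 0" "gcop u s" "B \<in> ZI" "Q \<in> ZI"
    "n \<in> ZI" and n: "2 * \<i> - Q * u = s * n" and xy: "tup_x t = mk \<i> B 0 (- \<i>)" "tup_y t = mk (u * Q - \<i>) (u * n) (s * Q) (s * n - \<i>)"
    using assms by (rule Tuples_cases)
  have "tup_x t \<in> Gam" "trace (tup_x t) = 0" unfolding xy using t by simp_all
  then show "tup_x t \<in> Invol" by (simp add: Invol_def)
  have sn: "s * n = 2 * \<i> - Q * u" using n by simp
  have "(u * Q - \<i>) * (s * n - \<i>) - (u * n) * (s * Q) = - \<i> * (u * Q + s * n) - 1" by (simp add: algebra_simps)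
  also have "\<dots> = 1" unfolding sn by (simp add: algebra_simps)
  finally have "(u * Q - \<i>) * (s * n - \<i>) - (u * n) * (s * Q) = 1" .
  moreover have "u * Q - \<i> \<in> ZI" "u * n \<in> ZI" "s * Q \<in> ZI" "s * n - \<i> \<in> ZI" using t by (auto intro!: ZI_closed)
  ultimately have "tup_y t \<in> Gam" unfolding xy Gam_mk by blast
  moreover have "trace (tup_y t) = 0" unfolding xy trace_mk sn by (simp add: mult.commute)
  ultimately show "tup_y t \<in> Invol" by (simp add: Invol_def)
  have "gcop 1 0" unfolding gcop_def using ZI_simps by (metis add.right_neutral mult_1 mult_zero_left)
  then show "isev (tup_x t) (1, 0)" by (simp add: isev_def xy)
  have "(u * Q - \<i>) * u + u * n * s = u * (u * Q + s * n) - \<i> * u" "s * Q * u + (s * n - \<i>) * s = s * (u * Q + s * n) - \<i> * s"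
    by (simp_all add: algebra_simps)
  then have "app (tup_y t) (u, s) = smul \<i> (u, s)" unfolding xy app_mk sn by (simp add: algebra_simps)
  then show "isev (tup_y t) (tup_w t)" using t by (simp add: isev_def tup_w_def)
qed

lemma trace_tup:
  assumes "t \<in> Tuples" "t = (s, u, B, Q)"
  shows "trace (tup_x t ** tup_y t) = Q * (2 * \<i> * u + B * s) + 2"
  using assms by (simp add: tup_x_def tup_y_def algebra_simps)

text \<open>Eigenvectors are carried along because they rigidify the pair: with them the tuple is
  unique, and the unit multiples can be counted separately.\<close>

definition Rel :: "(complex^2^2) \<times> (complex^2^2) \<times> cvec \<times> cvec \<Rightarrow> complex \<times> complex \<times> complex \<times> complex \<Rightarrow> bool" where
  "Rel = (\<lambda>(x, y, v, w) t. t \<in> Tuples \<and> (\<exists>k\<in>Gam. x = mconj k (tup_x t) \<and> y = mconj k (tup_y t) \<and> v = app k (1, 0) \<and> w = app k (tup_w t)))"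

lemma Rel_exists:
  assumes x: "x \<in> Invol" and y: "y \<in> Invol" and v: "isev x v" and w: "isev y w" and s: "detv v w \<noteq> 0"
  shows "\<exists>t. Rel (x, y, v, w) t"
proof -
  obtain v1 v2 where v12: "v = (v1, v2)" by (cases v)
  obtain \<alpha> \<beta> where ab: "\<alpha> \<in> ZI" "\<beta> \<in> ZI" "\<alpha> * v1 + \<beta> * v2 = 1" and vI: "v1 \<in> ZI" "v2 \<in> ZI"
    using v by (auto simp: v12 isev_def gcop_def)
  \<comment> \<open>The Bezout identity completes \<open>v\<close> to a matrix of determinant 1 with
    first column \<open>v\<close>.\<close>
  define k0 where "k0 = mk v1 (- \<beta>) v2 \<alpha>"
  have k0: "k0 \<in> Gam" "app k0 (1, 0) = v" using ab vI by (auto simp: k0_def v12 algebra_simps)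
  obtain p s where ps: "app (adj k0) w = (p, s)" by (cases "app (adj k0) w")
  have "prim (p, s)" unfolding ps[symmetric] using w k0 by (auto simp: isev_def intro: prim_app)
  then have pI: "p \<in> ZI" "s \<in> ZI" "gcop p s" by auto
  have "app (adj k0) v = (1, 0)" using app_Gam_cancel(1)[OF k0(1), of "(1, 0)"] k0(2) by simp
  then have "detv (1, 0) (p, s) = detv v w" using detv_app[of "adj k0" v w] k0 by (simp add: ps det_Gam)
  then have s0: "s \<noteq> 0" using s by simp
  \<comment> \<open>A translation fixing (1, 0) reduces the first coordinate of the second vector
    modulo \<open>s\<close>.\<close>
  define g u where "g = gfloor (p / s)" and "u = p - s * g"
  have gI: "g \<in> ZI" by (simp add: g_def)
  have uI: "u \<in> ZI" using pI gI by (auto simp: u_def)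
  have "u / s = p / s - g" using s0 by (simp add: u_def diff_divide_distrib)
  then have fu: "gfloor (u / s) = 0" by (simp add: g_def gfloor_diff_eq_0)
  define k where "k = k0 ** mk 1 g 0 1"
  have k: "k \<in> Gam" using k0 gI by (simp add: k_def Gam_mult)
  have kv: "app k (1, 0) = v" using k0 by (simp add: k_def app_mult)
  have "app (mk 1 g 0 1) (u, s) = (p, s)" by (simp add: u_def mult.commute)
  then have kw: "app k (u, s) = w" using app_Gam_cancel(2)[OF k0(1), of w] by (simp add: k_def app_mult ps)
  define x' y' where "x' = mconj (adj k) x" and "y' = mconj (adj k) y"
  have x': "x' \<in> Invol" "x = mconj k x'" and y': "y' \<in> Invol" "y = mconj k y'"
    using x y k by (auto simp: x'_def y'_def intro: Invol_mconj)
  have "isev x' (app (adj k) v)" "isev y' (app (adj k) w)"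
    using v w k by (auto simp: x'_def y'_def intro: isev_mconj)
  then have ev: "isev x' (1, 0)" "isev y' (u, s)"
    using app_Gam_cancel(1)[OF k] unfolding kv[symmetric] kw[symmetric] by simp_all
  have gus: "gcop u s" using ev(2) by (simp add: isev_def)
  obtain a' B c' where xm: "x' = mk a' B c' (- a')" "B \<in> ZI" using x'(1) by (rule Invol_cases)
  have xB: "x' = mk \<i> B 0 (- \<i>)" using ev(1) by (simp add: xm isev_def)
  obtain a b c where ym: "y' = mk a b c (- a)" "a \<in> ZI" "b \<in> ZI" "c \<in> ZI" using y'(1) by (rule Invol_cases)
  have e1: "a * u + b * s = \<i> * u" and e2: "c * u - a * s = \<i> * s" using ev(2) by (simp_all add: ym isev_def)
  obtain \<gamma> \<delta> where gd: "\<gamma> \<in> ZI" "\<delta> \<in> ZI" "\<gamma> * u + \<delta> * s = 1" using gus by (auto simp: gcop_def)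
  \<comment> \<open>Both columns of y' + i are multiples of (u, s). The Bezout coefficients of (u,
    s) extract the factors: \<open>Q\<close> for the first column, \<open>n\<close> below for the
    second.\<close>
  define Q where "Q = \<gamma> * (a + \<i>) + \<delta> * c"
  have QI: "Q \<in> ZI" using gd ym by (auto simp: Q_def intro!: ZI_closed)
  have "c = (\<gamma> * u + \<delta> * s) * c" using gd by simp
  also have "\<dots> = \<gamma> * (c * u) + \<delta> * s * c" by (simp add: algebra_simps)
  also have "c * u = s * (a + \<i>)" using e2 by (simp add: algebra_simps)
  also have "\<gamma> * (s * (a + \<i>)) + \<delta> * s * c = s * Q" by (simp add: Q_def algebra_simps)
  finally have cQ: "c = s * Q" .
  have "s * (a + \<i>) = s * (Q * u)" using e2 unfolding cQ by (simp add: algebra_simps)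
  then have aQ: "a = u * Q - \<i>" using s0 by (simp add: eq_diff_eq mult.commute)
  define m where "m = 2 * \<i> - Q * u"
  have um: "u * m = b * s" using e1 unfolding aQ m_def by (simp add: algebra_simps)
  define n where "n = \<gamma> * b + \<delta> * m"
  have mI: "m \<in> ZI" using QI uI by (auto simp: m_def intro!: ZI_closed)
  have nI: "n \<in> ZI" using mI gd ym by (auto simp: n_def intro!: ZI_closed)
  have "m = (\<gamma> * u + \<delta> * s) * m" using gd by simp
  also have "\<dots> = \<gamma> * (u * m) + \<delta> * s * m" by (simp add: algebra_simps)
  also have "\<dots> = s * n" unfolding um by (simp add: n_def algebra_simps)
  finally have mn: "m = s * n" .
  have "b * s = u * (s * n)" using um unfolding mn by (rule sym)
  then have "b * s = u * n * s" by (simp only: mult_ac)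
  then have bn: "b = u * n" using s0 by (metis mult_right_cancel)
  define t where "t = (s, u, B, Q)"
  have "gdvd s (2 * \<i> - Q * u)" using mn nI unfolding m_def gdvd_def by blast
  then have t: "t \<in> Tuples" using pI s0 uI fu gus xm QI by (simp add: t_def Tuples_def coprime_residues_def residues_def)
  have "n = (2 * \<i> - Q * u) / s" using mn s0 by (simp add: m_def field_simps)
  then have "y' = tup_y t" using ym(1) by (simp add: t_def tup_y_def cQ aQ bn mult.commute)
  moreover have "x' = tup_x t" using xB by (simp add: t_def tup_x_def)
  ultimately have "Rel (x, y, v, w) t"
    unfolding Rel_def using t k x' y' kv kw by (auto simp: tup_w_def t_def intro!: bexI[of _ k])
  then show ?thesis by blast
qed

text \<open>A matrix fixing (1, 0) is a translation and moves \<open>u\<close> by a multiple of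
  \<open>s\<close>; as both values of \<open>u\<close> are reduced modulo \<open>s\<close>, it is
  the identity.\<close>

lemma Tuples_rigid:
  assumes t: "t \<in> Tuples" "t' \<in> Tuples" and m: "m \<in> Gam"
    and e: "tup_x t' = mconj m (tup_x t)" "tup_y t' = mconj m (tup_y t)" "app m (1, 0) = (1, 0)" "app m (tup_w t) = tup_w t'"
  shows "t = t'"
proof -
  obtain s u B Q where ts: "t = (s, u, B, Q)" by (cases t)
  obtain s' u' B' Q' where ts': "t' = (s', u', B', Q')" by (cases t')
  have T: "s \<in> ZI" "s \<noteq> 0" "gfloor (u / s) = 0" using t(1) by (auto simp: ts Tuples_def coprime_residues_def residues_def)
  have T': "gfloor (u' / s') = 0" using t(2) by (auto simp: ts' Tuples_def coprime_residues_def residues_def)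
  obtain a b c d where mm: "m = mk a b c d" "b \<in> ZI" "a * d - b * c = 1" using m by (rule Gam_cases)
  have ac: "a = 1" "c = 0" using e(3) by (simp_all add: mm)
  then have d: "d = 1" using mm by simp
  have us: "u' = u + b * s" "s' = s" using e(4) by (auto simp: mm ac d tup_w_def ts ts')
  have "u' / s = u / s + b" using T us by (simp add: field_simps)
  then have "gfloor (u' / s) = gfloor (u / s) + b" using mm(2) by (simp add: gfloor_add)
  then have "b = 0" using T T' us by simp
  then have "m = mat 1" by (simp add: mm ac d mat1_mk)
  then have "tup_x t' = tup_x t" "tup_y t' = tup_y t" using e by simp_all
  then show ?thesis using us \<open>b = 0\<close> T by (auto simp: ts ts' tup_x_def tup_y_def)
qed

text \<open>The tuple depends only on the orbit of the pair with its eigenvectors;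
  \<open>Rel_orbit\<close> is the converse.\<close>

lemma Rel_unique:
  assumes "Rel (x, y, v, w) t" "Rel (mconj k x, mconj k y, app k v, app k w) t'" "k \<in> Gam"
  shows "t = t'"
proof -
  obtain m where m: "t \<in> Tuples" "m \<in> Gam" "x = mconj m (tup_x t)" "y = mconj m (tup_y t)" "v = app m (1, 0)" "w = app m (tup_w t)"
    using assms(1) by (auto simp: Rel_def)
  obtain m' where m': "t' \<in> Tuples" "m' \<in> Gam" "mconj k x = mconj m' (tup_x t')" "mconj k y = mconj m' (tup_y t')" "app k v = app m' (1, 0)" "app k w = app m' (tup_w t')"
    using assms(2) by (auto simp: Rel_def)
  let ?m = "adj m' ** (k ** m)"
  have M: "?m \<in> Gam" using m m' assms by auto
  have "mconj (adj m') (mconj m' (tup_x t')) = mconj ?m (tup_x t)" "mconj (adj m') (mconj m' (tup_y t')) = mconj ?m (tup_y t)"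
    unfolding m'(3,4)[symmetric] by (simp_all add: m mconj_mconj)
  then have 1: "tup_x t' = mconj ?m (tup_x t)" "tup_y t' = mconj ?m (tup_y t)" using m' by simp_all
  have "app (adj m') (app m' (1, 0)) = app ?m (1, 0)" "app (adj m') (app m' (tup_w t')) = app ?m (tup_w t)"
    unfolding m'(5,6)[symmetric] by (simp_all add: m app_mult)
  then have 2: "app ?m (1, 0) = (1, 0)" "app ?m (tup_w t) = tup_w t'" using m' by simp_all
  show ?thesis by (rule Tuples_rigid[OF m(1) m'(1) M 1 2])
qed

lemma Rel_orbit:
  assumes "Rel (x, y, v, w) t" "Rel (x', y', v', w') t"
  shows "\<exists>k\<in>Gam. x' = mconj k x \<and> y' = mconj k y \<and> v' = app k v \<and> w' = app k w"
proof -
  obtain m where m: "t \<in> Tuples" "m \<in> Gam" "x = mconj m (tup_x t)" "y = mconj m (tup_y t)" "v = app m (1, 0)" "w = app m (tup_w t)"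
    using assms(1) by (auto simp: Rel_def)
  obtain m' where m': "m' \<in> Gam" "x' = mconj m' (tup_x t)" "y' = mconj m' (tup_y t)" "v' = app m' (1, 0)" "w' = app m' (tup_w t)"
    using assms(2) by (auto simp: Rel_def)
  have "m' ** adj m \<in> Gam" using m m' by auto
  moreover have "x' = mconj (m' ** adj m) x" "y' = mconj (m' ** adj m) y" "v' = app (m' ** adj m) v" "w' = app (m' ** adj m) w"
    using m m' by (simp_all add: mconj_mconj[symmetric] app_mult)
  ultimately show ?thesis by blast
qed

text \<open>The content \<open>l\<close> of an eigenvector divides every combination of its
  coordinates, here 2 i, so its norm is between 1 and 4.\<close>

lemma isev_divisor:
  assumes x: "x \<in> Gam" and v: "isev x v" and pq: "p \<in> ZI" "q \<in> ZI" "app x (p, q) = smul \<i> (p, q)"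
    and ab: "a \<in> ZI" "b \<in> ZI" "a * p + b * q = 2 * \<i>"
  obtains l where "l \<in> ZI" "(p, q) = smul l v" "1 \<le> (cmod l)\<^sup>2" "(cmod l)\<^sup>2 \<le> 4"
proof -
  obtain l where l: "l \<in> ZI" "(p, q) = smul l v" using isev_unique[OF x v, of "(p, q)"] pq by auto
  obtain v1 v2 where v12: "v = (v1, v2)" by (cases v)
  have vI: "v1 \<in> ZI" "v2 \<in> ZI" using v by (auto simp: v12 isev_def)
  have "a * (l * v1) + b * (l * v2) = 2 * \<i>" using l(2) ab(3) by (simp add: v12)
  then have e: "l * (a * v1 + b * v2) = 2 * \<i>" by (simp add: algebra_simps)
  then have nz: "l \<noteq> 0" "a * v1 + b * v2 \<noteq> 0" by auto
  have "a * v1 + b * v2 \<in> ZI" using ab vI by (auto intro!: ZI_closed)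
  then have "(cmod (a * v1 + b * v2))\<^sup>2 \<ge> 1" using nz by (intro ZI_norm_ge_1)
  then have "(cmod l)\<^sup>2 * 1 \<le> (cmod l)\<^sup>2 * (cmod (a * v1 + b * v2))\<^sup>2" by (intro mult_left_mono) auto
  also have "\<dots> = (cmod (l * (a * v1 + b * v2)))\<^sup>2" by (simp add: norm_mult power_mult_distrib)
  also have "\<dots> = 4" unfolding e by (simp add: norm_mult)
  finally have "(cmod l)\<^sup>2 \<le> 4" by simp
  moreover have "1 \<le> (cmod l)\<^sup>2" using l nz by (intro ZI_norm_ge_1)
  ultimately show thesis using l that by blast
qed

text \<open>
  Changing the signs of \<open>x\<close> and \<open>y\<close> replaces \<open>s\<close> by \<open>W\<close>, \<open>Q\<close> or \<open>(Q * W + 4) / s\<close>, up to the contents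
  of the opposite eigenvectors, which divide 2.
\<close>

lemma det_norm_tuple:
  assumes t: "t \<in> Tuples" "t = (s, u, B, Q)"
  defines "W \<equiv> 2 * \<i> * u + B * s"
  shows "det_norm (tup_x t) (tup_y t) = (cmod s)\<^sup>2"
    and "det_norm (- tup_x t) (tup_y t) \<le> (cmod W)\<^sup>2" "(cmod W)\<^sup>2 \<le> 4 * det_norm (- tup_x t) (tup_y t)"
    and "det_norm (tup_x t) (- tup_y t) \<le> (cmod Q)\<^sup>2" "(cmod Q)\<^sup>2 \<le> 4 * det_norm (tup_x t) (- tup_y t)"
    and "(cmod (Q * W + 4))\<^sup>2 \<le> 16 * (cmod s)\<^sup>2 * det_norm (- tup_x t) (- tup_y t)"
proof -
  obtain n where T: "s \<in> ZI" "s \<noteq> 0" "u \<in> ZI" "B \<in> ZI" "Q \<in> ZI" "n \<in> ZI"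
    and n: "2 * \<i> - Q * u = s * n" and xm: "tup_x t = mk \<i> B 0 (- \<i>)" and ym: "tup_y t = mk (u * Q - \<i>) (u * n) (s * Q) (s * n - \<i>)"
    using Tuples_cases[OF t(1)] unfolding t(2) by (metis prod.inject)
  have sn: "s * n = 2 * \<i> - Q * u" using n by simp
  have x: "tup_x t \<in> Invol" "tup_x t \<in> Gam" "isev (tup_x t) (1, 0)" and y: "tup_y t \<in> Invol" "tup_y t \<in> Gam" "isev (tup_y t) (u, s)"
    using tup_x_tup_y[OF t(1)] by (auto simp: Invol_Gam tup_w_def t(2))
  obtain v' w' where v': "isev (- tup_x t) v'" and w': "isev (- tup_y t) w'" using x y isev_exists Invol_uminus by metis
  \<comment> \<open>The second column of x - i, an eigenvector for -\<i>; its content divides the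
    entry -2 i.\<close>
  have "app (- tup_x t) (B, - 2 * \<i>) = smul \<i> (B, - 2 * \<i>)" by (simp add: xm algebra_simps)
  then obtain l where l: "l \<in> ZI" "(B, - 2 * \<i>) = smul l v'" "1 \<le> (cmod l)\<^sup>2" "(cmod l)\<^sup>2 \<le> 4"
  proof (rule isev_divisor[OF _ v' _ _ _ ZI_simps(1), rotated 3])
    show "-1 \<in> ZI" by simp
    show "- 2 * \<i> \<in> ZI" by (auto intro: ZI_closed)
  qed (use x T in auto)
  \<comment> \<open>The vector (n, -Q) is annihilated by y + i, because both rows of y + i are
    multiples of (Q, n). Its content divides Q u + n s = 2 i.\<close>
  have "(- (u * Q - \<i>)) * n - (u * n) * (- Q) = \<i> * n" "(- (s * Q)) * n - (s * n - \<i>) * (- Q) = - (\<i> * Q)"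
    by (simp_all add: algebra_simps)
  then have "app (- tup_y t) (n, - Q) = smul \<i> (n, - Q)" by (simp add: ym algebra_simps)
  then obtain m where m: "m \<in> ZI" "(n, - Q) = smul m w'" "1 \<le> (cmod m)\<^sup>2" "(cmod m)\<^sup>2 \<le> 4"
  proof (rule isev_divisor[OF _ w' _ _ _ T(1), rotated 3])
    show "- u \<in> ZI" using T by simp
    show "s * n + - u * - Q = 2 * \<i>" unfolding sn by (simp add: mult.commute)
  qed (use y T in auto)
  show S: "det_norm (tup_x t) (tup_y t) = (cmod s)\<^sup>2" using det_norm_eq[OF x(2) y(2) x(3) y(3)] by simp
  have sc: "r \<le> c * r \<and> c * r \<le> 4 * r" if "1 \<le> c" "c \<le> 4" "r \<ge> 0" for c r :: real
    using that mult_right_mono[of 1 c r] mult_right_mono[of c 4 r] by simp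
  have "detv (B, - 2 * \<i>) (u, s) = W" by (simp add: W_def algebra_simps)
  then have "W = l * detv v' (u, s)" unfolding l(2) by simp
  then have W2: "(cmod W)\<^sup>2 = (cmod l)\<^sup>2 * det_norm (- tup_x t) (tup_y t)"
    using det_norm_eq[OF _ y(2) v' y(3)] x by (simp add: norm_mult power_mult_distrib)
  have "det_norm a b \<ge> 0" for a b by (simp add: det_norm_def)
  note sc = sc[OF _ _ this]
  show "det_norm (- tup_x t) (tup_y t) \<le> (cmod W)\<^sup>2" "(cmod W)\<^sup>2 \<le> 4 * det_norm (- tup_x t) (tup_y t)"
    unfolding W2 using sc[OF l(3,4)] by blast+
  have "detv (1, 0) (n, - Q) = - Q" by simp
  then have "- Q = m * detv (1, 0) w'" unfolding m(2) by simp
  then have "(cmod (- Q))\<^sup>2 = (cmod m)\<^sup>2 * det_norm (tup_x t) (- tup_y t)"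
    using det_norm_eq[OF x(2) _ x(3) w'] y by (simp only: Gam_uminus norm_mult power_mult_distrib)
  then have Q2: "(cmod Q)\<^sup>2 = (cmod m)\<^sup>2 * det_norm (tup_x t) (- tup_y t)" by simp
  show "det_norm (tup_x t) (- tup_y t) \<le> (cmod Q)\<^sup>2" "(cmod Q)\<^sup>2 \<le> 4 * det_norm (tup_x t) (- tup_y t)"
    unfolding Q2 using sc[OF m(3,4)] by blast+
  \<comment> \<open>Multiplying by \<open>s\<close> eliminates \<open>n\<close> through s n = 2 i -
    Q u.\<close>
  have "s * detv (B, - 2 * \<i>) (n, - Q) = - (Q * (B * s)) + 2 * \<i> * (s * n)" by (simp add: algebra_simps)
  also have "\<dots> = - (Q * W + 4)" unfolding sn W_def by (simp add: algebra_simps)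
  finally have "s * (m * (l * detv v' w')) = - (Q * W + 4)" unfolding l(2) m(2) detv_smul .
  then have "- (Q * W + 4) = s * (l * (m * detv v' w'))" by (metis mult.left_commute)
  then have "(cmod (- (Q * W + 4)))\<^sup>2 = (cmod s)\<^sup>2 * ((cmod l)\<^sup>2 * ((cmod m)\<^sup>2 * det_norm (- tup_x t) (- tup_y t)))"
    using det_norm_eq[OF _ _ v' w'] x y by (simp only: Gam_uminus norm_mult power_mult_distrib)
  then have "(cmod (Q * W + 4))\<^sup>2 = (cmod s)\<^sup>2 * ((cmod l)\<^sup>2 * ((cmod m)\<^sup>2 * det_norm (- tup_x t) (- tup_y t)))" by (metis norm_minus_cancel)
  also have "\<dots> \<le> (cmod s)\<^sup>2 * (4 * (4 * det_norm (- tup_x t) (- tup_y t)))"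
    using l m by (intro mult_left_mono mult_mono) (auto simp: det_norm_def)
  finally show "(cmod (Q * W + 4))\<^sup>2 \<le> 16 * (cmod s)\<^sup>2 * det_norm (- tup_x t) (- tup_y t)" by simp
qed

section \<open>Reversing involutions\<close>

lemma ln_powi:
  fixes x :: real
  assumes "x > 0"
  shows "ln (x powi n) = of_int n * ln x"
  using assms by (simp add: power_int_def ln_realpow ln_inverse)

text \<open>By discreteness there is an element \<open>h0\<close> of least modulus above 1, and it
  generates \<open>H\<close> up to elements of modulus 1. Those are squares up to sign, so
  \<open>H\<close> modulo squares and signs has exactly the classes of 1 and
  \<open>h0\<close>.\<close>

lemma subgroup_structure:
  fixes H :: "complex set"
  assumes one: "1 \<in> H" and mult: "\<And>g h. g \<in> H \<Longrightarrow> h \<in> H \<Longrightarrow> g * h \<in> H"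
    and inv: "\<And>h. h \<in> H \<Longrightarrow> inverse h \<in> H" and nz: "\<And>h. h \<in> H \<Longrightarrow> h \<noteq> 0"
    and fin: "\<And>K. finite {h \<in> H. cmod h \<le> K \<and> cmod (inverse h) \<le> K}"
    and ex: "\<exists>h\<in>H. cmod h \<noteq> 1"
    and unit: "\<And>h. h \<in> H \<Longrightarrow> cmod h = 1 \<Longrightarrow> \<exists>d\<in>H. h = d * d \<or> h = - (d * d)"
  obtains h0 where "h0 \<in> H" "\<And>h. h \<in> H \<Longrightarrow> \<exists>d\<in>H. \<exists>j\<in>{0, 1::nat}. h = h0 ^ j * (d * d) \<or> h = - (h0 ^ j * (d * d))"
    "\<And>d. d \<in> H \<Longrightarrow> h0 \<noteq> d * d \<and> h0 \<noteq> - (d * d)"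
proof -
  obtain h1 where h1: "h1 \<in> H" "cmod h1 > 1"
  proof -
    obtain h where h: "h \<in> H" "cmod h \<noteq> 1" using ex by blast
    have "cmod h > 0" using nz h by simp
    then have "cmod h > 1 \<or> cmod (inverse h) > 1" using h(2) by (auto simp: norm_inverse one_less_inverse_iff)
    then show thesis using that h inv by blast
  qed
  define F where "F = {h \<in> H. 1 < cmod h \<and> cmod h \<le> cmod h1}"
  have "F \<subseteq> {h \<in> H. cmod h \<le> cmod h1 \<and> cmod (inverse h) \<le> cmod h1}"
  proof
    fix h assume h: "h \<in> F"
    then have "inverse (cmod h) \<le> 1" by (auto simp: F_def intro: inverse_le_1_iff[THEN iffD2])
    then show "h \<in> {h \<in> H. cmod h \<le> cmod h1 \<and> cmod (inverse h) \<le> cmod h1}"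
      using h h1 by (auto simp: F_def norm_inverse)
  qed
  then have finF: "finite F" using fin finite_subset by blast
  have "h1 \<in> F" using h1 by (simp add: F_def)
  then have "Min (cmod ` F) \<in> cmod ` F" using finF by (intro Min_in) auto
  then obtain h0 where h0: "h0 \<in> F" "cmod h0 = Min (cmod ` F)" by auto
  have h0H: "h0 \<in> H" "1 < cmod h0" "cmod h0 \<le> cmod h1" using h0 by (auto simp: F_def)
  have min: "cmod h0 \<le> cmod h" if "h \<in> H" "1 < cmod h" for h
  proof (cases "cmod h \<le> cmod h1")
    case True
    then have "h \<in> F" using that by (simp add: F_def)
    then show ?thesis unfolding h0(2) using finF by (intro Min_le) auto
  next
    case False
    then show ?thesis using h0H by linarith
  qed
  have pw: "g ^ n \<in> H" if "g \<in> H" for g and n :: nat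
    by (induction n) (use that one mult in auto)
  have pwi: "h0 powi n \<in> H" for n :: int
    using pw[OF h0H(1)] pw[OF inv[OF h0H(1)]] by (auto simp: power_int_def)
  have h00: "h0 \<noteq> 0" using nz h0H by blast
  show thesis
  proof (rule that[OF h0H(1)])
    fix h assume h: "h \<in> H"
    \<comment> \<open>Division with remainder on logarithms: 1 <= |f| < |h0|, so |f| = 1 by
      minimality.\<close>
    define k where "k = \<lfloor>ln (cmod h) / ln (cmod h0)\<rfloor>"
    define f where "f = h * h0 powi (- k)"
    have fH: "f \<in> H" unfolding f_def by (intro mult h pwi)
    have L: "ln (cmod h0) > 0" using h0H(2) by (rule ln_gt_zero)
    have h0p: "cmod h0 > 0" and "cmod h > 0" using nz[OF h] h00 by simp_all
    have "cmod f = cmod h * cmod h0 powi (- k)" by (simp add: f_def norm_mult norm_power_int)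
    then have "ln (cmod f) = ln (cmod h) + of_int (- k) * ln (cmod h0)"
      by (simp only: ln_mult_pos[OF \<open>cmod h > 0\<close> zero_less_power_int[OF h0p]] ln_powi[OF h0p])
    then have lf: "ln (cmod f) = ln (cmod h) - of_int k * ln (cmod h0)" by simp
    have "of_int k \<le> ln (cmod h) / ln (cmod h0)" "ln (cmod h) / ln (cmod h0) < of_int k + 1"
      unfolding k_def by linarith+
    then have b: "of_int k * ln (cmod h0) \<le> ln (cmod h)" "ln (cmod h) < (of_int k + 1) * ln (cmod h0)"
      using L by (simp_all add: pos_le_divide_eq pos_divide_less_eq)
    then have "0 \<le> ln (cmod f)" "ln (cmod f) < ln (cmod h0)" unfolding lf by (simp_all add: algebra_simps)
    moreover have f0: "cmod f > 0" using nz[OF fH] by simp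
    ultimately have f1: "1 \<le> cmod f" "cmod f < cmod h0"
      using h0p by (simp_all only: ln_ge_zero_iff ln_less_cancel_iff)
    then have "cmod f = 1" using min[OF fH] by linarith
    then obtain d where d: "d \<in> H" "f = d * d \<or> f = - (d * d)" using unit[OF fH] by blast
    \<comment> \<open>Modulo squares only the parity of the exponent survives.\<close>
    define j where "j = nat (k mod 2)"
    have j: "j \<in> {0, 1}" unfolding j_def using pos_mod_bound[of 2 k] pos_mod_sign[of 2 k] by (auto simp del: pos_mod_bound pos_mod_sign)
    have kj: "k = int j + (k div 2 + k div 2)" unfolding j_def using div_mult_mod_eq[of k 2] by simp
    have "h = f * h0 powi k" using h00 by (simp add: f_def power_int_minus)
    also have "h0 powi k = h0 ^ j * (h0 powi (k div 2) * h0 powi (k div 2))"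
      by (subst kj) (simp only: power_int_add[OF disjI1[OF h00]] power_int_of_nat)
    finally have "h = h0 ^ j * ((h0 powi (k div 2) * d) * (h0 powi (k div 2) * d)) \<or>
        h = - (h0 ^ j * ((h0 powi (k div 2) * d) * (h0 powi (k div 2) * d)))"
      using d(2) by (auto simp: mult_ac)
    then show "\<exists>d\<in>H. \<exists>j\<in>{0, 1::nat}. h = h0 ^ j * (d * d) \<or> h = - (h0 ^ j * (d * d))"
      using mult[OF pwi d(1)] j by blast
  next
    fix d assume d: "d \<in> H"
    show "h0 \<noteq> d * d \<and> h0 \<noteq> - (d * d)"
    proof (rule ccontr)
      assume "\<not> ?thesis"
      \<comment> \<open>Such a \<open>d\<close> would have modulus above 1 but below that of
        \<open>h0\<close>.\<close>
      then have "cmod h0 = cmod d * cmod d" by (auto simp: norm_mult)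
      moreover have "cmod d > 1"
      proof (rule ccontr)
        assume "\<not> cmod d > 1"
        then have "cmod d * cmod d \<le> 1" by (intro mult_le_one) auto
        then show False using calculation h0H by linarith
      qed
      moreover have "cmod d * 1 < cmod d * cmod d" using calculation(2) by (intro mult_strict_left_mono) linarith+
      ultimately show False using min[OF d] by linarith
    qed
  qed
qed

text \<open>Comparing entries, the trace of \<open>X\<close> annihilates \<open>b\<close>,
  \<open>c\<close> and a - d. As \<open>A\<close> is not scalar, it is 0, so every reverser is an
  involution in PSL.\<close>

lemma reverser_trace:
  assumes A: "A \<in> Gam" and tr: "trace A \<notin> complex_of_real ` {-2..2}" and X: "X \<in> Gam" and r: "X ** A = adj A ** X"
  shows "X \<in> Invol"
proof (rule ccontr)
  assume "X \<notin> Invol"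
  obtain a b c d where m: "A = mk a b c d" and det: "a * d - b * c = 1" using A by (rule Gam_cases)
  obtain p q r' s where x: "X = mk p q r' s" using mk_cases by blast
  have nz: "p + s \<noteq> 0" using \<open>X \<notin> Invol\<close> X by (auto simp: Invol_def x)
  have e: "p * a + q * c = d * p + - b * r'" "p * b + q * d = d * q + - b * s" "r' * a + s * c = - c * p + a * r'" "r' * b + s * d = - c * q + a * s"
    using r by (simp_all add: m x)
  have "b * (p + s) = 0" by (rule eq_of_diff_multiple[OF e(2), where k = 1]) (simp add: algebra_simps)
  moreover have "c * (p + s) = 0" by (rule eq_of_diff_multiple[OF e(3), where k = 1]) (simp add: algebra_simps)
  moreover have "(a - d) * (p + s) = 0"
    by (rule eq_of_diff_combination[OF e(1) e(4), where k = 1 and k' = "-1"]) (simp add: algebra_simps)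
  ultimately have "b * (p + s) = 0" "c * (p + s) = 0" "(a - d) * (p + s) = 0" by simp_all
  then have "b = 0" "c = 0" "a = d" using nz by auto
  then have "(trace A)\<^sup>2 = 4" using det m by (simp add: power2_eq_square algebra_simps)
  then have "trace A = of_real 2 \<or> trace A = of_real (-2)" unfolding trace_sq_4_iff by simp
  then show False using tr by (metis atLeastAtMost_iff image_eqI order_refl neg_le_iff_le neg_numeral_le_numeral)
qed

lemma trace_adj: "trace (adj A) = trace A"
  by (cases A rule: mk_cases) simp

text \<open>The sign ambiguity of lifts disappears: if \<open>adj A\<close> were minus a conjugate
  of \<open>A\<close>, the trace would be 0.\<close>

lemma reversible_reverser:
  assumes A: "A \<in> Gam" and tr: "trace A \<notin> complex_of_real ` {-2..2}"
  shows "reversible (PSL2 ZI) {A, - A} \<longleftrightarrow> (\<exists>x\<in>Invol. x ** A = adj A ** x)"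
proof
  assume "reversible (PSL2 ZI) {A, - A}"
  then obtain X where X: "X \<in> Gam" "adj A = mconj X A \<or> adj A = - mconj X A" using reversible_iff[OF A] by auto
  have "adj A = mconj X A"
  proof (rule ccontr)
    assume "adj A \<noteq> mconj X A"
    then have "trace (adj A) = - trace A" using X by (simp add: trace_mconj)
    then have "trace A = of_real 0" by (simp add: trace_adj)
    then show False using tr by (metis atLeastAtMost_iff image_eqI neg_0_le_iff_le neg_le_0_iff_le zero_le_numeral)
  qed
  then have "X ** A = adj A ** X" using mconj_eq_iff[OF X(1)] by metis
  then show "\<exists>x\<in>Invol. x ** A = adj A ** x" using reverser_trace[OF A tr X(1)] by blast
next
  assume "\<exists>x\<in>Invol. x ** A = adj A ** x"
  then obtain x where x: "x \<in> Gam" "x ** A = adj A ** x" using Invol_Gam by blast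
  then have "adj A = mconj x A" using mconj_eq_iff[OF x(1)] by metis
  then show "reversible (PSL2 ZI) {A, - A}" using reversible_iff[OF A] x by blast
qed

lemma Invol_product_reverser:
  assumes x: "x \<in> Invol" and y: "y \<in> Invol" and A: "x ** y = A \<or> x ** y = - A"
  shows "x ** A = adj A ** x"
proof -
  have "x ** (x ** y) = - y" using Invol_sq[OF x] by (simp add: matrix_mul_assoc mat_uminus_mult)
  moreover have "adj (x ** y) ** x = - y"
    by (simp add: adj_mult Invol_adj[OF x] Invol_adj[OF y] mat_uminus_mult matrix_mul_assoc[symmetric] Invol_sq[OF x])
  ultimately have "x ** (x ** y) = adj (x ** y) ** x" by simp
  moreover from A have "A = x ** y \<or> A = - (x ** y)" by auto
  ultimately show ?thesis by (auto simp: mat_uminus_mult)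
qed

lemma prim_nonzero: "prim v \<Longrightarrow> smul l v = smul m v \<Longrightarrow> l = m"
  by (cases v) (auto simp: gcop_def)

text \<open>The characteristic polynomial at \<open>e\<close> kills both coordinates of
  \<open>v\<close>, and the Bezout identity for \<open>v\<close> removes them.\<close>

lemma eigenvalue_trace:
  assumes A: "A \<in> Gam" and v: "prim v" and e: "app A v = smul e v"
  shows "e * trace A = e * e + 1"
proof -
  obtain a b c d where m: "A = mk a b c d" and det: "a * d - b * c = 1" using A by (rule Gam_cases)
  obtain p q where pq: "v = (p, q)" by (cases v)
  obtain x y where xy: "x * p + y * q = 1" using v by (auto simp: pq gcop_def)
  have 1: "a * p + b * q = e * p" "c * p + d * q = e * q" using e by (simp_all add: m pq)
  have 2: "p * (a * d - b * c - e * (a + d) + e * e) = 0"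
    by (rule eq_of_diff_combination[OF 1, where k = "d - e" and k' = "- b"]) (simp add: algebra_simps)
  have 3: "q * (a * d - b * c - e * (a + d) + e * e) = 0"
    by (rule eq_of_diff_combination[OF 1, where k = "- c" and k' = "a - e"]) (simp add: algebra_simps)
  have "(x * p + y * q) * (1 - e * (a + d) + e * e) = 0"
    by (rule eq_of_diff_combination[OF 2 3, where k = x and k' = y]) (simp only: det, simp add: algebra_simps)
  then show ?thesis unfolding xy by (simp add: m algebra_simps)
qed

section \<open>The centralizer of a reversible element\<close>

text \<open>
  The centralizer of \<open>A\<close> is parametrised by the eigenvalue \<open>h\<close>: \<open>D h\<close> is the polynomial in \<open>A\<close> with
  eigenvalues \<open>h\<close> and \<open>inverse h\<close>, and \<open>x0\<close> is a fixed involution inverting \<open>A\<close>.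
\<close>

locale rev_lox =
  fixes A x0 :: "complex^2^2" and a b c d :: complex
  assumes Am: "A = mk a b c d" and A: "A \<in> Gam" and tr: "trace A \<notin> complex_of_real ` {-2..2}"
    and x0: "x0 \<in> Invol" and rev: "x0 ** A = adj A ** x0"
begin

definition mu where "mu = a + d"
definition lam where "lam = (mu + csqrt (mu\<^sup>2 - 4)) / 2"
text \<open>The difference of the two eigenvalues \<open>lam\<close> and
  \<open>mu - lam\<close>.\<close>

definition dl where "dl = 2 * lam - mu"

lemma det: "a * d - b * c = 1" using A unfolding Am by simp

lemma mu: "mu = a + d" by (rule mu_def)

lemma mu_trace: "trace A = mu" by (simp add: mu_def Am)

lemma real_trace: "\<bar>x\<bar> \<le> 2 \<Longrightarrow> mu \<noteq> of_real x"
  using tr by (auto simp: mu_trace abs_le_iff)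

lemma mu_sq: "mu\<^sup>2 \<noteq> 4"
  using real_trace[of 2] real_trace[of "-2"] by (simp add: trace_sq_4_iff)

lemma nonscalar: "\<not> (b = 0 \<and> c = 0 \<and> a = d)"
proof
  assume "b = 0 \<and> c = 0 \<and> a = d"
  then have "(a + d)\<^sup>2 = 4" using det by (auto simp: power2_eq_square algebra_simps)
  then show False using mu_sq unfolding mu_def by simp
qed

lemma dl_sq: "dl * dl = mu\<^sup>2 - 4"
proof -
  have "dl = csqrt (mu\<^sup>2 - 4)" by (simp add: dl_def lam_def field_simps)
  then show ?thesis by (metis power2_csqrt power2_eq_square)
qed

lemma dl_nz: "dl \<noteq> 0" using dl_sq mu_sq by auto

lemma lam_eq: "lam * lam = mu * lam - 1"
  by (rule eq_of_diff_multiple[OF dl_sq, where k = "1 / 4"]) (simp add: dl_def power2_eq_square field_simps)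

lemma lam_inv: "lam * (mu - lam) = 1" "lam \<noteq> 0" "inverse lam = mu - lam"
proof -
  show e: "lam * (mu - lam) = 1" using lam_eq by (simp add: algebra_simps)
  then show "lam \<noteq> 0" by auto
  then show "inverse lam = mu - lam" using e by (metis inverse_unique)
qed

definition DD :: "complex \<Rightarrow> complex \<Rightarrow> complex^2^2" where
  "DD \<alpha> \<beta> = mk (\<alpha> + \<beta> * a) (\<beta> * b) (\<beta> * c) (\<alpha> + \<beta> * d)"

text \<open>Interpolation: the polynomial with coefficients \<open>al h\<close> and
  \<open>be h\<close> takes the value \<open>h\<close> at \<open>lam\<close> and
  \<open>inverse h\<close> at \<open>inverse lam\<close>.\<close>

definition be where "be h = (h - inverse h) / dl"
definition al where "al h = h - be h * lam"
definition D where "D h = DD (al h) (be h)"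

lemma al_be: "al h + be h * lam = h" "al h + be h * (mu - lam) = inverse h"
proof -
  show "al h + be h * lam = h" by (simp add: al_def)
  have "be h * dl = h - inverse h" using dl_nz by (simp add: be_def)
  then show "al h + be h * (mu - lam) = inverse h" by (simp add: al_def dl_def algebra_simps)
qed

lemma al_be_unique:
  assumes "\<alpha> + \<beta> * lam = h" "\<alpha> + \<beta> * (mu - lam) = inverse h"
  shows "\<alpha> = al h" "\<beta> = be h"
proof -
  have "\<beta> * dl = h - inverse h"
    by (rule eq_of_diff_combination[OF assms, where k = 1 and k' = "-1"]) (simp add: dl_def algebra_simps)
  then show "\<beta> = be h" using dl_nz by (simp add: be_def eq_divide_eq)
  then show "\<alpha> = al h" using assms(1) by (simp add: al_def algebra_simps)
qed

text \<open>Multiplication of linear polynomials in \<open>A\<close>, reduced by Cayley-Hamilton: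
  A^2 = mu A - 1.\<close>

lemma DD_mult: "DD \<alpha> \<beta> ** DD \<alpha>' \<beta>' = DD (\<alpha> * \<alpha>' - \<beta> * \<beta>') (\<alpha> * \<beta>' + \<alpha>' * \<beta> + mu * \<beta> * \<beta>')"
proof -
  have bc: "b * c = a * d - 1" using det by (simp add: algebra_simps)
  have 1: "\<beta> * b * (\<beta>' * c) = \<beta> * \<beta>' * (b * c)" "\<beta> * c * (\<beta>' * b) = \<beta> * \<beta>' * (b * c)" by (simp_all add: mult_ac)
  show ?thesis unfolding DD_def mk_mult mk_eq_iff 1 bc mu by (simp add: algebra_simps)
qed

lemma D_mult:
  assumes "g \<noteq> 0" "h \<noteq> 0"
  shows "D g ** D h = D (g * h)"
proof -
  let ?\<alpha> = "al g * al h - be g * be h" and ?\<beta> = "al g * be h + al h * be g + mu * be g * be h"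
  have *: "?\<alpha> + ?\<beta> * l = (al g + be g * l) * (al h + be h * l)" if l: "l * l = mu * l - 1" for l
    by (rule eq_of_diff_multiple[OF l, where k = "- (be g * be h)"]) (simp add: algebra_simps)
  have "(mu - lam) * (mu - lam) = mu * (mu - lam) - 1"
    by (rule eq_of_diff_multiple[OF lam_eq, where k = 1]) (simp add: algebra_simps)
  note *[OF lam_eq] *[OF this]
  then have "?\<alpha> = al (g * h)" "?\<beta> = be (g * h)"
    by (intro al_be_unique; simp add: al_be)+
  then show ?thesis by (simp add: D_def DD_mult)
qed

lemma D_one: "D 1 = mat 1"
proof -
  have "al 1 = 1" "be 1 = 0" by (simp_all add: al_def be_def)
  then show ?thesis by (simp add: D_def DD_def mat1_mk)
qed

lemma D_lam: "D lam = A"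
proof -
  have "al lam = 0" "be lam = 1" using al_be_unique[of 0 1 lam] lam_inv(3) by simp_all
  then show ?thesis by (simp add: D_def DD_def Am)
qed

lemma D_uminus: "D (- h) = - D h"
proof -
  have "be (- h) = - be h" by (simp add: be_def diff_divide_distrib)
  moreover have "al (- h) = - al h" unfolding al_def calculation by simp
  ultimately show ?thesis by (simp add: D_def DD_def)
qed

lemma D_inverse: "D (inverse h) = adj (D h)"
proof -
  have "al h + be h * mu + (- be h) * lam = inverse h"
    by (rule eq_of_diff_multiple[OF al_be(2), where k = 1]) (simp add: algebra_simps)
  moreover have "al h + be h * mu + (- be h) * (mu - lam) = inverse (inverse h)"
    unfolding inverse_inverse_eq by (rule eq_of_diff_multiple[OF al_be(1), where k = 1]) (simp add: algebra_simps)
  ultimately have e: "al (inverse h) = al h + be h * mu" "be (inverse h) = - be h"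
    using al_be_unique[of "al h + be h * mu" "- be h" "inverse h"] by simp_all
  show ?thesis unfolding D_def e by (simp add: DD_def mu algebra_simps)
qed

lemma trace_D: "trace (D h) = h + inverse h"
proof -
  have "trace (D h) = (al h + be h * lam) + (al h + be h * (mu - lam))"
    by (simp add: D_def DD_def mu algebra_simps)
  then show ?thesis by (simp add: al_be)
qed

lemma D_inj:
  assumes "D g = D h"
  shows "g = h"
proof -
  have e: "al g + be g * a = al h + be h * a" "be g * b = be h * b" "be g * c = be h * c" "al g + be g * d = al h + be h * d"
    using assms by (simp_all add: D_def DD_def)
  have "(be g - be h) * (a - d) = 0"
    by (rule eq_of_diff_combination[OF e(1) e(4), where k = 1 and k' = "-1"]) (simp add: algebra_simps)
  moreover have "(be g - be h) * b = 0" "(be g - be h) * c = 0" using e by (simp_all add: left_diff_distrib)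
  ultimately have "be g = be h" using nonscalar by auto
  moreover have "al g = al h" using e(1) calculation by simp
  ultimately show ?thesis using al_be(1) by metis
qed

lemma D_commute: "D h ** A = A ** D h"
proof (cases "h = 0")
  case False
  then have "D h ** D lam = D lam ** D h" using lam_inv by (simp add: D_mult mult.commute)
  then show ?thesis by (simp add: D_lam)
qed (use DD_mult[of "al 0" "be 0" 0 1] DD_mult[of 0 1 "al 0" "be 0"] in
  \<open>simp add: D_def DD_def[of 0 1] Am mult_ac add_ac\<close>)

definition H :: "complex set" where "H = {h. h \<noteq> 0 \<and> D h \<in> Gam}"

text \<open>A matrix commuting with the nonscalar \<open>A\<close> is a polynomial in
  \<open>A\<close>; determinant 1 makes its eigenvalues mutually inverse.\<close>

lemma commutant:
  assumes g: "g \<in> Gam" and com: "g ** A = A ** g"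
  obtains h where "h \<in> H" "g = D h"
proof -
  obtain p q r s where gm: "g = mk p q r s" and gdet: "p * s - q * r = 1" using g by (rule Gam_cases)
  have e: "p * a + q * c = a * p + b * r" "p * b + q * d = a * q + b * s" "r * a + s * c = c * p + d * r" "r * b + s * d = c * q + d * s"
    using com by (simp_all add: gm Am)
  have f: "q * c = b * r" "q * (a - d) = b * (p - s)" "r * (a - d) = c * (p - s)"
    by (rule eq_of_diff_multiple[OF e(1), where k = 1], simp add: algebra_simps)
       (rule eq_of_diff_multiple[OF e(2), where k = "-1"], simp add: algebra_simps,
        rule eq_of_diff_multiple[OF e(3), where k = 1], simp add: algebra_simps)
  \<comment> \<open>The trace-free parts of \<open>g\<close> and \<open>A\<close> are proportional;
    the ratio is read off at a nonzero coordinate of that of \<open>A\<close>.\<close>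
  obtain \<beta> where \<beta>: "q = \<beta> * b" "r = \<beta> * c" "p - s = \<beta> * (a - d)"
  proof -
    consider "b \<noteq> 0" | "c \<noteq> 0" | "a - d \<noteq> 0" using nonscalar by auto
    then show thesis
    proof cases
      case 1
      then show thesis using f by (intro that[of "q / b"]) (simp_all add: eq_divide_eq mult_ac)
    next
      case 2
      then show thesis using f by (intro that[of "r / c"]) (simp_all add: eq_divide_eq mult_ac)
    next
      case 3
      then show thesis using f by (intro that[of "(p - s) / (a - d)"]) (simp_all add: eq_divide_eq mult_ac)
    qed
  qed
  define \<alpha> where "\<alpha> = p - \<beta> * a"
  have gD: "g = DD \<alpha> \<beta>" using \<beta> by (simp add: gm DD_def \<alpha>_def algebra_simps)
  define h where "h = \<alpha> + \<beta> * lam"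
  have "(\<alpha> + \<beta> * lam) * (\<alpha> + \<beta> * (mu - lam)) = (\<alpha> + \<beta> * a) * (\<alpha> + \<beta> * d) - \<beta> * \<beta> * (a * d - 1)"
    by (rule eq_of_diff_multiple[OF lam_inv(1), where k = "\<beta> * \<beta>"]) (simp add: mu algebra_simps)
  also have "a * d - 1 = b * c" using det by (simp add: algebra_simps)
  also have "(\<alpha> + \<beta> * a) * (\<alpha> + \<beta> * d) - \<beta> * \<beta> * (b * c) = det g" by (simp add: gD DD_def mult_ac)
  also have "det g = 1" using g by (rule det_Gam)
  finally have h1: "h * (\<alpha> + \<beta> * (mu - lam)) = 1" by (simp add: h_def)
  then have "\<alpha> + \<beta> * (mu - lam) = inverse h" by (metis inverse_unique)
  then have "\<alpha> = al h" "\<beta> = be h" by (intro al_be_unique; simp add: h_def)+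
  then have "g = D h" by (simp add: gD D_def)
  moreover have "h \<noteq> 0" using h1 by auto
  ultimately show thesis using that g by (auto simp: H_def)
qed

lemma H_one: "1 \<in> H" by (simp add: H_def D_one)
lemma H_mult: "g \<in> H \<Longrightarrow> h \<in> H \<Longrightarrow> g * h \<in> H" by (auto simp: H_def D_mult[symmetric])
lemma H_inverse: "h \<in> H \<Longrightarrow> inverse h \<in> H" by (simp add: H_def D_inverse)
lemma H_nz: "h \<in> H \<Longrightarrow> h \<noteq> 0" by (simp add: H_def)
lemma H_uminus: "- h \<in> H \<longleftrightarrow> h \<in> H" by (simp add: H_def D_uminus)
lemma H_Gam: "h \<in> H \<Longrightarrow> D h \<in> Gam" by (simp add: H_def)
lemma H_lam: "lam \<in> H" using lam_inv A by (simp add: H_def D_lam)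
lemma H_power: "h \<in> H \<Longrightarrow> h ^ n \<in> H" for n :: nat
  by (induction n) (auto simp: H_one H_mult)

lemma trace_ZI: "g \<in> Gam \<Longrightarrow> trace g \<in> ZI"
  by (erule Gam_cases) auto

text \<open>The trace \<open>h + inverse h\<close> is a Gaussian integer in a bounded disc and
  determines \<open>h\<close> up to inversion.\<close>

lemma finite_H: "finite {h \<in> H. cmod h \<le> K \<and> cmod (inverse h) \<le> K}"
proof -
  have "{h \<in> H. cmod h \<le> K \<and> cmod (inverse h) \<le> K} \<subseteq>
    (\<Union>z\<in>{z \<in> ZI. (cmod z)\<^sup>2 \<le> (2 * K)\<^sup>2}. {(z + csqrt (z\<^sup>2 - 4)) / 2, (z - csqrt (z\<^sup>2 - 4)) / 2})"
  proof
    fix h assume h: "h \<in> {h \<in> H. cmod h \<le> K \<and> cmod (inverse h) \<le> K}"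
    define z where "z = h + inverse h"
    have "z \<in> ZI" using trace_ZI[OF H_Gam] h by (simp add: z_def trace_D[symmetric])
    moreover have "cmod z \<le> 2 * K" using h norm_triangle_ineq[of h "inverse h"] by (simp add: z_def)
    then have "(cmod z)\<^sup>2 \<le> (2 * K)\<^sup>2" by (intro power_mono) auto
    moreover have "h = (z + csqrt (z\<^sup>2 - 4)) / 2 \<or> h = (z - csqrt (z\<^sup>2 - 4)) / 2"
    proof -
      have "h * inverse h = 1" using h H_nz by simp
      then have "(2 * h - z)\<^sup>2 = z\<^sup>2 - 4"
        by (rule eq_of_diff_multiple[where k = "-4"]) (simp add: z_def power2_eq_square algebra_simps)
      then have "(2 * h - z)\<^sup>2 = (csqrt (z\<^sup>2 - 4))\<^sup>2" by simp
      then have "2 * h - z = csqrt (z\<^sup>2 - 4) \<or> 2 * h - z = - csqrt (z\<^sup>2 - 4)" by (simp only: power2_eq_iff)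
      then show ?thesis by (auto simp: field_simps)
    qed
    ultimately show "h \<in> (\<Union>z\<in>{z \<in> ZI. (cmod z)\<^sup>2 \<le> (2 * K)\<^sup>2}. {(z + csqrt (z\<^sup>2 - 4)) / 2, (z - csqrt (z\<^sup>2 - 4)) / 2})" by blast
  qed
  then show ?thesis by (rule finite_subset) (auto simp: finite_ZI_ball)
qed

lemma unit_inverse: "cmod h = 1 \<Longrightarrow> inverse h = cnj h"
  using complex_norm_square[of h] by (metis inverse_unique of_real_1 one_power2)

lemma norm_lam: "cmod lam \<noteq> 1"
proof
  assume l: "cmod lam = 1"
  have "mu = lam + inverse lam" unfolding lam_inv(3) by simp
  also have "\<dots> = of_real (2 * Re lam)" unfolding unit_inverse[OF l] by (simp add: complex_add_cnj)
  finally have "mu = of_real (2 * Re lam)" .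
  moreover have "\<bar>2 * Re lam\<bar> \<le> 2" using abs_Re_le_cmod[of lam] l by simp
  ultimately show False using real_trace by blast
qed

text \<open>
  An involution commuting with \<open>A\<close> would make the eigenvectors of \<open>A\<close> Gaussian and its eigenvalues units.
\<close>

lemma i_notin_H: "\<i> \<notin> H"
proof
  assume i: "\<i> \<in> H"
  let ?g = "D \<i>"
  have g: "?g \<in> Gam" "trace ?g = 0" using H_Gam[OF i] by (simp_all add: trace_D)
  then have "?g \<in> Invol" by (simp add: Invol_def)
  then obtain v where v: "isev ?g v" using isev_exists by blast
  have pv: "prim v" using v by (simp add: isev_def)
  have com: "app ?g (app B v) = smul \<i> (app B v)" if "?g ** B = B ** ?g" for B
    using v by (simp add: app_mult[symmetric] that) (simp add: app_mult isev_def app_smul)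
  have ev: "\<exists>l\<in>ZI. app B v = smul l v" if "B \<in> Gam" "?g ** B = B ** ?g" for B
    using isev_unique[OF g(1) v _ _ com[OF that(2)]] prim_app[OF that(1) pv] by (metis prim_def)
  \<comment> \<open>\<open>A\<close> and \<open>adj A\<close> preserve the line of \<open>v\<close>
    and act on it by Gaussian integers with product 1.\<close>
  obtain l where l: "l \<in> ZI" "app A v = smul l v" using ev[OF A D_commute] by blast
  have "?g ** adj A = adj A ** ?g"
    using D_mult[of \<i> "inverse lam"] D_mult[of "inverse lam" \<i>] lam_inv(2) by (simp add: D_inverse D_lam mult.commute)
  then obtain m where m: "m \<in> ZI" "app (adj A) v = smul m v" using ev[of "adj A"] A by blast
  have "app (adj A) (app A v) = smul (l * m) v" by (simp add: l m app_smul)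
  then have "smul 1 v = smul (l * m) v" using A by simp
  then have "l * m = 1" using prim_nonzero[OF pv] by metis
  then have lu: "l \<in> gunits" using ZI_unit_mult l m by blast
  have e: "l * mu = l * l + 1" using eigenvalue_trace[OF A pv l(2)] by (simp add: mu_trace)
  from lu consider "l = 1" | "l = -1" | "l = \<i>" | "l = - \<i>" by (auto simp: gunits_def)
  then show False
  proof cases
    case 1 then show False using e real_trace[of 2] by simp
  next
    case 2 then have "- mu = 2" using e by simp
    then have "mu = - 2" by (metis minus_minus)
    then show False using real_trace[of "-2"] by simp
  next
    case 3 then show False using e real_trace[of 0] by simp
  next
    case 4 then show False using e real_trace[of 0] by simp
  qed
qed

lemma H_no_i: "h \<in> H \<Longrightarrow> h * h \<noteq> -1"
proof
  assume h: "h \<in> H" and "h * h = -1"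
  then have "(h - \<i>) * (h + \<i>) = 0" by (simp add: algebra_simps)
  then have "h = \<i> \<or> h = - \<i>" by (auto simp: eq_neg_iff_add_eq_0)
  then show False using h i_notin_H H_uminus[of \<i>] by auto
qed

text \<open>The trace of \<open>D h\<close> is a rational integer of size at most 2, so
  \<open>h\<close> is a root of unity of order 1, 2, 3, 4 or 6. Order 4 is excluded by
  \<open>H_no_i\<close>; for order 3 and 6 one has h = h^4 and h = -h^4.\<close>

lemma H_unit_square:
  assumes h: "h \<in> H" "cmod h = 1"
  shows "\<exists>g\<in>H. h = g * g \<or> h = - (g * g)"
proof -
  have "h + inverse h \<in> ZI" using trace_ZI[OF H_Gam[OF h(1)]] by (simp add: trace_D)
  then obtain m n where "h + inverse h = Complex (of_int m) (of_int n)" by (rule ZI_cases)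
  then have m: "2 * Re h = of_int m" unfolding unit_inverse[OF h(2)] by (simp add: complex_eq_iff)
  have tr: "h + inverse h = of_int m" unfolding unit_inverse[OF h(2)] using m by (simp add: complex_eq_iff)
  have "h * inverse h = 1" using H_nz[OF h(1)] by simp
  then have q: "h * h = of_int m * h - 1"
    by (rule eq_of_diff_combination[OF tr, where k = h and k' = "-1"]) (simp add: algebra_simps)
  have "\<bar>of_int m\<bar> \<le> (2::real)" using abs_Re_le_cmod[of h] h(2) m by linarith
  then have "\<bar>m\<bar> \<le> 2" by linarith
  then consider "m = 2" | "m = 1" | "m = 0" | "m = -1" | "m = -2" by linarith
  then show ?thesis
  proof cases
    case 1
    then have "(h - 1) * (h - 1) = 0" using q by (simp add: algebra_simps)
    then have "h = 1 * 1" by simp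
    then show ?thesis using H_one by blast
  next
    case 2
    then have "h * h = h - 1" using q by simp
    then have "h = - ((h * h) * (h * h))"
      by (rule eq_of_diff_multiple[where k = "h * h + h"]) (simp add: algebra_simps)
    then show ?thesis using H_mult[OF h(1) h(1)] by blast
  next
    case 3
    then have "h * h = -1" using q by simp
    then show ?thesis using H_no_i[OF h(1)] by simp
  next
    case 4
    then have "h * h = - h - 1" using q by simp
    then have "h = (h * h) * (h * h)"
      by (rule eq_of_diff_multiple[where k = "h - h * h"]) (simp add: algebra_simps)
    then show ?thesis using H_mult[OF h(1) h(1)] by blast
  next
    case 5
    have "(h + 1) * (h + 1) = 0" by (rule eq_of_diff_multiple[OF q, where k = 1]) (simp add: 5 algebra_simps)
    then have "h = - (1 * 1)" by (simp add: eq_neg_iff_add_eq_0)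
    then show ?thesis using H_one by blast
  qed
qed

text \<open>The relation is linear in \<open>A\<close> because \<open>adj\<close> is, so it passes
  to every linear polynomial in \<open>A\<close>.\<close>

lemma reverser_D:
  assumes x: "x ** A = adj A ** x"
  shows "x ** D h = adj (D h) ** x"
proof -
  obtain p q r s where xm: "x = mk p q r s" by (rule mk_cases)
  have e: "p * a + q * c = d * p + - b * r" "p * b + q * d = d * q + - b * s" "r * a + s * c = - c * p + a * r" "r * b + s * d = - c * q + a * s"
    using x by (simp_all add: xm Am)
  have "p * (al h + be h * a) + q * (be h * c) = (al h + be h * d) * p + - (be h * b) * r"
    "p * (be h * b) + q * (al h + be h * d) = (al h + be h * d) * q + - (be h * b) * s"
    "r * (al h + be h * a) + s * (be h * c) = - (be h * c) * p + (al h + be h * a) * r"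
    "r * (be h * b) + s * (al h + be h * d) = - (be h * c) * q + (al h + be h * a) * s"
    by (rule eq_of_diff_multiple[OF e(1), where k = "be h"], simp add: algebra_simps)
       (rule eq_of_diff_multiple[OF e(2), where k = "be h"], simp add: algebra_simps,
        rule eq_of_diff_multiple[OF e(3), where k = "be h"], simp add: algebra_simps,
        rule eq_of_diff_multiple[OF e(4), where k = "be h"], simp add: algebra_simps)
  then show ?thesis by (simp add: xm D_def DD_def)
qed

end

section \<open>Fibres of the tuple map\<close>

definition signs :: "complex^2^2 \<Rightarrow> complex^2^2 \<Rightarrow> ((complex^2^2) \<times> (complex^2^2)) set" where
  "signs x y = {(x, y), (- x, y), (x, - y), (- x, - y)}"

lemma signs_min: "\<exists>p\<in>signs x y. \<forall>q\<in>signs x y. det_norm (fst p) (snd p) \<le> det_norm (fst q) (snd q)"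
proof -
  let ?f = "\<lambda>p. det_norm (fst p) (snd p)"
  have fin: "finite (signs x y)" by (simp add: signs_def)
  have "Min (?f ` signs x y) \<in> ?f ` signs x y" using fin by (intro Min_in) (auto simp: signs_def)
  then obtain p where p: "p \<in> signs x y" "?f p = Min (?f ` signs x y)" by auto
  have "?f p \<le> ?f q" if "q \<in> signs x y" for q
    unfolding p(2) using fin that by (intro Min_le) auto
  then show ?thesis using p(1) by blast
qed

lemma signs_sym: "(X, Y) \<in> signs x y \<Longrightarrow> signs X Y = signs x y"
  by (auto simp: signs_def)

text \<open>Minimality with ties allowed; \<open>strict_tuple\<close> excludes ties. A class has at
  least 16 tuples of the first kind and at most 16 of the second, which gives the two sides of the
  squeeze.\<close>

definition min_tuple where
  "min_tuple t \<longleftrightarrow> (\<forall>(x, y)\<in>signs (tup_x t) (tup_y t). det_norm (tup_x t) (tup_y t) \<le> det_norm x y)"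

definition strict_tuple where
  "strict_tuple t \<longleftrightarrow> det_norm (tup_x t) (tup_y t) < det_norm (- tup_x t) (tup_y t) \<and> det_norm (tup_x t) (tup_y t) < det_norm (tup_x t) (- tup_y t) \<and>
     det_norm (tup_x t) (tup_y t) < det_norm (- tup_x t) (- tup_y t)"

abbreviation tup_class where "tup_class t \<equiv> mat_class (tup_x t ** tup_y t)"

context rev_lox
begin

lemma H_structure:
  obtains h0 where "h0 \<in> H" "\<And>h. h \<in> H \<Longrightarrow> \<exists>g\<in>H. \<exists>j\<in>{0, 1::nat}. h = h0 ^ j * (g * g) \<or> h = - (h0 ^ j * (g * g))"
    "\<And>g. g \<in> H \<Longrightarrow> h0 \<noteq> g * g \<and> h0 \<noteq> - (g * g)"
proof (rule subgroup_structure[of H])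
  show "\<exists>h\<in>H. cmod h \<noteq> 1" using H_lam norm_lam by blast
qed (use that in \<open>auto simp: H_one H_mult H_inverse finite_H H_nz intro: H_unit_square\<close>)

text \<open>A common \<i>-eigenvector of \<open>x\<close> and \<open>y\<close> would have eigenvalue
  -1 under the product, so \<open>A\<close> would have trace 2 or -2.\<close>

lemma detv_nonzero:
  assumes x: "x \<in> Invol" and y: "y \<in> Invol" and xy: "x ** y = A \<or> x ** y = - A" and v: "isev x v" and w: "isev y w"
  shows "detv v w \<noteq> 0"
proof
  assume "detv v w = 0"
  then obtain l where l: "w = smul l v" using detv_zero[of v w] v w by (auto simp: isev_def prim_def)
  have l0: "l \<noteq> 0" using l w by (cases v) (auto simp: isev_def gcop_def)
  have "smul l (app y v) = smul l (smul \<i> v)" using w unfolding l by (simp add: isev_def app_smul mult.commute)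
  then have "app y v = smul \<i> v" using l0 by (simp only: smul_cancel simp_thms)
  then have xyv: "app (x ** y) v = smul (-1) v" using v by (simp add: app_mult app_smul isev_def)
  from xy have "app A v = smul (-1) v \<or> app A v = smul 1 v"
  proof
    assume "x ** y = - A"
    then have "smul (-1) (app A v) = smul (-1) v" using xyv by simp
    then show ?thesis by (simp add: smul_cancel)
  qed (use xyv in simp)
  then have "- 1 * mu = - 1 * - 1 + 1 \<or> 1 * mu = 1 * 1 + 1"
    using eigenvalue_trace[OF A, of v] v unfolding mu_trace isev_def by blast
  then have "mu = - 2 \<or> mu = 2" by (auto simp: minus_equation_iff)
  then show False using real_trace[of 2] real_trace[of "-2"] by auto
qed

text \<open>Conjugation by the centralizer changes a reverser by a square; hence reversers are
  classified by \<open>H\<close> modulo squares.\<close>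

lemma conj_D:
  assumes x: "x ** A = adj A ** x"
  shows "mconj (D h) x = x ** D (inverse h) ** D (inverse h)"
proof -
  have "x ** D (inverse h) = D h ** x" using reverser_D[OF x, of "inverse h"] by (simp add: D_inverse)
  then show ?thesis by (simp add: mconj_def D_inverse[symmetric])
qed

lemma conj_A_neq: "k \<in> Gam \<Longrightarrow> mconj k A \<noteq> - A"
proof
  assume "k \<in> Gam" "mconj k A = - A"
  then have "trace A = - trace A" by (metis trace_mconj trace_uminus2)
  then have "mu = of_real 0" by (simp add: mu_trace)
  then show False using real_trace[of 0] by simp
qed

text \<open>
  Sixteen is two classes of reversers modulo squares of the centralizer and signs, times four units
  for each of the eigenvectors, divided by the action of \<open>- 1\<close>. Each class contributes the sign
  choices of smallest determinant, which are unique for a strict tuple.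
\<close>

lemma fibre:
  obtains F where "finite F" "card F = 16" "F \<subseteq> {t \<in> Tuples. tup_class t = mat_class A \<and> min_tuple t}"
    "{t \<in> Tuples. tup_class t = mat_class A \<and> strict_tuple t} \<subseteq> F"
proof -
  obtain h0 where h0: "h0 \<in> H" and gen: "\<And>h. h \<in> H \<Longrightarrow> \<exists>g\<in>H. \<exists>j\<in>{0, 1::nat}. h = h0 ^ j * (g * g) \<or> h = - (h0 ^ j * (g * g))"
    and nsq: "\<And>g. g \<in> H \<Longrightarrow> h0 \<noteq> g * g \<and> h0 \<noteq> - (g * g)"
    by (rule H_structure) blast
  \<comment> \<open>The two classes of reversers are represented by \<open>x0\<close> and
    \<open>x0 ** D h0\<close>; the partner \<open>yj\<close> is forced by xj^2 = -1 and xj yj =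
    A.\<close>
  define xj where "xj j = x0 ** D (h0 ^ j)" for j :: nat
  define yj where "yj j = - (xj j ** A)" for j
  have pw: "h0 ^ j \<in> H" for j :: nat by (rule H_power[OF h0])
  have xrev: "xj j ** A = adj A ** xj j" for j
    unfolding xj_def by (metis D_commute matrix_mul_assoc rev)
  have xG: "xj j \<in> Gam" for j unfolding xj_def using x0 H_Gam[OF pw] by (auto simp: Invol_Gam)
  have xI: "xj j \<in> Invol" for j by (rule reverser_trace[OF A tr xG xrev])
  have "(xj j ** A) ** A = adj A ** (xj j ** A)" for j by (metis xrev matrix_mul_assoc)
  then have yI: "yj j \<in> Invol" for j
    unfolding yj_def Invol_uminus by (intro reverser_trace[OF A tr]) (auto simp: xG A)
  have xyA: "xj j ** yj j = A" for j
    by (simp add: yj_def mat_uminus_mult matrix_mul_assoc Invol_sq[OF xI])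
  have "\<forall>j. \<exists>p. p \<in> signs (xj j) (yj j) \<and> (\<forall>q\<in>signs (xj j) (yj j). det_norm (fst p) (snd p) \<le> det_norm (fst q) (snd q))"
    using signs_min by blast
  then obtain XY where XY: "\<And>j. XY j \<in> signs (xj j) (yj j)"
    "\<And>j q. q \<in> signs (xj j) (yj j) \<Longrightarrow> det_norm (fst (XY j)) (snd (XY j)) \<le> det_norm (fst q) (snd q)"
    by metis
  define X Y where "X j = fst (XY j)" and "Y j = snd (XY j)" for j
  have sXY: "(X j, Y j) \<in> signs (xj j) (yj j)" for j using XY(1)[of j] by (simp add: X_def Y_def)
  have minXY: "det_norm (X j) (Y j) \<le> det_norm x y" if "(x, y) \<in> signs (xj j) (yj j)" for j x y
    using XY(2)[OF that] by (simp add: X_def Y_def)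
  have Xx: "X j = xj j \<or> X j = - xj j" and Yy: "Y j = yj j \<or> Y j = - yj j" for j
    using sXY[of j] by (auto simp: signs_def)
  have XI: "X j \<in> Invol" and YI: "Y j \<in> Invol" for j
    using Xx[of j] Yy[of j] xI[of j] yI[of j] by (metis Invol_uminus)+
  have XYA: "X j ** Y j = A \<or> X j ** Y j = - A" for j
    using Xx[of j] Yy[of j] xyA[of j] by (auto simp: mat_uminus_mult)
  obtain V W where V: "\<And>j. isev (X j) (V j)" and W: "\<And>j. isev (Y j) (W j)"
    using isev_exists[OF XI] isev_exists[OF YI] by metis
  \<comment> \<open>The units in the first slot are taken modulo -1: the matrix -1 conjugates
    trivially but negates both eigenvectors.\<close>
  define I where "I = {0, 1::nat} \<times> {1, \<i>} \<times> gunits"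
  define f where "f = (\<lambda>(j, e, n). SOME t. Rel (X j, Y j, smul e (V j), smul n (W j)) t)"
  have Rf: "Rel (X j, Y j, smul e (V j), smul n (W j)) (f (j, e, n))" if "e \<in> gunits" "n \<in> gunits" for j e n
  proof -
    have ev: "isev (X j) (smul e (V j))" "isev (Y j) (smul n (W j))" using V W that by (auto intro: isev_smul)
    have "\<exists>t. Rel (X j, Y j, smul e (V j), smul n (W j)) t"
      by (rule Rel_exists[OF XI YI ev detv_nonzero[OF XI YI XYA ev]])
    then show ?thesis unfolding f_def prod.case by (rule someI_ex)
  qed
  have cardI: "card I = 16" and finI: "finite I"
    by (simp_all add: I_def card_cartesian_product card_gunits finite_gunits complex_eq_iff)
  have Iu: "e \<in> gunits" "n \<in> gunits" if "(j, e, n) \<in> I" for j e n using that by (auto simp: I_def gunits_def)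
  have inj: "inj_on f I"
  proof (rule inj_onI)
    fix p p' assume p: "p \<in> I" and p': "p' \<in> I" and eq: "f p = f p'"
    obtain j e n where pe: "p = (j, e, n)" by (cases p)
    obtain j' e' n' where pe': "p' = (j', e', n')" by (cases p')
    have R1: "Rel (X j, Y j, smul e (V j), smul n (W j)) (f p)" unfolding pe using p Iu by (intro Rf) (auto simp: pe)
    have R2: "Rel (X j', Y j', smul e' (V j'), smul n' (W j')) (f p)" unfolding eq pe' using p' Iu by (intro Rf) (auto simp: pe')
    obtain k where k: "k \<in> Gam" "X j' = mconj k (X j)" "Y j' = mconj k (Y j)"
      "smul e' (V j') = app k (smul e (V j))" "smul n' (W j') = app k (smul n (W j))"
      using Rel_orbit[OF R1 R2] by blast
    have "X j' ** Y j' = mconj k (X j ** Y j)" using k by (simp add: mconj_mult)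
    \<comment> \<open>Equality up to sign becomes equality, since conjugates share their nonzero
      trace; so \<open>k\<close> lies in the centralizer.\<close>
    then have "mconj k A = A"
      using XYA[of j] XYA[of j'] conj_A_neq[OF k(1)] by (metis mconj_uminus(1) minus_minus)
    then have "k ** A = A ** k" using mconj_eq_iff[OF k(1)] by blast
    then obtain h where h: "h \<in> H" "k = D h" using commutant[OF k(1)] by blast
    have hi: "inverse h \<in> H" "h \<noteq> 0" using h H_inverse H_nz by auto
    have "xj j' = mconj k (xj j) \<or> xj j' = - mconj k (xj j)"
      using Xx[of j] Xx[of j'] k(2) by (metis mconj_uminus(1) minus_minus)
    moreover have "mconj k (xj j) = x0 ** D (h0 ^ j * (inverse h * inverse h))"
    proof -
      have "mconj k (xj j) = x0 ** (D (h0 ^ j) ** D (inverse h) ** D (inverse h))"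
        unfolding h(2) conj_D[OF xrev] unfolding xj_def by (simp add: matrix_mul_assoc)
      also have "D (h0 ^ j) ** D (inverse h) ** D (inverse h) = D (h0 ^ j * (inverse h * inverse h))"
        using hi H_nz[OF pw] by (simp add: D_mult mult.assoc)
      finally show ?thesis .
    qed
    ultimately have "x0 ** D (h0 ^ j') = x0 ** D (h0 ^ j * (inverse h * inverse h)) \<or>
        x0 ** D (h0 ^ j') = x0 ** D (- (h0 ^ j * (inverse h * inverse h)))"
      unfolding xj_def by (simp add: D_uminus mat_uminus_mult)
    then have "D (h0 ^ j') = D (h0 ^ j * (inverse h * inverse h)) \<or> D (h0 ^ j') = D (- (h0 ^ j * (inverse h * inverse h)))"
      by (metis Gam_cancel(1) Invol_Gam x0)
    then have hh: "h0 ^ j' = h0 ^ j * (inverse h * inverse h) \<or> h0 ^ j' = - (h0 ^ j * (inverse h * inverse h))"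
      using D_inj by blast
    have jj: "j \<in> {0, 1}" "j' \<in> {0, 1}" using p p' by (auto simp: pe pe' I_def)
    \<comment> \<open>Otherwise \<open>h0\<close> would be a square up to sign.\<close>
    have "j = j'"
    proof (rule ccontr)
      assume "j \<noteq> j'"
      then consider "j = 0" "j' = 1" | "j = 1" "j' = 0" using jj by auto
      then show False
      proof cases
        case 1
        then show False using hh nsq[OF hi(1)] by simp
      next
        case 2
        then have "h0 * (inverse h * inverse h) = 1 \<or> h0 * (inverse h * inverse h) = -1" using hh by (auto simp: minus_equation_iff)
        then have "h0 = h * h \<or> h0 = - (h * h)" using hi(2) by (auto simp: field_simps)
        then show False using nsq[OF h(1)] by blast
      qed
    qed
    have *: "i = 1 \<or> i = -1" if "z = z * i \<or> z = - (z * i)" "z \<noteq> 0" for i z :: complex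
      using that by (metis minus_minus mult_cancel_left2 mult_minus_right)
    have "inverse h * inverse h = 1 \<or> inverse h * inverse h = -1"
      by (rule *[OF hh[folded \<open>j = j'\<close>] H_nz[OF pw]])
    then have "inverse h * inverse h = 1" using H_no_i[OF hi(1)] by blast
    then have "h * h = 1" by (metis inverse_1 inverse_inverse_eq inverse_mult_distrib)
    then have "(h - 1) * (h + 1) = 0" by (simp add: algebra_simps)
    then have "h = 1 \<or> h = - 1" by (auto simp: eq_neg_iff_add_eq_0)
    then have "k = mat 1 \<or> k = - mat 1" using h(2) D_one D_uminus[of 1] by auto
    moreover have pV: "prim (V j)" "prim (W j)" using V W by (auto simp: isev_def)
    \<comment> \<open>-1 would give e' = -e, but both lie in {1, \<i>}.\<close>
    have "k \<noteq> - mat 1"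
    proof
      assume "k = - mat 1"
      then have "smul e' (V j) = smul (- e) (V j)" using k(4) \<open>j = j'\<close> by simp
      then have "e' = - e" using prim_nonzero[OF pV(1)] by blast
      then show False using p p' by (auto simp: pe pe' I_def complex_eq_iff)
    qed
    ultimately have "k = mat 1" by blast
    then have "smul e' (V j) = smul e (V j)" "smul n' (W j) = smul n (W j)" using k \<open>j = j'\<close> by simp_all
    then have "e' = e" "n' = n" using prim_nonzero pV by blast+
    then show "p = p'" using \<open>j = j'\<close> by (simp add: pe pe')
  qed
  have sub1: "f ` I \<subseteq> {t \<in> Tuples. tup_class t = mat_class A \<and> min_tuple t}"
  proof
    fix t assume "t \<in> f ` I"
    then obtain j e n where jen: "(j, e, n) \<in> I" "t = f (j, e, n)" by auto
    have "Rel (X j, Y j, smul e (V j), smul n (W j)) t" unfolding jen(2) using Iu[OF jen(1)] by (rule Rf)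
    then obtain k where t: "t \<in> Tuples" and k: "k \<in> Gam" "X j = mconj k (tup_x t)" "Y j = mconj k (tup_y t)" unfolding Rel_def by auto
    have tG: "tup_x t \<in> Invol" "tup_y t \<in> Invol" using tup_x_tup_y[OF t] by auto
    have "A = mconj k (tup_x t ** tup_y t) \<or> A = - mconj k (tup_x t ** tup_y t)"
      using XYA[of j] k by (auto simp: mconj_mult)
    then have "tup_class t = mat_class A" using mat_class_eq_iff[of "tup_x t ** tup_y t" A] tG A k(1) by (auto simp: Invol_Gam)
    moreover have "det_norm (tup_x t) (tup_y t) \<le> det_norm x y" if xy: "(x, y) \<in> signs (tup_x t) (tup_y t)" for x y
    proof -
      have xyI: "x \<in> Invol" "y \<in> Invol" using xy tG by (auto simp: signs_def)
      have "(mconj k x, mconj k y) \<in> signs (X j) (Y j)" using xy k by (auto simp: signs_def)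
      then have "(mconj k x, mconj k y) \<in> signs (xj j) (yj j)" using signs_sym[OF sXY] by blast
      then have "det_norm (X j) (Y j) \<le> det_norm (mconj k x) (mconj k y)" by (rule minXY)
      then show ?thesis unfolding k(2,3) det_norm_mconj[OF k(1) tG] det_norm_mconj[OF k(1) xyI] .
    qed
    ultimately show "t \<in> {t \<in> Tuples. tup_class t = mat_class A \<and> min_tuple t}" using t by (auto simp: min_tuple_def)
  qed
  have sub2: "{t \<in> Tuples. tup_class t = mat_class A \<and> strict_tuple t} \<subseteq> f ` I"
  proof
    fix t assume "t \<in> {t \<in> Tuples. tup_class t = mat_class A \<and> strict_tuple t}"
    then have t: "t \<in> Tuples" "tup_class t = mat_class A" "strict_tuple t" by auto
    have tG: "tup_x t \<in> Invol" "tup_y t \<in> Invol" using tup_x_tup_y[OF t(1)] by auto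
    then have "tup_x t ** tup_y t \<in> Gam" by (auto simp: Invol_Gam)
    then obtain k where k: "k \<in> Gam" "A = mconj k (tup_x t ** tup_y t) \<or> A = - mconj k (tup_x t ** tup_y t)"
      using mat_class_eq_iff[OF _ A] t(2) by blast
    define x y where "x = mconj k (tup_x t)" and "y = mconj k (tup_y t)"
    have xyI: "x \<in> Invol" "y \<in> Invol" using tG k by (auto simp: x_def y_def intro: Invol_mconj)
    have xyA': "x ** y = A \<or> x ** y = - A" using k by (auto simp: x_def y_def mconj_mult)
    have xr: "x ** A = adj A ** x" by (rule Invol_product_reverser[OF xyI xyA'])
    have x0G: "x0 \<in> Gam" using x0 by (rule Invol_Gam)
    have x0': "adj x0 ** adj A = A ** adj x0"
    proof -
      have "x0 ** adj A = A ** x0" using reverser_D[OF rev, of "inverse lam"] by (simp add: D_inverse D_lam)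
      then show ?thesis by (simp add: Invol_adj[OF x0] mat_uminus_mult)
    qed
    \<comment> \<open>Two reversers differ by an element of the centralizer.\<close>
    have "(adj x0 ** x) ** A = A ** (adj x0 ** x)"
      by (metis matrix_mul_assoc x0' xr)
    moreover have "adj x0 ** x \<in> Gam" using x0G xyI Invol_Gam by auto
    ultimately obtain h where h: "h \<in> H" "adj x0 ** x = D h" using commutant by blast
    have xD: "x = x0 ** D h" using Gam_cancel(2)[OF x0G, of x] h(2) by simp
    obtain g j where g: "g \<in> H" "j \<in> {0, 1::nat}" "h = h0 ^ j * (g * g) \<or> h = - (h0 ^ j * (g * g))"
      using gen[OF h(1)] by blast
    have gnz: "g \<noteq> 0" "h0 ^ j \<noteq> 0" using H_nz g pw by blast+
    have cx: "mconj (D g) x = x0 ** D (h * (inverse g * inverse g))"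
    proof -
      have "mconj (D g) x = x0 ** (D h ** D (inverse g) ** D (inverse g))"
        unfolding conj_D[OF xr] unfolding xD by (simp add: matrix_mul_assoc)
      also have "D h ** D (inverse g) ** D (inverse g) = D (h * (inverse g * inverse g))"
        using gnz H_nz[OF h(1)] by (simp add: D_mult mult.assoc)
      finally show ?thesis .
    qed
    have "h * (inverse g * inverse g) = h0 ^ j \<or> h * (inverse g * inverse g) = - (h0 ^ j)"
      using g(3) gnz by (auto simp: field_simps)
    then have cxj: "mconj (D g) x = xj j \<or> mconj (D g) x = - xj j"
      unfolding cx xj_def by (auto simp: D_uminus mat_uminus_mult)
    have DG: "D g \<in> Gam" by (rule H_Gam[OF g(1)])
    have cA: "mconj (D g) A = A" using mconj_eq_iff[OF DG] D_commute by blast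
    have "x ** (x ** y) = - y" using Invol_sq[OF xyI(1)] by (simp add: matrix_mul_assoc mat_uminus_mult)
    then have "y = - (x ** A) \<or> y = x ** A" using xyA' by (auto simp: mat_uminus_mult)
    then have "mconj (D g) y = - (mconj (D g) x ** A) \<or> mconj (D g) y = mconj (D g) x ** A"
      by (auto simp: mconj_mult[OF DG] cA)
    then have cyj: "mconj (D g) y = yj j \<or> mconj (D g) y = - yj j"
      using cxj by (auto simp: yj_def mat_uminus_mult)
    define m where "m = D g ** k"
    have mG: "m \<in> Gam" using DG k by (simp add: m_def Gam_mult)
    have mx: "mconj (D g) x = mconj m (tup_x t)" "mconj (D g) y = mconj m (tup_y t)" by (simp_all add: m_def x_def y_def mconj_mconj)
    have inS: "(mconj m (tup_x t), mconj m (tup_y t)) \<in> signs (xj j) (yj j)" using cxj cyj unfolding mx by (auto simp: signs_def)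
    have "(X j, Y j) \<in> signs (mconj m (tup_x t)) (mconj m (tup_y t))" using sXY[of j] signs_sym[OF inS] by simp
    then obtain x' y' where xy': "(x', y') \<in> signs (tup_x t) (tup_y t)" "X j = mconj m x'" "Y j = mconj m y'"
      by (auto simp: signs_def) (metis mconj_uminus(1))+
    have I': "x' \<in> Invol" "y' \<in> Invol" using xy'(1) tG by (auto simp: signs_def)
    \<comment> \<open>The chosen minimal pair and that of \<open>t\<close> differ only by signs, and
      strictness leaves a single minimiser.\<close>
    have "det_norm x' y' \<le> det_norm (tup_x t) (tup_y t)"
      using minXY[OF inS] unfolding xy'(2,3) det_norm_mconj[OF mG tG] det_norm_mconj[OF mG I'] .
    then have "x' = tup_x t" "y' = tup_y t" using xy'(1) t(3) by (auto simp: signs_def strict_tuple_def)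
    then have XYm: "X j = mconj m (tup_x t)" "Y j = mconj m (tup_y t)" using xy' by auto
    have "isev (X j) (app m (1, 0))" "isev (Y j) (app m (tup_w t))"
      unfolding XYm using tup_x_tup_y[OF t(1)] mG by (auto intro: isev_mconj)
    then obtain e n where en: "e \<in> gunits" "app m (1, 0) = smul e (V j)" "n \<in> gunits" "app m (tup_w t) = smul n (W j)"
      using isev_unit V W XI YI Invol_Gam by metis
    have fin: "t = f (j, e', n')" if "e' \<in> gunits" "n' \<in> gunits" "k' \<in> Gam" "X j = mconj k' (tup_x t)" "Y j = mconj k' (tup_y t)"
      "app k' (1, 0) = smul e' (V j)" "app k' (tup_w t) = smul n' (W j)" for e' n' k'
    proof -
      have "Rel (X j, Y j, smul e' (V j), smul n' (W j)) t"
        unfolding Rel_def using that t(1) by auto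
      moreover have "Rel (mconj (mat 1) (X j), mconj (mat 1) (Y j), app (mat 1) (smul e' (V j)), app (mat 1) (smul n' (W j))) (f (j, e', n'))"
        using Rf[OF that(1,2)] by simp
      ultimately show ?thesis by (rule Rel_unique) simp
    qed
    show "t \<in> f ` I"
    proof (cases "e \<in> {1, \<i>}")
      case True
      then have "(j, e, n) \<in> I" using g(2) en by (simp add: I_def)
      then show ?thesis using fin[OF en(1,3) mG XYm en(2,4)] by blast
    next
      case False
      \<comment> \<open>Pass from \<open>m\<close> to \<open>- m\<close>, which conjugates
        identically and negates both units.\<close>
      then have e: "- e \<in> {1, \<i>}" "- e \<in> gunits" "- n \<in> gunits" using en by (auto simp: gunits_def)
      then have "(j, - e, - n) \<in> I" using g(2) by (simp add: I_def)
      moreover have "t = f (j, - e, - n)"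
        by (rule fin[of _ _ "- m"]) (use e mG XYm en in simp_all)
      ultimately show ?thesis by blast
    qed
  qed
  have "card (f ` I) = 16" using card_image[OF inj] cardI by simp
  then show thesis using that[of "f ` I"] finI sub1 sub2 by simp
qed

end

section \<open>The asymptotic formula\<close>

lemma tuples_Tup: "t \<in> tuples C X \<Longrightarrow> t \<in> Tuples"
  by (auto simp: tuples_def Tuples_def)

lemma rev_lox_fibre:
  assumes A: "A \<in> Gam" and rv: "reversible (PSL2 ZI) {A, - A}" and lx: "loxodromic {A, - A}"
  obtains F where "finite F" "card F = 16" "F \<subseteq> {t \<in> Tuples. tup_class t = mat_class A \<and> min_tuple t}"
    "{t \<in> Tuples. tup_class t = mat_class A \<and> strict_tuple t} \<subseteq> F"
proof -
  have tr: "trace A \<notin> complex_of_real ` {-2..2}" using loxodromic_iff[OF A] lx by simp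
  obtain x0 where x0: "x0 \<in> Invol" "x0 ** A = adj A ** x0" using reversible_reverser[OF A tr] rv by blast
  interpret rev_lox A x0 "A$1$1" "A$1$2" "A$2$1" "A$2$2"
    by unfold_locales (use A tr x0 mk_eta in auto)
  show thesis using fibre that by blast
qed

lemma tup_class_trace:
  assumes A: "A \<in> Gam" and t: "t \<in> Tuples" and e: "tup_class t = mat_class A"
  shows "cmod (trace (tup_x t ** tup_y t)) = cmod (trace A)"
proof -
  have "tup_x t ** tup_y t \<in> Gam" using tup_x_tup_y[OF t] by (auto simp: Invol_Gam)
  then obtain X where "X \<in> Gam" "A = mconj X (tup_x t ** tup_y t) \<or> A = - mconj X (tup_x t ** tup_y t)"
    using mat_class_eq_iff[OF _ A] e by blast
  then show ?thesis by (auto simp: trace_mconj)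
qed

lemma sum_card_fibres:
  assumes "finite R" "finite S"
  shows "(\<Sum>K\<in>R. card {t \<in> S. h t = K}) = card {t \<in> S. h t \<in> R}"
proof -
  have "card (\<Union>K\<in>R. {t \<in> S. h t = K}) = (\<Sum>K\<in>R. card {t \<in> S. h t = K})"
    using assms by (intro card_UN_disjoint) auto
  moreover have "(\<Union>K\<in>R. {t \<in> S. h t = K}) = {t \<in> S. h t \<in> R}" by auto
  ultimately show ?thesis by simp
qed

text \<open>Each class supplies at least 16 minimal tuples, and minimality gives |s| <= |W| and |s|
  <= |Q|, that is C = 1. The bound sqrt T + 2 absorbs the 2 in the trace Q W + 2.\<close>

lemma rev_lox_classes_upper:
  assumes T: "T > 0"
  shows "finite (rev_lox_classes T)" "16 * card (rev_lox_classes T) \<le> card (tuples 1 ((sqrt T + 2)\<^sup>2))"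
proof -
  let ?R = "rev_lox_classes T" and ?S = "tuples 1 ((sqrt T + 2)\<^sup>2)"
  have finS: "finite ?S" by (rule finite_tuples) simp
  have key: "\<exists>F. card F = 16 \<and> F \<subseteq> {t \<in> ?S. tup_class t = K}" if K: "K \<in> ?R" for K
  proof -
    obtain A where A: "K = mat_class A" "A \<in> Gam" "reversible (PSL2 ZI) {A, - A}" "loxodromic {A, - A}" "(cmod (trace A))\<^sup>2 \<le> T"
      using K unfolding rev_lox_classes_eq by blast
    obtain F where "finite F" and F: "card F = 16" "F \<subseteq> {t \<in> Tuples. tup_class t = mat_class A \<and> min_tuple t}"
      and "{t \<in> Tuples. tup_class t = mat_class A \<and> strict_tuple t} \<subseteq> F"
      using A(2,3,4) by (rule rev_lox_fibre)
    have "F \<subseteq> {t \<in> ?S. tup_class t = K}"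
    proof
      fix t assume "t \<in> F"
      then have t: "t \<in> Tuples" "tup_class t = mat_class A" "min_tuple t" using F by auto
      obtain s u B Q where ts: "t = (s, u, B, Q)" by (cases t)
      define W where "W = 2 * \<i> * u + B * s"
      have "cmod (Q * W + 2) = cmod (trace A)"
        using tup_class_trace[OF A(2) t(1,2)] trace_tup[OF t(1) ts] by (simp add: W_def)
      also have "\<dots> \<le> sqrt T" using A(5) by (rule real_le_rsqrt)
      finally have "cmod (Q * W) \<le> sqrt T + 2"
        using norm_triangle_ineq4[of "Q * W + 2" 2] by simp
      then have "(cmod (Q * W))\<^sup>2 \<le> (sqrt T + 2)\<^sup>2" by (intro power_mono) auto
      moreover have "det_norm (tup_x t) (tup_y t) \<le> det_norm (- tup_x t) (tup_y t)" "det_norm (tup_x t) (tup_y t) \<le> det_norm (tup_x t) (- tup_y t)"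
        using t(3) by (auto simp: min_tuple_def signs_def)
      then have "(cmod s)\<^sup>2 \<le> (cmod W)\<^sup>2" "(cmod s)\<^sup>2 \<le> (cmod Q)\<^sup>2"
        using det_norm_tuple[OF t(1) ts] unfolding W_def by linarith+
      ultimately have "t \<in> ?S" using t(1) by (simp add: ts tuples_def Tuples_def W_def)
      then show "t \<in> {t \<in> ?S. tup_class t = K}" using t A by simp
    qed
    then show ?thesis using F by blast
  qed
  have "?R \<subseteq> tup_class ` ?S"
  proof
    fix K assume "K \<in> ?R"
    then obtain F where F: "card F = 16" "F \<subseteq> {t \<in> ?S. tup_class t = K}" using key by blast
    then have "F \<noteq> {}" by auto
    then show "K \<in> tup_class ` ?S" using F by blast
  qed
  then show finR: "finite ?R" using finS finite_surj by blast
  have "16 \<le> card {t \<in> ?S. tup_class t = K}" if K: "K \<in> ?R" for K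
  proof -
    obtain F where F: "card F = 16" "F \<subseteq> {t \<in> ?S. tup_class t = K}" using key[OF K] by blast
    then show ?thesis using card_mono[OF _ F(2)] finS by simp
  qed
  then have "(\<Sum>K\<in>?R. 16) \<le> (\<Sum>K\<in>?R. card {t \<in> ?S. tup_class t = K})" by (rule sum_mono)
  also have "\<dots> = card {t \<in> ?S. tup_class t \<in> ?R}" by (rule sum_card_fibres[OF finR finS])
  also have "\<dots> \<le> card ?S" using finS by (intro card_mono) auto
  finally show "16 * card ?R \<le> card ?S" by simp
qed

text \<open>With C = 9 one sign change gives a determinant of norm at least (9/4) |s|^2. Changing
  both uses |Q W + 4| >= 9 |s|^2 - 4 >= 5 |s|^2 and gives (25/16) |s|^2, so (C - 4)^2 > 16 is the
  binding condition. Moreover |Q W| >= 9 keeps the trace outside [-2, 2].\<close>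

lemma tuples_9:
  assumes T: "T \<ge> 16" and t: "t \<in> tuples 9 ((sqrt T - 2)\<^sup>2)"
  shows "tup_class t \<in> rev_lox_classes T" "strict_tuple t"
proof -
  obtain s u B Q where ts: "t = (s, u, B, Q)" by (cases t)
  define W where "W = 2 * \<i> * u + B * s"
  have tT: "t \<in> Tuples" using t by (rule tuples_Tup)
  have s: "s \<in> ZI" "s \<noteq> 0" and b: "9 * (cmod s)\<^sup>2 \<le> (cmod W)\<^sup>2" "9 * (cmod s)\<^sup>2 \<le> (cmod Q)\<^sup>2"
    "(cmod (Q * W))\<^sup>2 \<le> (sqrt T - 2)\<^sup>2" using t by (auto simp: ts tuples_def W_def)
  have s1: "(cmod s)\<^sup>2 \<ge> 1" using s by (rule ZI_norm_ge_1)
  have "(9 * (cmod s)\<^sup>2) * (9 * (cmod s)\<^sup>2) \<le> (cmod Q)\<^sup>2 * (cmod W)\<^sup>2" using b by (intro mult_mono) auto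
  then have "(9 * (cmod s)\<^sup>2)\<^sup>2 \<le> (cmod (Q * W))\<^sup>2"
    unfolding norm_mult power_mult_distrib[of "cmod Q"] power2_eq_square[of "9 * (cmod s)\<^sup>2"] .
  then have QW: "9 * (cmod s)\<^sup>2 \<le> cmod (Q * W)" by (rule power2_le_imp_le) simp
  have T4: "sqrt T \<ge> 4" using T real_le_rsqrt[of 4 T] by simp
  have QW2: "cmod (Q * W) \<le> sqrt T - 2" using b(3) T4 by (intro power2_le_imp_le[of "cmod (Q * W)"]) auto
  let ?A = "tup_x t ** tup_y t"
  have I: "tup_x t \<in> Invol" "tup_y t \<in> Invol" using tup_x_tup_y[OF tT] by auto
  then have A: "?A \<in> Gam" by (auto simp: Invol_Gam)
  have tr: "trace ?A = Q * W + 2" using trace_tup[OF tT ts] by (simp add: W_def)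
  have "cmod (Q * W) \<le> cmod (Q * W + 2) + 2" using norm_triangle_ineq4[of "Q * W + 2" 2] by simp
  then have "cmod (trace ?A) \<ge> 7" unfolding tr using QW s1 by linarith
  then have lx: "trace ?A \<notin> complex_of_real ` {-2..2}" by auto
  have "cmod (trace ?A) \<le> sqrt T" unfolding tr using norm_triangle_ineq[of "Q * W" 2] QW2 by simp
  then have "(cmod (trace ?A))\<^sup>2 \<le> (sqrt T)\<^sup>2" by (intro power_mono) auto
  then have "(cmod (trace ?A))\<^sup>2 \<le> T" using T by simp
  moreover have "tup_x t ** ?A = adj ?A ** tup_x t" by (rule Invol_product_reverser[OF I]) simp
  then have "reversible (PSL2 ZI) {?A, - ?A}" using reversible_reverser[OF A lx] I by blast
  moreover have "loxodromic {?A, - ?A}" using loxodromic_iff[OF A] lx by simp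
  ultimately show "tup_class t \<in> rev_lox_classes T" unfolding rev_lox_classes_eq using A by blast
  note S = det_norm_tuple[OF tT ts, folded W_def]
  have "cmod (Q * W) \<le> cmod (Q * W + 4) + 4" using norm_triangle_ineq4[of "Q * W + 4" 4] by simp
  then have "5 * (cmod s)\<^sup>2 \<le> cmod (Q * W + 4)" using QW s1 by linarith
  then have "(5 * (cmod s)\<^sup>2)\<^sup>2 \<le> (cmod (Q * W + 4))\<^sup>2" by (intro power_mono) auto
  also have "\<dots> \<le> 16 * (cmod s)\<^sup>2 * det_norm (- tup_x t) (- tup_y t)" by (rule S(6))
  finally have "(cmod s)\<^sup>2 * (25 * (cmod s)\<^sup>2) \<le> (cmod s)\<^sup>2 * (16 * det_norm (- tup_x t) (- tup_y t))"
    by (simp add: power2_eq_square mult_ac)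
  then have "25 * (cmod s)\<^sup>2 \<le> 16 * det_norm (- tup_x t) (- tup_y t)" using s by (subst (asm) mult_le_cancel_left_pos) auto
  then show "strict_tuple t" unfolding strict_tuple_def S(1) using S(3,5) b s1 by linarith
qed

text \<open>All tuples counted here are strict, so each class meets them only inside its 16 tuples
  from \<open>rev_lox_fibre\<close>.\<close>

lemma rev_lox_classes_lower:
  assumes T: "T \<ge> 16"
  shows "card (tuples 9 ((sqrt T - 2)\<^sup>2)) \<le> 16 * card (rev_lox_classes T)"
proof -
  let ?R = "rev_lox_classes T" and ?S = "tuples 9 ((sqrt T - 2)\<^sup>2)"
  have finS: "finite ?S" by (rule finite_tuples) simp
  have finR: "finite ?R" using T by (intro rev_lox_classes_upper) simp
  have "?S = {t \<in> ?S. tup_class t \<in> ?R}" using tuples_9[OF T] by blast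
  then have "card ?S = (\<Sum>K\<in>?R. card {t \<in> ?S. tup_class t = K})" using sum_card_fibres[OF finR finS, of tup_class] by simp
  also have "\<dots> \<le> (\<Sum>K\<in>?R. 16)"
  proof (rule sum_mono)
    fix K assume "K \<in> ?R"
    then obtain A where A: "K = mat_class A" "A \<in> Gam" "reversible (PSL2 ZI) {A, - A}" "loxodromic {A, - A}"
      unfolding rev_lox_classes_eq by blast
    obtain F where F: "finite F" "card F = 16" and "F \<subseteq> {t \<in> Tuples. tup_class t = mat_class A \<and> min_tuple t}"
      and F3: "{t \<in> Tuples. tup_class t = mat_class A \<and> strict_tuple t} \<subseteq> F"
      using A(2,3,4) by (rule rev_lox_fibre)
    have "{t \<in> ?S. tup_class t = K} \<subseteq> F"
    proof
      fix t assume "t \<in> {t \<in> ?S. tup_class t = K}"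
      then have "t \<in> ?S" "tup_class t = mat_class A" using A(1) by auto
      then have "t \<in> {t \<in> Tuples. tup_class t = mat_class A \<and> strict_tuple t}"
        using tuples_9(2)[OF T] tuples_Tup[of t 9] by blast
      then show "t \<in> F" using F3 by (rule rev_subsetD)
    qed
    from card_mono[OF F(1) this] show "card {t \<in> ?S. tup_class t = K} \<le> 16" unfolding F(2) .
  qed
  finally show ?thesis by simp
qed

text \<open>Inserting \<open>zeta_sum\<close> gives kappa = 3 / (pi G); the factor 16 is the number
  of tuples per class.\<close>

lemma leading_constant: "pi\<^sup>2 * kappa / 2 = 16 * (3 * pi / (32 * catalan))"
proof -
  have "catalan \<noteq> 0" using zeta_sum_bounds(1) by (auto simp: zeta_sum_def)
  then show ?thesis by (simp add: kappa_def zeta_sum_def power2_eq_square field_simps)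
qed

theorem theorem1p2:
  shows "(\<forall>T>0. finite (rev_lox_classes T)) \<and>
    (\<lambda>T::real. real (card (rev_lox_classes T)) - 3 * pi / (32 * catalan) * T * (ln T)\<^sup>2)
      \<in> O[at_top](\<lambda>T. T * ln T * (ln (ln T))\<^sup>2)"
proof
  show "\<forall>T>0. finite (rev_lox_classes T)" using rev_lox_classes_upper by blast
  define q where "q = pi\<^sup>2 * kappa / 2"
  let ?g = "\<lambda>T::real. T * ln T * (ln (ln T))\<^sup>2"
  let ?f = "\<lambda>T::real. real (card (rev_lox_classes T)) - 3 * pi / (32 * catalan) * T * (ln T)\<^sup>2"
  define X1 X2 where "X1 = (\<lambda>T::real. (sqrt T + 2)\<^sup>2)" and "X2 = (\<lambda>T::real. (sqrt T - 2)\<^sup>2)"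
  define U L where "U = (\<lambda>T. q * (X1 T * (ln (X1 T))\<^sup>2 - T * (ln T)\<^sup>2) + tuple_const 1 * (X1 T * (ln (X1 T) + 1)))"
    and "L = (\<lambda>T. q * (X2 T * (ln (X2 T))\<^sup>2 - T * (ln T)\<^sup>2) - tuple_const 9 * (X2 T * (ln (X2 T) + 1)))"
  \<comment> \<open>Shifting sqrt T by 2 changes T (ln T)^2 only by O(sqrt T (ln T)^2).\<close>
  have "(\<lambda>T::real. (sqrt T + 2)\<^sup>2 * (ln ((sqrt T + 2)\<^sup>2))\<^sup>2 - T * (ln T)\<^sup>2) \<in> O(?g)"
    "(\<lambda>T::real. (sqrt T - 2)\<^sup>2 * (ln ((sqrt T - 2)\<^sup>2))\<^sup>2 - T * (ln T)\<^sup>2) \<in> O(?g)"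
    "(\<lambda>T::real. (sqrt T + 2)\<^sup>2 * (ln ((sqrt T + 2)\<^sup>2) + 1)) \<in> O(?g)"
    "(\<lambda>T::real. (sqrt T - 2)\<^sup>2 * (ln ((sqrt T - 2)\<^sup>2) + 1)) \<in> O(?g)"
    by real_asymp+
  then have UL: "U \<in> O(?g)" "L \<in> O(?g)"
    unfolding U_def L_def X1_def X2_def by (auto intro!: sum_in_bigo simp: cmult_in_bigo_iff)
  have "\<bar>16 * ?f T\<bar> \<le> \<bar>U T\<bar> + \<bar>L T\<bar>" if T: "T \<ge> 16" for T
  proof -
    have T4: "sqrt T \<ge> 4" using T real_le_rsqrt[of 4 T] by simp
    have X: "X1 T \<ge> 1" "X2 T \<ge> 1" unfolding X1_def X2_def using T4 by (auto intro: one_le_power)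
    have "16 * real (card (rev_lox_classes T)) \<le> real (card (tuples 1 (X1 T)))"
      using rev_lox_classes_upper(2)[of T] T unfolding X1_def by linarith
    moreover have "real (card (tuples 9 (X2 T))) \<le> 16 * real (card (rev_lox_classes T))"
      using rev_lox_classes_lower[OF T] unfolding X2_def by linarith
    moreover have "real (card (tuples 1 (X1 T))) \<le> q * X1 T * (ln (X1 T))\<^sup>2 + tuple_const 1 * X1 T * (ln (X1 T) + 1)"
      using card_tuples[of 1 "X1 T"] X unfolding q_def by linarith
    moreover have "q * X2 T * (ln (X2 T))\<^sup>2 - tuple_const 9 * X2 T * (ln (X2 T) + 1) \<le> real (card (tuples 9 (X2 T)))"
      using card_tuples[of 9 "X2 T"] X unfolding q_def by linarith
    moreover have "16 * ?f T = 16 * real (card (rev_lox_classes T)) - q * (T * (ln T)\<^sup>2)"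
      unfolding q_def leading_constant by (simp add: algebra_simps)
    moreover have "U T = q * X1 T * (ln (X1 T))\<^sup>2 - q * (T * (ln T)\<^sup>2) + tuple_const 1 * X1 T * (ln (X1 T) + 1)"
      "L T = q * X2 T * (ln (X2 T))\<^sup>2 - q * (T * (ln T)\<^sup>2) - tuple_const 9 * X2 T * (ln (X2 T) + 1)"
      unfolding U_def L_def by (simp_all only: right_diff_distrib mult.assoc)
    ultimately have "16 * ?f T \<le> U T" "L T \<le> 16 * ?f T" by linarith+
    then show ?thesis by linarith
  qed
  then have "(\<lambda>T. 16 * ?f T) \<in> O(\<lambda>T. \<bar>U T\<bar> + \<bar>L T\<bar>)"
    by (intro bigoI[where c = 1] eventually_mono[OF eventually_ge_at_top[of 16]]) auto
  also have "(\<lambda>T. \<bar>U T\<bar> + \<bar>L T\<bar>) \<in> O(?g)" using UL by (intro sum_in_bigo) auto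
  finally have "(\<lambda>T. 16 * ?f T) \<in> O(?g)" .
  then show "?f \<in> O(?g)" by (subst (asm) cmult_in_bigo_iff) simp
qed

end
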